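(* Let $s\ge1$. 1. The interior Euler operator $I$ restricted to $\Omega^{n,s}_0$ preserves the jet-order filtration, i.e. $I(\mathrm{F}^l\Omega^{n,s}_0)\subset\mathrm{F}^l\Omega^{n,s}_0$ for all $l\ge0$. 2. For every $l\ge 0$, the induced map on the graded component, $\bar I\colon \mathrm{Gr}^l\Omega^{n,s}_0\to\mathrm{Gr}^l\Omega^{n,s}_0$, $\bar I(\omega+\mathrm{F}^{l-1}\Omega^{n,s}_0)=I(\omega)+\mathrm{F}^{l-1}\Omega^{n,s}_0$ for $\omega\in\mathrm{F}^l\Omega^{n,s}_0$, is an idempotent homomorphism of $\mathcal R^\infty$-modules.
   Context: Let $\pi\colon E\to M$ be a smooth fibre bundle with finite-dimensional fibres over an $n$-dimensional manifold $M$ with a chosen volume form $\nu$. Let $x^i$ ($1\le i\le n$) be local coordinates on $M$ and $u^\alpha$ local fibre coordinates on $E$. The $k$-jet space $J^kE$ has fibre coordinates $u^\alpha_I$, $0\le|I|\le k$, over $M$, where $I$ is an unordered (symmetric) multi-index with entries in $\{1,\dots,n\}$ and $|I|$ is its length; $Ij$ denotes $I$ with $j$ appended. $J^\infty E$ is the inverse limit of the $J^kE$. Smooth functions and forms on $J^\infty E$ are those of finite order: $\mathcal R^\infty=\bigcup_{k\ge0}C^\infty(J^kE)$ and $\Omega^p(J^\infty E)=\bigcup_{k\ge0}\Omega^p(J^kE)$ (identified via pull-back). Contact forms are $\theta^\alpha_I=du^\alpha_I-u^\alpha_{Ij}dx^j$ (summation convention), and $\theta^\alpha:=\theta^\alpha_\emptyset$.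 $\Omega^{n,s}=\Omega^{n,s}(J^\infty E)$ is the $\mathcal R^\infty$-module of forms of horizontal degree $n$ and vertical degree $s$: locally, finite $\mathcal R^\infty$-linear combinations of $\theta^{\alpha_1}_{I_1}\wedge\cdots\wedge\theta^{\alpha_s}_{I_s}\wedge\nu$. For $s\ge 1$, $\Omega^{n,s}_0\subset\Omega^{n,s}$ is the $\mathcal R^\infty$-submodule of forms which are locally $\mathcal R^\infty$-linear combinations of $\theta^{\alpha_1}\wedge\theta^{\alpha_2}_{I_2}\wedge\cdots\wedge\theta^{\alpha_s}_{I_s}\wedge\nu$ (first factor undifferentiated). For $l\ge0$, $\mathrm{F}^l\Omega^{n,s}_0$ is the $\mathcal R^\infty$-submodule of those forms which are locally $\mathcal R^\infty$-linear combinations of $\theta^{\alpha_1}\wedge\theta^{\alpha_2}_{I_2}\wedge\cdots\wedge\theta^{\alpha_s}_{I_s}\wedge\nu$ with $|I_2|+\cdots+|I_s|\le l$; $\mathrm{F}^{-1}\Omega^{n,s}_0=0$; and $\mathrm{Gr}^l\Omega^{n,s}_0=\mathrm{F}^l\Omega^{n,s}_0/\mathrm{F}^{l-1}\Omega^{n,s}_0$. These do not depend on the choice of coordinates. The total derivative is $D_j=\frac{\partial}{\partial x^j}+\sum_{|I|\ge0}u^\alpha_{Ij}\frac{\partial}{\partial u^\alpha_I}$; it acts on forms by Lie derivative, so $D_j\theta^\alpha_I=\theta^\alpha_{Ij}$ and $D_jdx^i=0$. For $I=(i_1,\dots,i_k)$, $(-D)_I=(-1)^kD_{i_1}\cdots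 D_{i_k}$. Put $\partial^I_\alpha=\partial/\partial u^\alpha_I$. For $s\ge1$ the interior Euler operator is the $\mathbb R$-linear map $I\colon\Omega^{n,s}\to\Omega^{n,s}$ given in local coordinates by $$I(\omega)=\frac1s\,\theta^\alpha\wedge\sum_{|I|\ge0}(-D)_I\big(\partial^I_\alpha\lrcorner\,\omega\big),$$ the sum being over all unordered multi-indices (the letter $I$ is used both for the operator and for multi-indices). It is standard that $I$ is independent of coordinates and that $I\circ I=I$. *)

theory Defs
  imports "HOL-Analysis.Analysis" "HOL-Algebra.Module" "HOL-Algebra.AbelCoset"
    "HOL-Library.Multiset"
begin

section \<open>Calculus in coordinate spaces\<close>

text \<open>
  All coordinates are indexed by one type: \<open>Base i\<close> stands for \<open>x\<^sup>i\<close> and \<open>Fib \<alpha> I\<close> for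
  \<open>u\<^sup>\<alpha>\<^sub>I\<close>, where the unordered multi-index \<open>I\<close> is a multiset. Indices start at 0.
  For a set \<open>C\<close> of coordinates the coordinate space is \<open>powertop_real C\<close>, whose points are
  functions that are \<open>undefined\<close> off \<open>C\<close>. For finite \<open>C\<close> it is a Euclidean space; for
  \<open>C = jet_coords n m\<close> it is the inverse limit of the coordinate spaces of the
  finite-order jet spaces.
\<close>

datatype coord = Base nat | Fib nat "nat multiset"

type_synonym point = "coord \<Rightarrow> real"
type_synonym form = "point \<Rightarrow> point list \<Rightarrow> real"

definition base_coords :: "nat \<Rightarrow> coord set" where
  "base_coords n = Base ` {..<n}"

definition fibre_coords :: "nat \<Rightarrow> coord set" where
  "fibre_coords m = (\<lambda>\<alpha>. Fib \<alpha> {#}) ` {..<m}"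

definition multi_indices :: "nat \<Rightarrow> nat multiset set" where
  "multi_indices n = {I. set_mset I \<subseteq> {..<n}}"

definition jet_coords :: "nat \<Rightarrow> nat \<Rightarrow> coord set" where
  "jet_coords n m = base_coords n \<union> {Fib \<alpha> I | \<alpha> I. \<alpha> < m \<and> I \<in> multi_indices n}"

fun coord_order :: "coord \<Rightarrow> nat" where
  "coord_order (Base i) = 0"
| "coord_order (Fib \<alpha> I) = size I"

definition jet_coords_upto :: "nat \<Rightarrow> nat \<Rightarrow> nat \<Rightarrow> coord set" where
  "jet_coords_upto n m k = {A \<in> jet_coords n m. coord_order A \<le> k}"

definition pd :: "coord \<Rightarrow> (point \<Rightarrow> real) \<Rightarrow> point \<Rightarrow> real" where
  "pd A f z = deriv (\<lambda>t. f (z(A := t))) (z A)"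

text \<open>Smoothness on an open set \<open>W\<close> of \<open>powertop_real C\<close>: all iterated partial derivatives
  exist and are continuous.\<close>

definition smooth :: "coord set \<Rightarrow> point set \<Rightarrow> (point \<Rightarrow> real) \<Rightarrow> bool" where
  "smooth C W f \<longleftrightarrow>
     (\<forall>As. set As \<subseteq> C \<longrightarrow>
        continuous_map (subtopology (powertop_real C) W) euclideanreal (foldr pd As f) \<and>
        (\<forall>A\<in>C. \<forall>z\<in>W. (\<lambda>t. foldr pd As f (z(A := t))) differentiable (at (z A))))"

text \<open>The sum \<open>sum'\<close> runs over the support of the summand, which is finite whenever \<open>f\<close> is
  of finite order.\<close>

definition dir_deriv :: "coord set \<Rightarrow> point \<Rightarrow> (point \<Rightarrow> real) \<Rightarrow> point \<Rightarrow> real" where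
  "dir_deriv C v f z = sum' (\<lambda>A. v A * pd A f z) C"

definition differential :: "coord set \<Rightarrow> (point \<Rightarrow> point) \<Rightarrow> point \<Rightarrow> point \<Rightarrow> point" where
  "differential C \<tau> z v = (\<lambda>A. dir_deriv C v (\<lambda>y. \<tau> y A) z)"

definition pullback :: "coord set \<Rightarrow> (point \<Rightarrow> point) \<Rightarrow> form \<Rightarrow> form" where
  "pullback C \<tau> \<omega> z vs = \<omega> (\<tau> z) (map (differential C \<tau> z) vs)"

text \<open>A \<open>p\<close>-form on a coordinate domain is evaluated at a point and a list of \<open>p\<close> tangent
  vectors, given by their components. \<open>wedge1 \<theta> \<omega>\<close> is \<open>\<theta> \<and> \<omega>\<close> for a 1-form \<open>\<theta>\<close>.\<close>

definition wedge1 :: "(point \<Rightarrow> point \<Rightarrow> real) \<Rightarrow> form \<Rightarrow> form" where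
  "wedge1 \<theta> \<omega> z vs =
     (\<Sum>i<length vs. (- 1) ^ i * \<theta> z (vs ! i) * \<omega> z (take i vs @ drop (Suc i) vs))"

definition interior_product :: "point \<Rightarrow> form \<Rightarrow> form" where
  "interior_product v \<omega> z vs = \<omega> z (v # vs)"

text \<open>Lie derivative along the vector field with components \<open>Y\<close>, from
  \<open>(L\<^sub>Y \<omega>)(v\<^sub>1,\<dots>,v\<^sub>p) = Y(\<omega>(v\<^sub>1,\<dots>,v\<^sub>p)) - \<Sum>\<^sub>i \<omega>(v\<^sub>1,\<dots>,[Y,v\<^sub>i],\<dots>,v\<^sub>p)\<close> for vector fields \<open>v\<^sub>i\<close>
  with constant components, where \<open>[Y,v\<^sub>i] = - dY(v\<^sub>i)\<close>.\<close>

definition lie_deriv :: "coord set \<Rightarrow> (point \<Rightarrow> point) \<Rightarrow> form \<Rightarrow> form" where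
  "lie_deriv C Y \<omega> z vs =
     dir_deriv C (Y z) (\<lambda>y. \<omega> y vs) z
     + (\<Sum>i<length vs. \<omega> z (vs[i := differential C Y z (vs ! i)]))"

definition depends_upto :: "nat \<Rightarrow> nat \<Rightarrow> nat \<Rightarrow> point set \<Rightarrow> (point \<Rightarrow> real) \<Rightarrow> bool" where
  "depends_upto n m k W f \<longleftrightarrow>
     (\<forall>z\<in>W. \<forall>z'\<in>W. (\<forall>A\<in>jet_coords_upto n m k. z A = z' A) \<longrightarrow> f z = f z')"

definition smooth_finite_order :: "nat \<Rightarrow> nat \<Rightarrow> point set \<Rightarrow> (point \<Rightarrow> real) \<Rightarrow> bool" where
  "smooth_finite_order n m W f \<longleftrightarrow>
     smooth (jet_coords n m) W f \<and> (\<exists>k. depends_upto n m k W f)"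

definition smooth_form_upto :: "nat \<Rightarrow> nat \<Rightarrow> nat \<Rightarrow> nat \<Rightarrow> point set \<Rightarrow> form \<Rightarrow> bool" where
  "smooth_form_upto n m k p W \<omega> \<longleftrightarrow>
     (\<forall>vs. length vs = p \<longrightarrow>
        smooth (jet_coords n m) W (\<lambda>z. \<omega> z vs) \<and> depends_upto n m k W (\<lambda>z. \<omega> z vs)) \<and>
     (\<forall>z\<in>W. \<forall>vs ws. length vs = p \<and>
        list_all2 (\<lambda>v w. \<forall>A\<in>jet_coords_upto n m k. v A = w A) vs ws \<longrightarrow> \<omega> z vs = \<omega> z ws) \<and>
     (\<forall>z\<in>W. \<forall>vs i v w a b. length vs = p \<and> i < p \<longrightarrow>
        \<omega> z (vs[i := \<lambda>A. a * v A + b * w A]) = a * \<omega> z (vs[i := v]) + b * \<omega> z (vs[i := w])) \<and>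
     (\<forall>z\<in>W. \<forall>vs i j. length vs = p \<and> i < j \<and> j < p \<and> vs ! i = vs ! j \<longrightarrow> \<omega> z vs = 0)"

section \<open>Contact forms, total derivatives and the local interior Euler operator\<close>

definition contact_form :: "nat \<Rightarrow> nat \<Rightarrow> nat multiset \<Rightarrow> point \<Rightarrow> point \<Rightarrow> real" where
  "contact_form n \<alpha> I z v = v (Fib \<alpha> I) - (\<Sum>j<n. z (Fib \<alpha> (add_mset j I)) * v (Base j))"

fun total_field :: "nat \<Rightarrow> point \<Rightarrow> point" where
  "total_field j z (Base i) = (if i = j then 1 else 0)"
| "total_field j z (Fib \<alpha> I) = z (Fib \<alpha> (add_mset j I))"

definition total_deriv :: "nat \<Rightarrow> nat \<Rightarrow> nat \<Rightarrow> form \<Rightarrow> form" where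
  "total_deriv n m j = lie_deriv (jet_coords n m) (total_field j)"

definition neg_total_deriv :: "nat \<Rightarrow> nat \<Rightarrow> nat multiset \<Rightarrow> form \<Rightarrow> form" where
  "neg_total_deriv n m I \<omega> z vs =
     (- 1) ^ size I * foldr (total_deriv n m) (sorted_list_of_multiset I) \<omega> z vs"

definition coord_vector :: "coord \<Rightarrow> point" where
  "coord_vector A = (\<lambda>B. if B = A then 1 else 0)"

definition euler_local :: "nat \<Rightarrow> nat \<Rightarrow> nat \<Rightarrow> form \<Rightarrow> form" where
  "euler_local n m s \<omega> z vs =
     1 / real s *
     (\<Sum>\<alpha><m. wedge1 (contact_form n \<alpha> {#})
        (\<lambda>y ws. sum' (\<lambda>I. neg_total_deriv n m I
                             (interior_product (coord_vector (Fib \<alpha> I)) \<omega>) y ws)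
                     (multi_indices n)) z vs)"

section \<open>Manifolds and fibre bundles\<close>

type_synonym 'a chart = "'a set \<times> ('a \<Rightarrow> point)"

record 'a mfd =
  mtop :: "'a topology"
  matlas :: "'a chart set"

definition is_chart :: "coord set \<Rightarrow> 'a topology \<Rightarrow> 'a chart \<Rightarrow> bool" where
  "is_chart C T = (\<lambda>(U, \<phi>).
     openin T U \<and> openin (powertop_real C) (\<phi> ` U) \<and>
     homeomorphic_map (subtopology T U) (subtopology (powertop_real C) (\<phi> ` U)) \<phi>)"

definition transition_smooth :: "coord set \<Rightarrow> 'a chart \<Rightarrow> 'a chart \<Rightarrow> bool" where
  "transition_smooth C = (\<lambda>(U, \<phi>) (V, \<psi>).
     \<forall>A\<in>C. smooth C (\<phi> ` (U \<inter> V)) (\<lambda>z. \<psi> (inv_into U \<phi> z) A))"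

definition charts :: "coord set \<Rightarrow> 'a mfd \<Rightarrow> 'a chart set" where
  "charts C X = {c. is_chart C (mtop X) c \<and>
     (\<forall>c'\<in>matlas X. transition_smooth C c c' \<and> transition_smooth C c' c)}"

text \<open>\<open>charts C X\<close> is the maximal atlas. The finite set \<open>C\<close> fixes the dimension.\<close>

definition smooth_manifold :: "coord set \<Rightarrow> 'a mfd \<Rightarrow> bool" where
  "smooth_manifold C X \<longleftrightarrow>
     Hausdorff_space (mtop X) \<and> second_countable (mtop X) \<and>
     matlas X \<subseteq> charts C X \<and> (\<Union>c\<in>matlas X. fst c) = topspace (mtop X)"

definition smooth_map ::
  "coord set \<Rightarrow> 'a mfd \<Rightarrow> 'a set \<Rightarrow> coord set \<Rightarrow> 'b mfd \<Rightarrow> ('a \<Rightarrow> 'b) \<Rightarrow> bool" where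
  "smooth_map C X S C' Y f \<longleftrightarrow>
     continuous_map (subtopology (mtop X) S) (mtop Y) f \<and>
     (\<forall>(U, \<phi>)\<in>charts C X. \<forall>(V, \<psi>)\<in>charts C' Y. \<forall>A\<in>C'.
        smooth C (\<phi> ` {x \<in> U \<inter> S. f x \<in> V}) (\<lambda>z. \<psi> (f (inv_into U \<phi> z)) A))"

record ('m, 'e, 'f) fbundle =
  bdim :: nat
  fdim :: nat
  base_space :: "'m mfd"
  total_space :: "'e mfd"
  fibre_space :: "'f mfd"
  proj :: "'e \<Rightarrow> 'm"

abbreviation base_charts :: "('m, 'e, 'f) fbundle \<Rightarrow> 'm chart set" where
  "base_charts B \<equiv> charts (base_coords (bdim B)) (base_space B)"

abbreviation total_coords :: "('m, 'e, 'f) fbundle \<Rightarrow> coord set" where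
  "total_coords B \<equiv> jet_coords_upto (bdim B) (fdim B) 0"

abbreviation total_charts :: "('m, 'e, 'f) fbundle \<Rightarrow> 'e chart set" where
  "total_charts B \<equiv> charts (total_coords B) (total_space B)"

abbreviation inf_coords :: "('m, 'e, 'f) fbundle \<Rightarrow> coord set" where
  "inf_coords B \<equiv> jet_coords (bdim B) (fdim B)"

definition product_chart ::
  "('m, 'e, 'f) fbundle \<Rightarrow> ('e \<Rightarrow> 'f) \<Rightarrow> 'm chart \<Rightarrow> 'f chart \<Rightarrow> 'e chart" where
  "product_chart B \<Phi> = (\<lambda>(U, \<xi>) (W, \<kappa>).
     ({e \<in> topspace (mtop (total_space B)). proj B e \<in> U \<and> \<Phi> e \<in> W},
      \<lambda>e. \<lambda>A\<in>total_coords B. (case A of Base i \<Rightarrow> \<xi> (proj B e) A | Fib \<alpha> I \<Rightarrow> \<kappa> (\<Phi> e) A)))"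

text \<open>The homeomorphism \<open>e \<mapsto> (\<pi> e, \<Phi> e)\<close> over \<open>U\<close> is a diffeomorphism iff it pulls charts of
  the product manifold back to charts of \<open>E\<close>.\<close>

definition smooth_fibre_bundle :: "('m, 'e, 'f) fbundle \<Rightarrow> bool" where
  "smooth_fibre_bundle B \<longleftrightarrow>
     smooth_manifold (base_coords (bdim B)) (base_space B) \<and>
     smooth_manifold (total_coords B) (total_space B) \<and>
     smooth_manifold (fibre_coords (fdim B)) (fibre_space B) \<and>
     smooth_map (total_coords B) (total_space B) (topspace (mtop (total_space B)))
       (base_coords (bdim B)) (base_space B) (proj B) \<and>
     proj B ` topspace (mtop (total_space B)) = topspace (mtop (base_space B)) \<and>
     (\<forall>p\<in>topspace (mtop (base_space B)). \<exists>U \<Phi>.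
        openin (mtop (base_space B)) U \<and> p \<in> U \<and>
        homeomorphic_map
          (subtopology (mtop (total_space B)) {e \<in> topspace (mtop (total_space B)). proj B e \<in> U})
          (prod_topology (subtopology (mtop (base_space B)) U) (mtop (fibre_space B)))
          (\<lambda>e. (proj B e, \<Phi> e)) \<and>
        (\<forall>c\<in>base_charts B. fst c \<subseteq> U \<longrightarrow>
           (\<forall>d\<in>charts (fibre_coords (fdim B)) (fibre_space B). product_chart B \<Phi> c d \<in> total_charts B)))"

type_synonym ('m, 'e) bchart = "'m chart \<times> 'e chart"

definition adapted_charts :: "('m, 'e, 'f) fbundle \<Rightarrow> ('m, 'e) bchart set" where
  "adapted_charts B = {((U, \<xi>), (V, \<psi>)).
     (U, \<xi>) \<in> base_charts B \<and> (V, \<psi>) \<in> total_charts B \<and> proj B ` V \<subseteq> U \<and>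
     (\<forall>e\<in>V. restrict (\<psi> e) (base_coords (bdim B)) = \<xi> (proj B e))}"

section \<open>Jets\<close>

definition local_sections :: "('m, 'e, 'f) fbundle \<Rightarrow> 'm \<Rightarrow> ('m \<Rightarrow> 'e) set" where
  "local_sections B p = {\<sigma>. \<exists>U. openin (mtop (base_space B)) U \<and> p \<in> U \<and>
     smooth_map (base_coords (bdim B)) (base_space B) U (total_coords B) (total_space B) \<sigma> \<and>
     (\<forall>q\<in>U. proj B (\<sigma> q) = q)}"

text \<open>The value at \<open>Fib \<alpha> I\<close> is the iterated partial derivative along \<open>I\<close> of the component
  \<open>u\<^sup>\<alpha>\<close> of the section.\<close>

definition section_coords ::
  "('m, 'e, 'f) fbundle \<Rightarrow> ('m, 'e) bchart \<Rightarrow> 'm \<Rightarrow> ('m \<Rightarrow> 'e) \<Rightarrow> point" where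
  "section_coords B = (\<lambda>((U, \<xi>), (V, \<psi>)) p \<sigma>. \<lambda>A\<in>inf_coords B.
     (case A of
        Base i \<Rightarrow> \<xi> p A
      | Fib \<alpha> I \<Rightarrow> foldr pd (map Base (sorted_list_of_multiset I))
                    (\<lambda>x. \<psi> (\<sigma> (inv_into U \<xi> x)) (Fib \<alpha> {#})) (\<xi> p)))"

definition jet :: "('m, 'e, 'f) fbundle \<Rightarrow> nat \<Rightarrow> 'm \<Rightarrow> ('m \<Rightarrow> 'e) \<Rightarrow> ('m \<Rightarrow> 'e) set" where
  "jet B k p \<sigma> = {\<tau> \<in> local_sections B p. \<tau> p = \<sigma> p \<and>
     (\<forall>c\<in>adapted_charts B. \<sigma> p \<in> fst (snd c) \<longrightarrow>
        (\<forall>A\<in>jet_coords_upto (bdim B) (fdim B) k.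
           section_coords B c p \<tau> A = section_coords B c p \<sigma> A))}"

text \<open>A point of \<open>J\<^sup>\<infinity>E\<close> is a base point \<open>p\<close> with a compatible sequence \<open>j\<close> of \<open>k\<close>-jets
  at \<open>p\<close>, i.e. a point of the inverse limit.\<close>

type_synonym ('m, 'e) jet_point = "'m \<times> (nat \<Rightarrow> ('m \<Rightarrow> 'e) set)"

definition jet_space :: "('m, 'e, 'f) fbundle \<Rightarrow> ('m, 'e) jet_point set" where
  "jet_space B = {(p, j). p \<in> topspace (mtop (base_space B)) \<and>
     (\<forall>k. (\<exists>\<sigma>\<in>local_sections B p. j k = jet B k p \<sigma>) \<and> j (Suc k) \<subseteq> j k)}"

definition jet_space_over :: "('m, 'e, 'f) fbundle \<Rightarrow> 'e set \<Rightarrow> ('m, 'e) jet_point set" where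
  "jet_space_over B V = {(p, j) \<in> jet_space B. \<forall>\<sigma>\<in>j 0. \<sigma> p \<in> V}"

definition jet_chart ::
  "('m, 'e, 'f) fbundle \<Rightarrow> ('m, 'e) bchart \<Rightarrow> ('m, 'e) jet_point \<Rightarrow> point" where
  "jet_chart B c = (\<lambda>(p, j). \<lambda>A\<in>inf_coords B.
     section_coords B c p (SOME \<sigma>. \<sigma> \<in> j (coord_order A)) A)"

text \<open>The image of the chart of \<open>J\<^sup>\<infinity>E\<close> induced by an adapted chart: the coordinates of
  positive order are unrestricted.\<close>

definition jet_domain :: "('m, 'e, 'f) fbundle \<Rightarrow> ('m, 'e) bchart \<Rightarrow> point set" where
  "jet_domain B = (\<lambda>(_, (V, \<psi>)).
     {z \<in> topspace (powertop_real (inf_coords B)). restrict z (total_coords B) \<in> \<psi> ` V})"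

definition jet_overlap ::
  "('m, 'e, 'f) fbundle \<Rightarrow> ('m, 'e) bchart \<Rightarrow> ('m, 'e) bchart \<Rightarrow> ('m, 'e) jet_point set" where
  "jet_overlap B c c' = jet_space_over B (fst (snd c) \<inter> fst (snd c'))"

definition jet_transition ::
  "('m, 'e, 'f) fbundle \<Rightarrow> ('m, 'e) bchart \<Rightarrow> ('m, 'e) bchart \<Rightarrow> point \<Rightarrow> point" where
  "jet_transition B c c' z = jet_chart B c' (inv_into (jet_overlap B c c') (jet_chart B c) z)"

section \<open>Functions and forms on the infinite jet space\<close>

text \<open>
  Functions and differential forms on \<open>J\<^sup>\<infinity>E\<close> are represented by the families of their
  expressions in all adapted charts, subject to the transformation law on overlaps. The
  expressions are normalised to 0 off the chart domains and, for \<open>p\<close>-forms, on lists of length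
  other than \<open>p\<close>, so that equality of forms is equality of families. The bound \<open>k\<close> on the
  jet order is the same for all charts.
\<close>

type_synonym ('m, 'e) jfun = "('m, 'e) bchart \<Rightarrow> point \<Rightarrow> real"
type_synonym ('m, 'e) jform = "('m, 'e) bchart \<Rightarrow> form"

definition jet_functions :: "('m, 'e, 'f) fbundle \<Rightarrow> ('m, 'e) jfun set" where
  "jet_functions B = {f.
     (\<forall>c z. c \<notin> adapted_charts B \<or> z \<notin> jet_domain B c \<longrightarrow> f c z = 0) \<and>
     (\<exists>k. \<forall>c\<in>adapted_charts B.
        smooth (inf_coords B) (jet_domain B c) (f c) \<and>
        depends_upto (bdim B) (fdim B) k (jet_domain B c) (f c)) \<and>
     (\<forall>c\<in>adapted_charts B. \<forall>c'\<in>adapted_charts B. \<forall>J\<in>jet_overlap B c c'.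
        f c (jet_chart B c J) = f c' (jet_chart B c' J))}"

definition jet_forms :: "('m, 'e, 'f) fbundle \<Rightarrow> nat \<Rightarrow> ('m, 'e) jform set" where
  "jet_forms B p = {\<omega>.
     (\<forall>c z vs. c \<notin> adapted_charts B \<or> z \<notin> jet_domain B c \<or> length vs \<noteq> p \<longrightarrow> \<omega> c z vs = 0) \<and>
     (\<exists>k. \<forall>c\<in>adapted_charts B.
        smooth_form_upto (bdim B) (fdim B) k p (jet_domain B c) (\<omega> c)) \<and>
     (\<forall>c\<in>adapted_charts B. \<forall>c'\<in>adapted_charts B. \<forall>J\<in>jet_overlap B c c'. \<forall>vs.
        \<omega> c (jet_chart B c J) vs =
        pullback (inf_coords B) (jet_transition B c c') (\<omega> c') (jet_chart B c J) vs)}"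

definition coord_volume :: "nat \<Rightarrow> form" where
  "coord_volume n =
     foldr (\<lambda>i. wedge1 (\<lambda>z v. v (Base i))) [0..<n] (\<lambda>z vs. if vs = [] then 1 else 0)"

text \<open>A volume form on \<open>M\<close>, as the family of its expressions in the charts of \<open>M\<close>.\<close>

definition volume_form :: "nat \<Rightarrow> 'm mfd \<Rightarrow> ('m chart \<Rightarrow> form) \<Rightarrow> bool" where
  "volume_form n X \<nu> \<longleftrightarrow>
     (\<forall>(U, \<xi>)\<in>charts (base_coords n) X. \<exists>\<rho>.
        smooth (base_coords n) (\<xi> ` U) \<rho> \<and>
        (\<forall>x\<in>\<xi> ` U. \<rho> x \<noteq> 0 \<and> (\<forall>vs. \<nu> (U, \<xi>) x vs = \<rho> x * coord_volume n x vs))) \<and>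
     (\<forall>(U, \<xi>)\<in>charts (base_coords n) X. \<forall>(U', \<xi>')\<in>charts (base_coords n) X.
        \<forall>x\<in>\<xi> ` (U \<inter> U'). \<forall>vs.
          \<nu> (U, \<xi>) x vs =
          pullback (base_coords n) (\<lambda>y. \<xi>' (inv_into U \<xi> y)) (\<nu> (U', \<xi>')) x vs)"

text \<open>\<open>[(\<alpha>\<^sub>1,I\<^sub>1),\<dots>,(\<alpha>\<^sub>s,I\<^sub>s)]\<close> encodes \<open>\<theta>\<^sup>\<alpha>\<^sup>1\<^sub>I\<^sub>1 \<and> \<dots> \<and> \<theta>\<^sup>\<alpha>\<^sup>s\<^sub>I\<^sub>s \<and> \<nu>\<close>.\<close>

definition contact_lists :: "nat \<Rightarrow> nat \<Rightarrow> nat \<Rightarrow> (nat \<times> nat multiset) list set" where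
  "contact_lists n m s = {K. length K = s \<and> set K \<subseteq> {..<m} \<times> multi_indices n}"

definition contact_monomial ::
  "('m, 'e, 'f) fbundle \<Rightarrow> ('m chart \<Rightarrow> form) \<Rightarrow> ('m, 'e) bchart \<Rightarrow>
   (nat \<times> nat multiset) list \<Rightarrow> form" where
  "contact_monomial B \<nu> c K =
     foldr (\<lambda>(\<alpha>, I). wedge1 (contact_form (bdim B) \<alpha> I)) K
       (\<lambda>z vs. \<nu> (fst c) (restrict z (base_coords (bdim B))) vs)"

text \<open>Locally, \<open>\<omega>\<close> is a finite combination, with smooth coefficients of finite order, of those
  \<open>\<theta>\<^sup>\<alpha>\<^sup>1\<^sub>I\<^sub>1 \<and> \<dots> \<and> \<theta>\<^sup>\<alpha>\<^sup>s\<^sub>I\<^sub>s \<and> \<nu>\<close> that satisfy \<open>P\<close>.\<close>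

definition locally_spanned ::
  "('m, 'e, 'f) fbundle \<Rightarrow> ('m chart \<Rightarrow> form) \<Rightarrow> nat \<Rightarrow>
   ((nat \<times> nat multiset) list \<Rightarrow> bool) \<Rightarrow> ('m, 'e) jform \<Rightarrow> bool" where
  "locally_spanned B \<nu> s P \<omega> \<longleftrightarrow>
     (\<forall>c\<in>adapted_charts B. \<forall>z\<in>jet_domain B c. \<exists>W.
        openin (powertop_real (inf_coords B)) W \<and> z \<in> W \<and> W \<subseteq> jet_domain B c \<and>
        (\<exists>\<K> g. finite \<K> \<and> \<K> \<subseteq> {K \<in> contact_lists (bdim B) (fdim B) s. P K} \<and>
           (\<forall>K\<in>\<K>. smooth_finite_order (bdim B) (fdim B) W (g K)) \<and>
           (\<forall>y\<in>W. \<forall>vs. length vs = bdim B + s \<longrightarrow>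
              \<omega> c y vs = (\<Sum>K\<in>\<K>. g K y * contact_monomial B \<nu> c K y vs))))"

definition Omega_ns ::
  "('m, 'e, 'f) fbundle \<Rightarrow> ('m chart \<Rightarrow> form) \<Rightarrow> nat \<Rightarrow> ('m, 'e) jform set" where
  "Omega_ns B \<nu> s = {\<omega> \<in> jet_forms B (bdim B + s). locally_spanned B \<nu> s (\<lambda>K. True) \<omega>}"

definition Omega_ns0 ::
  "('m, 'e, 'f) fbundle \<Rightarrow> ('m chart \<Rightarrow> form) \<Rightarrow> nat \<Rightarrow> ('m, 'e) jform set" where
  "Omega_ns0 B \<nu> s = {\<omega> \<in> Omega_ns B \<nu> s. locally_spanned B \<nu> s (\<lambda>K. snd (hd K) = {#}) \<omega>}"

definition zero_form :: "('m, 'e) jform" where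
  "zero_form = (\<lambda>c z vs. 0)"

definition filt ::
  "('m, 'e, 'f) fbundle \<Rightarrow> ('m chart \<Rightarrow> form) \<Rightarrow> nat \<Rightarrow> int \<Rightarrow> ('m, 'e) jform set" where
  "filt B \<nu> s l =
     (if l < 0 then {zero_form}
      else {\<omega> \<in> Omega_ns0 B \<nu> s. locally_spanned B \<nu> s
              (\<lambda>K. snd (hd K) = {#} \<and> int (\<Sum>(\<alpha>, I)\<leftarrow>tl K. size I) \<le> l) \<omega>})"

text \<open>The interior Euler operator is the map on \<open>\<Omega>\<^sup>n\<^sup>,\<^sup>s\<close> with the given expression in every
  adapted chart.\<close>

definition interior_euler_operator ::
  "('m, 'e, 'f) fbundle \<Rightarrow> ('m chart \<Rightarrow> form) \<Rightarrow> nat \<Rightarrow>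
   (('m, 'e) jform \<Rightarrow> ('m, 'e) jform) \<Rightarrow> bool" where
  "interior_euler_operator B \<nu> s Eul \<longleftrightarrow>
     Eul \<in> Omega_ns B \<nu> s \<rightarrow> Omega_ns B \<nu> s \<and>
     (\<forall>\<omega>\<in>Omega_ns B \<nu> s. \<forall>c\<in>adapted_charts B. \<forall>z\<in>jet_domain B c. \<forall>vs.
        length vs = bdim B + s \<longrightarrow>
        Eul \<omega> c z vs = euler_local (bdim B) (fdim B) s (\<omega> c) z vs)"

section \<open>Module structures\<close>

definition jet_ring :: "('m, 'e, 'f) fbundle \<Rightarrow> ('m, 'e) jfun ring" where
  "jet_ring B = \<lparr>carrier = jet_functions B,
     monoid.mult = (\<lambda>f g c z. f c z * g c z),
     one = (\<lambda>c z. if c \<in> adapted_charts B \<and> z \<in> jet_domain B c then 1 else 0),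
     zero = (\<lambda>c z. 0),
     add = (\<lambda>f g c z. f c z + g c z)\<rparr>"

text \<open>The fields \<open>mult\<close> and \<open>one\<close> of a module record are not used.\<close>

definition filt_module ::
  "('m, 'e, 'f) fbundle \<Rightarrow> ('m chart \<Rightarrow> form) \<Rightarrow> nat \<Rightarrow> int \<Rightarrow>
   (('m, 'e) jfun, ('m, 'e) jform) module" where
  "filt_module B \<nu> s l = \<lparr>carrier = filt B \<nu> s l,
     monoid.mult = (\<lambda>_ _. undefined),
     one = undefined,
     zero = zero_form,
     add = (\<lambda>\<omega> \<eta> c z vs. \<omega> c z vs + \<eta> c z vs),
     smult = (\<lambda>f \<omega> c z vs. f c z * \<omega> c z vs)\<rparr>"

definition quotient_module :: "('r, 'a) module \<Rightarrow> 'a set \<Rightarrow> ('r, 'a set) module" where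
  "quotient_module X N = \<lparr>carrier = a_rcosets\<^bsub>X\<^esub> N,
     monoid.mult = (\<lambda>_ _. undefined),
     one = undefined,
     zero = N,
     add = set_add X,
     smult = (\<lambda>a Q. \<Union>x\<in>Q. N +>\<^bsub>X\<^esub> (a \<odot>\<^bsub>X\<^esub> x))\<rparr>"

definition gr_module ::
  "('m, 'e, 'f) fbundle \<Rightarrow> ('m chart \<Rightarrow> form) \<Rightarrow> nat \<Rightarrow> int \<Rightarrow>
   (('m, 'e) jfun, ('m, 'e) jform set) module" where
  "gr_module B \<nu> s l = quotient_module (filt_module B \<nu> s l) (filt B \<nu> s (l - 1))"

definition filt_coset ::
  "('m, 'e, 'f) fbundle \<Rightarrow> ('m chart \<Rightarrow> form) \<Rightarrow> nat \<Rightarrow> int \<Rightarrow>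
   ('m, 'e) jform \<Rightarrow> ('m, 'e) jform set" where
  "filt_coset B \<nu> s l \<omega> = filt B \<nu> s (l - 1) +>\<^bsub>filt_module B \<nu> s l\<^esub> \<omega>"

text \<open>On a coset \<open>Q\<close> the induced map is the union of the cosets of the \<open>Eul \<omega>\<close>,
  \<open>\<omega> \<in> Q\<close>; it is well defined iff these cosets agree.\<close>

definition gr_map ::
  "('m, 'e, 'f) fbundle \<Rightarrow> ('m chart \<Rightarrow> form) \<Rightarrow> nat \<Rightarrow> int \<Rightarrow>
   (('m, 'e) jform \<Rightarrow> ('m, 'e) jform) \<Rightarrow> ('m, 'e) jform set \<Rightarrow> ('m, 'e) jform set" where
  "gr_map B \<nu> s l Eul Q = (\<Union>\<omega>\<in>Q. filt_coset B \<nu> s l (Eul \<omega>))"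

definition module_homomorphism ::
  "('r, 'c) ring_scheme \<Rightarrow> ('r, 'a) module \<Rightarrow> ('r, 'b) module \<Rightarrow> ('a \<Rightarrow> 'b) \<Rightarrow> bool" where
  "module_homomorphism R X Y h \<longleftrightarrow>
     Module.module R X \<and> Module.module R Y \<and> h \<in> carrier X \<rightarrow> carrier Y \<and>
     (\<forall>x\<in>carrier X. \<forall>y\<in>carrier X. h (x \<oplus>\<^bsub>X\<^esub> y) = h x \<oplus>\<^bsub>Y\<^esub> h y) \<and>
     (\<forall>a\<in>carrier R. \<forall>x\<in>carrier X. h (a \<odot>\<^bsub>X\<^esub> x) = a \<odot>\<^bsub>Y\<^esub> h x)"

end

theory Submission
  imports Defs "HOL-Library.Function_Algebras"
begin

text \<open>
  Give a monomial \<open>\<theta>\<^sup>\<alpha>\<^sup>1\<^sub>I\<^sub>1 \<and> \<dots> \<and> \<theta>\<^sup>\<alpha>\<^sup>s\<^sub>I\<^sub>s \<and> \<nu>\<close> the weight \<open>|I\<^sub>1| + \<dots> + |I\<^sub>s|\<close>. Contraction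
  with \<open>\<partial>\<^sup>I\<^sub>\<alpha>\<close> removes one factor and lowers the weight by \<open>|I|\<close>; each total derivative raises it by at
  most one; multiplication by \<open>\<theta>\<^sup>\<alpha>\<close> does not change it. So the Euler operator does not increase the
  weight, and its values begin with an undifferentiated contact form (\<open>E_lin\<close>). This is the
  invariance of the filtration, because on monomials that begin with an undifferentiated factor
  the weight is the number that defines the filtration.

  The weight rises by the full amount \<open>|I|\<close> only where all derivatives in \<open>(-D)\<^sub>I\<close> fall on contact
  forms. A derivative that falls on a coefficient function is lost for the weight. Hence the Euler
  operator commutes with multiplication by functions up to forms of lower weight
  (\<open>E_scale_defect\<close>), which is linearity over the ring of functions on the graded components.

  By the same token, idempotence on the graded components has to be shown only for
  combinations of monomials with constant coefficients and the coordinate volume form, where it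
  holds exactly (\<open>E_idempotent_constants\<close>). There the total derivatives commute and act by
  \<open>D\<^sub>j \<theta>\<^sup>\<alpha>\<^sub>I = \<theta>\<^sup>\<alpha>\<^sub>I\<^sub>j\<close> alone. The classical argument applies: the sum of all
  \<open>\<theta>\<^sup>\<alpha>\<^sub>I \<and> (\<partial>\<^sup>I\<^sub>\<alpha> \<lrcorner> \<kappa>)\<close> is \<open>s \<kappa>\<close> (\<open>sum_theta_iota\<close>), integration by parts turns it into \<open>s\<close> times
  the image of \<open>\<kappa>\<close> plus total derivatives (\<open>theta_by_parts\<close>), and the Euler operator annihilates
  total derivatives because \<open>[\<partial>\<^sup>I\<^sub>\<alpha>, D\<^sub>j]\<close> makes the defining sum telescope (\<open>E_D_eq_0\<close>).

  These facts are proved on an open set of jet coordinates. They pass to forms on \<open>J\<^sup>\<infinity>E\<close> because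
  the filtration is defined locally (\<open>filt_transfer\<close>), and to the graded components by a
  general statement on maps that are linear and idempotent modulo a submodule
  (\<open>quotient_map_properties\<close>).
\<close>

section \<open>Smooth functions of finite order\<close>

text \<open>Partial derivatives at a point of \<open>W\<close> see only \<open>W\<close>: a small change of one coordinate does not
  leave an open set. So functions may be replaced by others that agree with them on \<open>W\<close>.\<close>

lemma eventually_update_in:
  assumes "openin (powertop_real C) W" "z \<in> W" "A \<in> C"
  shows "\<forall>\<^sub>F t in nhds (z A). z(A := t) \<in> W"
proof -
  have z: "z \<in> extensional C"
    using openin_subset[OF assms(1)] assms(2) by (auto simp: PiE_iff)
  have "continuous_map euclideanreal (powertop_real C) (\<lambda>t. z(A := t))"
    using z assms(3) by (auto simp: continuous_map_componentwise extensional_def fun_upd_def)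
  from openin_continuous_map_preimage[OF this assms(1)]
  have "open {t. z(A := t) \<in> W}" by simp
  then show ?thesis
    using eventually_nhds_in_open[of "{t. z(A := t) \<in> W}" "z A"] assms(2) by simp
qed

lemma pd_cong:
  assumes "openin (powertop_real C) W" "z \<in> W" "A \<in> C" "\<And>y. y \<in> W \<Longrightarrow> f y = g y"
  shows "pd A f z = pd A g z"
  unfolding pd_def
  by (rule deriv_cong_ev)
    (use eventually_update_in[OF assms(1-3)] assms(4) in \<open>auto elim: eventually_mono\<close>)

lemma differentiable_update_cong:
  fixes f g :: "point \<Rightarrow> real"
  assumes "openin (powertop_real C) W" "z \<in> W" "A \<in> C" "\<And>y. y \<in> W \<Longrightarrow> f y = g y"
    and "(\<lambda>t. f (z(A := t))) differentiable (at (z A))"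
  shows "(\<lambda>t. g (z(A := t))) differentiable (at (z A))"
proof -
  have ev: "\<forall>\<^sub>F t in nhds (z A). f (z(A := t)) = g (z(A := t))"
    using eventually_update_in[OF assms(1-3)] assms(4) by (auto elim: eventually_mono)
  from assms(5) obtain D where "((\<lambda>t. f (z(A := t))) has_real_derivative D) (at (z A))"
    by (auto simp: real_differentiable_def)
  then have "((\<lambda>t. g (z(A := t))) has_real_derivative D) (at (z A))"
    using DERIV_cong_ev[OF refl ev refl] by simp
  then show ?thesis by (auto simp: real_differentiable_def)
qed

text \<open>Smoothness by recursion on the number of derivatives. The first derivatives of a product or of an
  inverse are built from functions that are smooth to the same order, so closure
  under these operations follows by induction on \<open>k\<close>.\<close>

primrec smooth_upto :: "nat \<Rightarrow> coord set \<Rightarrow> point set \<Rightarrow> (point \<Rightarrow> real) \<Rightarrow> bool" where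
  "smooth_upto 0 C W f \<longleftrightarrow> True"
| "smooth_upto (Suc k) C W f \<longleftrightarrow>
     continuous_map (subtopology (powertop_real C) W) euclideanreal f \<and>
     (\<forall>A\<in>C. \<forall>z\<in>W. (\<lambda>t. f (z(A := t))) differentiable (at (z A))) \<and>
     (\<forall>A\<in>C. smooth_upto k C W (pd A f))"

lemma smooth_upto_iff:
  "smooth_upto k C W f \<longleftrightarrow>
     (\<forall>As. set As \<subseteq> C \<and> length As < k \<longrightarrow>
        continuous_map (subtopology (powertop_real C) W) euclideanreal (foldr pd As f) \<and>
        (\<forall>A\<in>C. \<forall>z\<in>W. (\<lambda>t. foldr pd As f (z(A := t))) differentiable (at (z A))))"
  (is "_ \<longleftrightarrow> (\<forall>As. set As \<subseteq> C \<and> length As < k \<longrightarrow> ?P As f)")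
proof (induction k arbitrary: f)
  case (Suc k)
  have "(\<forall>As. set As \<subseteq> C \<and> length As < Suc k \<longrightarrow> ?P As f) \<longleftrightarrow>
        ?P [] f \<and> (\<forall>A\<in>C. \<forall>As. set As \<subseteq> C \<and> length As < k \<longrightarrow> ?P As (pd A f))"
    (is "?L \<longleftrightarrow> ?R")
  proof
    assume L: ?L
    have "?P As (pd A f)" if "A \<in> C" "set As \<subseteq> C" "length As < k" for A As
      using L[rule_format, of "As @ [A]"] that by (simp del: fun_upd_apply)
    then show ?R using L[rule_format, of "[]"] by (simp del: fun_upd_apply)
  next
    assume R: ?R
    have "?P As f" if "set As \<subseteq> C" "length As < Suc k" for As
      using that R by (cases As rule: rev_cases) auto
    then show ?L by blast
  qed
  then show ?case using Suc.IH by (simp del: fun_upd_apply)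
qed simp

lemma smooth_iff: "smooth C W f \<longleftrightarrow> (\<forall>k. smooth_upto k C W f)"
  unfolding smooth_def smooth_upto_iff using lessI by blast

lemma smooth_upto_Suc_D: "smooth_upto (Suc k) C W f \<Longrightarrow> smooth_upto k C W f"
  unfolding smooth_upto_iff by auto

lemma smooth_upto_Suc_elims:
  assumes "smooth_upto (Suc k) C W f"
  shows "continuous_map (subtopology (powertop_real C) W) euclideanreal f"
    and "A \<in> C \<Longrightarrow> z \<in> W \<Longrightarrow> (\<lambda>t. f (z(A := t))) differentiable (at (z A))"
    and "A \<in> C \<Longrightarrow> smooth_upto k C W (pd A f)"
  using assms unfolding smooth_upto.simps by blast+

lemma smooth_upto_SucI:
  assumes "continuous_map (subtopology (powertop_real C) W) euclideanreal f"
    and "\<And>A z. A \<in> C \<Longrightarrow> z \<in> W \<Longrightarrow> (\<lambda>t. f (z(A := t))) differentiable (at (z A))"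
    and "\<And>A. A \<in> C \<Longrightarrow> smooth_upto k C W (pd A f)"
  shows "smooth_upto (Suc k) C W f"
  using assms unfolding smooth_upto.simps by blast

lemma smooth_upto_cong:
  assumes W: "openin (powertop_real C) W" and "\<And>y. y \<in> W \<Longrightarrow> f y = g y" "smooth_upto k C W f"
  shows "smooth_upto k C W g"
  using assms(2,3)
proof (induction k arbitrary: f g)
  case (Suc k)
  note f = smooth_upto_Suc_elims[OF Suc.prems(2)]
  show ?case
  proof (rule smooth_upto_SucI)
    show "continuous_map (subtopology (powertop_real C) W) euclideanreal g"
      by (rule continuous_map_eq[OF f(1)]) (simp add: Suc.prems(1))
  next
    fix A z assume A: "A \<in> C" "z \<in> W"
    show "(\<lambda>t. g (z(A := t))) differentiable (at (z A))"
      by (rule differentiable_update_cong[OF W A(2,1) Suc.prems(1) f(2)[OF A]])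
  next
    fix A assume A: "A \<in> C"
    show "smooth_upto k C W (pd A g)"
      by (rule Suc.IH[OF pd_cong[OF W _ A Suc.prems(1)] f(3)[OF A]])
  qed
qed simp

lemma smooth_upto_subset:
  assumes "smooth_upto k C W f" "W' \<subseteq> W"
  shows "smooth_upto k C W' f"
  using assms
  by (induction k arbitrary: f) (auto intro: continuous_map_from_subtopology_mono)

lemma has_derivative_update:
  assumes "(\<lambda>t. f (z(A := t))) differentiable (at (z A))"
  shows "((\<lambda>t. f (z(A := t))) has_real_derivative pd A f z) (at (z A))"
  unfolding pd_def using assms DERIV_deriv_iff_real_differentiable by blast

lemma pd_const [simp]: "pd A (\<lambda>_. c) = (\<lambda>_. 0)"
  by (simp add: pd_def fun_eq_iff)

lemma pd_coord: "pd A (\<lambda>z. z B) z = (if A = B then 1 else 0)"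
  by (simp add: pd_def fun_upd_def)

lemma pd_add:
  assumes "(\<lambda>t. f (z(A := t))) differentiable (at (z A))"
    and "(\<lambda>t. g (z(A := t))) differentiable (at (z A))"
  shows "pd A (\<lambda>y. f y + g y) z = pd A f z + pd A g z"
  using DERIV_imp_deriv[OF DERIV_add[OF assms[THEN has_derivative_update]]]
  by (simp add: pd_def del: fun_upd_apply)

lemma pd_mult:
  assumes "(\<lambda>t. f (z(A := t))) differentiable (at (z A))"
    and "(\<lambda>t. g (z(A := t))) differentiable (at (z A))"
  shows "pd A (\<lambda>y. f y * g y) z = pd A f z * g z + f z * pd A g z"
  using DERIV_imp_deriv[OF DERIV_mult[OF assms[THEN has_derivative_update]]]
  by (simp add: pd_def[of A "\<lambda>y. f y * g y"] mult.commute del: fun_upd_apply)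

lemma pd_inverse:
  assumes "(\<lambda>t. f (z(A := t))) differentiable (at (z A))" "f z \<noteq> 0"
  shows "pd A (\<lambda>y. inverse (f y)) z = - 1 * (pd A f z * (inverse (f z) * inverse (f z)))"
  using DERIV_imp_deriv[OF DERIV_inverse_fun[OF assms(1)[THEN has_derivative_update]]] assms(2)
  by (simp add: pd_def[of A "\<lambda>y. inverse (f y)"] del: fun_upd_apply)

lemma smooth_upto_const: "smooth_upto k C W (\<lambda>_. c)"
  by (induction k arbitrary: c) auto

lemma smooth_upto_add:
  assumes W: "openin (powertop_real C) W" and "smooth_upto k C W f" "smooth_upto k C W g"
  shows "smooth_upto k C W (\<lambda>z. f z + g z)"
  using assms(2,3)
proof (induction k arbitrary: f g)
  case (Suc k)
  note f = smooth_upto_Suc_elims[OF Suc.prems(1)] and g = smooth_upto_Suc_elims[OF Suc.prems(2)]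
  show ?case
  proof (rule smooth_upto_SucI)
    show "continuous_map (subtopology (powertop_real C) W) euclideanreal (\<lambda>z. f z + g z)"
      by (rule continuous_map_add[OF f(1) g(1)])
  next
    fix A z assume A: "A \<in> C" "z \<in> W"
    show "(\<lambda>t. f (z(A := t)) + g (z(A := t))) differentiable (at (z A))"
      by (rule differentiable_add[OF f(2)[OF A] g(2)[OF A]])
  next
    fix A assume A: "A \<in> C"
    show "smooth_upto k C W (pd A (\<lambda>z. f z + g z))"
      by (rule smooth_upto_cong[OF W _ Suc.IH[OF f(3)[OF A] g(3)[OF A]]])
        (rule pd_add[OF f(2)[OF A] g(2)[OF A], symmetric])
  qed
qed simp

lemma smooth_upto_mult:
  assumes W: "openin (powertop_real C) W" and "smooth_upto k C W f" "smooth_upto k C W g"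
  shows "smooth_upto k C W (\<lambda>z. f z * g z)"
  using assms(2,3)
proof (induction k arbitrary: f g)
  case (Suc k)
  note f = smooth_upto_Suc_elims[OF Suc.prems(1)] and g = smooth_upto_Suc_elims[OF Suc.prems(2)]
  note low = Suc.prems[THEN smooth_upto_Suc_D]
  show ?case
  proof (rule smooth_upto_SucI)
    show "continuous_map (subtopology (powertop_real C) W) euclideanreal (\<lambda>z. f z * g z)"
      by (rule continuous_map_real_mult[OF f(1) g(1)])
  next
    fix A z assume A: "A \<in> C" "z \<in> W"
    show "(\<lambda>t. f (z(A := t)) * g (z(A := t))) differentiable (at (z A))"
      by (rule differentiable_mult[OF f(2)[OF A] g(2)[OF A]])
  next
    fix A assume A: "A \<in> C"
    show "smooth_upto k C W (pd A (\<lambda>z. f z * g z))"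
      by (rule smooth_upto_cong[OF W _ smooth_upto_add[OF W Suc.IH[OF f(3)[OF A] low(2)]
              Suc.IH[OF low(1) g(3)[OF A]]]])
        (rule pd_mult[OF f(2)[OF A] g(2)[OF A], symmetric])
  qed
qed simp

lemma smooth_upto_inverse:
  assumes W: "openin (powertop_real C) W" and nz: "\<And>z. z \<in> W \<Longrightarrow> f z \<noteq> 0"
    and "smooth_upto k C W f"
  shows "smooth_upto k C W (\<lambda>z. inverse (f z))"
  using assms(3)
proof (induction k)
  case (Suc k)
  note f = smooth_upto_Suc_elims[OF Suc.prems]
  note inv = Suc.IH[OF smooth_upto_Suc_D[OF Suc.prems]]
  note mult = smooth_upto_mult[OF W]
  show ?case
  proof (rule smooth_upto_SucI)
    show "continuous_map (subtopology (powertop_real C) W) euclideanreal (\<lambda>z. inverse (f z))"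
      by (rule continuous_map_real_inverse[OF f(1)]) (simp add: nz)
  next
    fix A z assume A: "A \<in> C" "z \<in> W"
    show "(\<lambda>t. inverse (f (z(A := t)))) differentiable (at (z A))"
      by (rule differentiable_inverse[OF f(2)[OF A]]) (simp add: nz A)
  next
    fix A assume A: "A \<in> C"
    show "smooth_upto k C W (pd A (\<lambda>z. inverse (f z)))"
      by (rule smooth_upto_cong[OF W _ mult[OF smooth_upto_const mult[OF f(3)[OF A] mult[OF inv inv]]]])
        (rule pd_inverse[OF f(2)[OF A] nz, symmetric])
  qed
qed simp

lemma smooth_cong:
  assumes "openin (powertop_real C) W" "\<And>y. y \<in> W \<Longrightarrow> f y = g y" "smooth C W f"
  shows "smooth C W g"
  using smooth_upto_cong[OF assms(1,2)] assms(3) by (auto simp: smooth_iff)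

lemma smooth_subset: "smooth C W f \<Longrightarrow> W' \<subseteq> W \<Longrightarrow> smooth C W' f"
  by (auto simp: smooth_iff intro: smooth_upto_subset)

lemma smooth_differentiable:
  "smooth C W f \<Longrightarrow> A \<in> C \<Longrightarrow> z \<in> W \<Longrightarrow> (\<lambda>t. f (z(A := t))) differentiable (at (z A))"
  unfolding smooth_def by (drule spec[of _ "[]"]) simp

lemma smooth_pd: "smooth C W f \<Longrightarrow> A \<in> C \<Longrightarrow> smooth C W (pd A f)"
  unfolding smooth_iff using smooth_upto.simps(2) by blast

lemma smooth_coord:
  assumes A: "A \<in> C"
  shows "smooth C W (\<lambda>z. z A)"
  unfolding smooth_iff
proof
  fix k
  show "smooth_upto k C W (\<lambda>z. z A)"
  proof (cases k)
    case (Suc k')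
    show ?thesis unfolding Suc
    proof (rule smooth_upto_SucI)
      show "continuous_map (subtopology (powertop_real C) W) euclideanreal (\<lambda>z. z A)"
        by (intro continuous_map_from_subtopology continuous_map_product_projection A)
    next
      fix B and z :: point
      show "(\<lambda>t. (z(B := t)) A) differentiable (at (z B))"
        by (cases "A = B") auto
    next
      fix B
      have "pd B (\<lambda>z. z A) = (\<lambda>_. if B = A then 1 else 0)"
        by (simp add: fun_eq_iff pd_coord)
      then show "smooth_upto k' C W (pd B (\<lambda>z. z A))" by (simp add: smooth_upto_const)
    qed
  qed simp
qed

text \<open>A function of the coordinates in \<open>C'\<close> alone has vanishing partial derivatives in all
  other directions, so its smoothness can be tested on \<open>powertop_real C'\<close>.\<close>

lemma smooth_restrict:
  assumes "smooth C' W' f" "C' \<subseteq> C" "openin (powertop_real C) W"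
    and "\<And>z. z \<in> W \<Longrightarrow> restrict z C' \<in> W'"
  shows "smooth C W (\<lambda>z. f (restrict z C'))"
proof -
  have upd: "restrict (z(A := t)) C' = (if A \<in> C' then (restrict z C')(A := t) else restrict z C')"
    for z :: point and A t by (auto simp: restrict_def)
  have "smooth_upto k C W (\<lambda>z. f (restrict z C'))" if "smooth_upto k C' W' f" for k
    using that
  proof (induction k arbitrary: f)
    case (Suc k)
    have "continuous_map (powertop_real C) (powertop_real C') (\<lambda>z. restrict z C')"
      using assms(2) by (auto simp: continuous_map_componentwise intro: continuous_map_product_projection)
    then have "continuous_map (subtopology (powertop_real C) W) (subtopology (powertop_real C') W')
        (\<lambda>z. restrict z C')"
      using assms(4) by (auto simp: continuous_map_in_subtopology continuous_map_from_subtopology)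
    from continuous_map_compose[OF this, of euclideanreal f]
    have 1: "continuous_map (subtopology (powertop_real C) W) euclideanreal (\<lambda>z. f (restrict z C'))"
      using Suc.prems by (simp add: o_def)
    have 2: "(\<lambda>t. f (restrict (z(A := t)) C')) differentiable (at (z A))" if "z \<in> W" for z A
    proof (cases "A \<in> C'")
      case True
      then have "(\<lambda>t. f ((restrict z C')(A := t))) differentiable (at (restrict z C' A))"
        using Suc.prems assms(4) that by (auto simp del: restrict_apply)
      then show ?thesis using True by (simp add: upd)
    qed (simp add: upd)
    have "smooth_upto k C W (pd A (\<lambda>z. f (restrict z C')))" for A
    proof (cases "A \<in> C'")
      case True
      then have "pd A (\<lambda>z. f (restrict z C')) = (\<lambda>z. pd A f (restrict z C'))"
        by (simp add: pd_def upd fun_eq_iff del: fun_upd_apply)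
      then show ?thesis using Suc.IH[OF smooth_upto_Suc_elims(3)[OF Suc.prems True]] by (simp only:)
    next
      case False
      then have "pd A (\<lambda>z. f (restrict z C')) = (\<lambda>z. 0)"
        by (simp add: pd_def upd fun_eq_iff)
      then show ?thesis by (simp add: smooth_upto_const)
    qed
    then show ?case using 1 2 unfolding smooth_upto.simps by blast
  qed simp
  then show ?thesis using assms(1) by (auto simp: smooth_iff)
qed

lemma depends_upto_mono:
  assumes "depends_upto n m k W f" "k \<le> k'" "W' \<subseteq> W"
  shows "depends_upto n m k' W' f"
proof -
  have "jet_coords_upto n m k \<subseteq> jet_coords_upto n m k'"
    using assms(2) by (auto simp: jet_coords_upto_def)
  then show ?thesis using assms(1,3) unfolding depends_upto_def by (meson subsetD)
qed

lemma finite_jet_coords_upto: "finite (jet_coords_upto n m k)"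
proof -
  have "finite {I. set_mset I \<subseteq> {..<n} \<and> size I \<le> k}"
  proof (rule finite_subset)
    show "{I. set_mset I \<subseteq> {..<n} \<and> size I \<le> k} \<subseteq>
        mset ` {xs. set xs \<subseteq> {..<n} \<and> length xs \<le> k}"
    proof
      fix I :: "nat multiset" assume "I \<in> {I. set_mset I \<subseteq> {..<n} \<and> size I \<le> k}"
      moreover obtain xs where "I = mset xs" by (metis ex_mset)
      ultimately show "I \<in> mset ` {xs. set xs \<subseteq> {..<n} \<and> length xs \<le> k}" by auto
    qed
    show "finite (mset ` {xs. set xs \<subseteq> {..<n} \<and> length xs \<le> k})"
      by (intro finite_imageI finite_lists_length_le) simp
  qed
  then have "finite (Base ` {..<n} \<union>
      (\<lambda>(\<alpha>, I). Fib \<alpha> I) ` ({..<m} \<times> {I. set_mset I \<subseteq> {..<n} \<and> size I \<le> k}))"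
    by blast
  moreover have "jet_coords_upto n m k \<subseteq> Base ` {..<n} \<union>
      (\<lambda>(\<alpha>, I). Fib \<alpha> I) ` ({..<m} \<times> {I. set_mset I \<subseteq> {..<n} \<and> size I \<le> k})"
    by (auto simp: jet_coords_upto_def jet_coords_def base_coords_def multi_indices_def)
  ultimately show ?thesis by (rule rev_finite_subset)
qed

lemma sum'_eq_sum:
  assumes "finite S" "S \<subseteq> X" "\<And>x. x \<in> X \<Longrightarrow> x \<notin> S \<Longrightarrow> f x = 0"
  shows "sum' f X = sum f S"
proof -
  have "sum' f X = sum' f S"
    using assms(2,3) by (intro sum.mono_neutral_right') auto
  also have "\<dots> = sum f S" using assms(1) by (rule sum.eq_sum)
  finally show ?thesis .
qed

lemma smooth_finite_order_const: "smooth_finite_order n m W (\<lambda>_. c)"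
  by (auto simp: smooth_finite_order_def smooth_iff smooth_upto_const depends_upto_def)

lemma smooth_finite_order_coord:
  assumes "A \<in> jet_coords n m"
  shows "smooth_finite_order n m W (\<lambda>z. z A)"
proof -
  have "depends_upto n m (coord_order A) W (\<lambda>z. z A)"
    using assms by (auto simp: depends_upto_def jet_coords_upto_def)
  then show ?thesis using smooth_coord[OF assms] by (auto simp: smooth_finite_order_def)
qed

lemma smooth_finite_order_subset:
  "smooth_finite_order n m W f \<Longrightarrow> W' \<subseteq> W \<Longrightarrow> smooth_finite_order n m W' f"
  unfolding smooth_finite_order_def using smooth_subset depends_upto_mono by blast

lemma depends_upto_combine:
  assumes "depends_upto n m k W f" "depends_upto n m k' W g"
  shows "depends_upto n m (max k k') W (\<lambda>z. h (f z) (g z))"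
proof -
  have "depends_upto n m (max k k') W f" "depends_upto n m (max k k') W g"
    using assms depends_upto_mono[OF _ _ order.refl] max.cobounded1 max.cobounded2 by blast+
  then show ?thesis unfolding depends_upto_def by metis
qed

lemma dir_deriv_const [simp]: "dir_deriv C v (\<lambda>_. c) z = 0"
  by (simp add: dir_deriv_def sum.G_def)

context
  fixes n m :: nat and W :: "point set"
  assumes openW: "openin (powertop_real (jet_coords n m)) W"
begin

lemma smooth_finite_order_cong:
  assumes "smooth_finite_order n m W f" and eq: "\<And>z. z \<in> W \<Longrightarrow> f z = g z"
  shows "smooth_finite_order n m W g"
proof -
  from assms(1) obtain k where f: "smooth (jet_coords n m) W f" and d: "depends_upto n m k W f"
    by (auto simp: smooth_finite_order_def)
  have "smooth (jet_coords n m) W g" by (rule smooth_cong[OF openW eq f])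
  moreover have "depends_upto n m k W g" using d eq unfolding depends_upto_def by metis
  ultimately show ?thesis unfolding smooth_finite_order_def by blast
qed

lemma smooth_add:
  "smooth (jet_coords n m) W f \<Longrightarrow> smooth (jet_coords n m) W g \<Longrightarrow>
   smooth (jet_coords n m) W (\<lambda>z. f z + g z)"
  using smooth_upto_add[OF openW] by (auto simp: smooth_iff)

lemma smooth_mult:
  "smooth (jet_coords n m) W f \<Longrightarrow> smooth (jet_coords n m) W g \<Longrightarrow>
   smooth (jet_coords n m) W (\<lambda>z. f z * g z)"
  using smooth_upto_mult[OF openW] by (auto simp: smooth_iff)

lemma smooth_finite_order_add:
  "smooth_finite_order n m W f \<Longrightarrow> smooth_finite_order n m W g \<Longrightarrow>
   smooth_finite_order n m W (\<lambda>z. f z + g z)"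
  unfolding smooth_finite_order_def
  using smooth_add depends_upto_combine[of n m _ W f _ g "(+)"] by blast

lemma smooth_finite_order_mult:
  "smooth_finite_order n m W f \<Longrightarrow> smooth_finite_order n m W g \<Longrightarrow>
   smooth_finite_order n m W (\<lambda>z. f z * g z)"
  unfolding smooth_finite_order_def
  using smooth_mult depends_upto_combine[of n m _ W f _ g "(*)"] by blast

lemma smooth_finite_order_inverse:
  assumes "smooth_finite_order n m W f" "\<And>z. z \<in> W \<Longrightarrow> f z \<noteq> 0"
  shows "smooth_finite_order n m W (\<lambda>z. inverse (f z))"
proof -
  from assms(1) obtain k where f: "smooth (jet_coords n m) W f" and "depends_upto n m k W f"
    by (auto simp: smooth_finite_order_def)
  then have "depends_upto n m k W (\<lambda>z. inverse (f z))" unfolding depends_upto_def by metis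
  moreover have "smooth (jet_coords n m) W (\<lambda>z. inverse (f z))"
    using smooth_upto_inverse[OF openW assms(2)] f by (auto simp: smooth_iff)
  ultimately show ?thesis by (auto simp: smooth_finite_order_def)
qed

lemma smooth_finite_order_sum:
  "(\<And>x. x \<in> X \<Longrightarrow> smooth_finite_order n m W (f x)) \<Longrightarrow>
   smooth_finite_order n m W (\<lambda>z. \<Sum>x\<in>X. f x z)"
  by (induction X rule: infinite_finite_induct)
    (auto intro: smooth_finite_order_const smooth_finite_order_add)

text \<open>Coordinate lines may meet \<open>W\<close> in several pieces, so that \<open>f\<close> is controlled only for small changes
  of the coordinate \<open>A\<close>. This suffices for a derivative at a point of \<open>W\<close>.\<close>

lemma pd_eq_0_above_order:
  assumes "depends_upto n m k W f" "z \<in> W" "A \<in> jet_coords n m" "A \<notin> jet_coords_upto n m k"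
  shows "pd A f z = 0"
proof -
  have "\<forall>\<^sub>F t in nhds (z A). f (z(A := t)) = f z"
    using eventually_update_in[OF openW assms(2,3)]
  proof eventually_elim
    case (elim t)
    have "\<forall>B\<in>jet_coords_upto n m k. (z(A := t)) B = z B" using assms(4) by auto
    then show ?case
      using assms(1)[unfolded depends_upto_def] elim assms(2) by blast
  qed
  then have "pd A f z = deriv (\<lambda>_. f z) (z A)"
    unfolding pd_def by (rule deriv_cong_ev) simp
  then show ?thesis by simp
qed

lemma depends_upto_pd:
  assumes "depends_upto n m k W f" "A \<in> jet_coords_upto n m k"
  shows "depends_upto n m k W (pd A f)"
  unfolding depends_upto_def
proof (intro ballI impI)
  fix z z' assume zz: "z \<in> W" "z' \<in> W" and eq: "\<forall>A\<in>jet_coords_upto n m k. z A = z' A"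
  have A: "A \<in> jet_coords n m" using assms(2) by (simp add: jet_coords_upto_def)
  have zA: "z A = z' A" using eq assms(2) by simp
  have "\<forall>\<^sub>F t in nhds (z A). f (z(A := t)) = f (z'(A := t))"
    using eventually_update_in[OF openW zz(1) A]
      eventually_update_in[OF openW zz(2) A, folded zA]
  proof eventually_elim
    case (elim t)
    have "\<forall>B\<in>jet_coords_upto n m k. (z(A := t)) B = (z'(A := t)) B" using eq by auto
    then show ?case
      using assms(1)[unfolded depends_upto_def] elim by blast
  qed
  then show "pd A f z = pd A f z'" unfolding pd_def by (rule deriv_cong_ev) (rule zA)
qed

lemma dir_deriv_eq_sum:
  assumes "depends_upto n m k W f" "z \<in> W"
  shows "dir_deriv (jet_coords n m) v f z = (\<Sum>A\<in>jet_coords_upto n m k. v A * pd A f z)"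
  unfolding dir_deriv_def
  by (rule sum'_eq_sum)
    (use finite_jet_coords_upto pd_eq_0_above_order[OF assms] in \<open>auto simp: jet_coords_upto_def\<close>)

lemma dir_deriv_cong:
  assumes "\<And>y. y \<in> W \<Longrightarrow> f y = g y" "z \<in> W"
  shows "dir_deriv (jet_coords n m) v f z = dir_deriv (jet_coords n m) v g z"
  unfolding dir_deriv_def using pd_cong[OF openW assms(2) _ assms(1)]
  by (intro sum.cong') auto

lemma dir_deriv_add:
  assumes "smooth_finite_order n m W f" "smooth_finite_order n m W g" "z \<in> W"
  shows "dir_deriv (jet_coords n m) v (\<lambda>y. f y + g y) z =
    dir_deriv (jet_coords n m) v f z + dir_deriv (jet_coords n m) v g z"
proof -
  from assms(1,2) obtain k k' where sm: "smooth (jet_coords n m) W f" "smooth (jet_coords n m) W g"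
    and "depends_upto n m k W f" "depends_upto n m k' W g"
    by (auto simp: smooth_finite_order_def)
  then have d: "depends_upto n m (max k k') W f" "depends_upto n m (max k k') W g"
      "depends_upto n m (max k k') W (\<lambda>y. f y + g y)"
    using depends_upto_mono[OF _ _ order.refl] depends_upto_combine[of n m k W f k' g "(+)"] by auto
  have "pd A (\<lambda>y. f y + g y) z = pd A f z + pd A g z" if "A \<in> jet_coords_upto n m (max k k')" for A
    using that sm assms(3) by (intro pd_add smooth_differentiable) (auto simp: jet_coords_upto_def)
  then show ?thesis
    unfolding d[THEN dir_deriv_eq_sum, OF assms(3)] by (simp add: algebra_simps sum.distrib)
qed

lemma dir_deriv_mult:
  assumes "smooth_finite_order n m W f" "smooth_finite_order n m W g" "z \<in> W"
  shows "dir_deriv (jet_coords n m) v (\<lambda>y. f y * g y) z =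
    dir_deriv (jet_coords n m) v f z * g z + f z * dir_deriv (jet_coords n m) v g z"
proof -
  from assms(1,2) obtain k k' where sm: "smooth (jet_coords n m) W f" "smooth (jet_coords n m) W g"
    and "depends_upto n m k W f" "depends_upto n m k' W g"
    by (auto simp: smooth_finite_order_def)
  then have d: "depends_upto n m (max k k') W f" "depends_upto n m (max k k') W g"
      "depends_upto n m (max k k') W (\<lambda>y. f y * g y)"
    using depends_upto_mono[OF _ _ order.refl] depends_upto_combine[of n m k W f k' g "(*)"] by auto
  have "pd A (\<lambda>y. f y * g y) z = pd A f z * g z + f z * pd A g z"
    if "A \<in> jet_coords_upto n m (max k k')" for A
    using that sm assms(3) by (intro pd_mult smooth_differentiable) (auto simp: jet_coords_upto_def)
  then show ?thesis
    unfolding d[THEN dir_deriv_eq_sum, OF assms(3)]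
    by (simp add: algebra_simps sum.distrib sum_distrib_left sum_distrib_right)
qed

lemma dir_deriv_sum:
  assumes "\<And>x. x \<in> X \<Longrightarrow> smooth_finite_order n m W (f x)" "z \<in> W"
  shows "dir_deriv (jet_coords n m) v (\<lambda>y. \<Sum>x\<in>X. f x y) z =
    (\<Sum>x\<in>X. dir_deriv (jet_coords n m) v (f x) z)"
  using assms(1)
proof (induction X rule: infinite_finite_induct)
  case (insert x X)
  then show ?case
    using dir_deriv_add[of "f x" "\<lambda>y. \<Sum>x\<in>X. f x y", OF _ smooth_finite_order_sum assms(2)] by simp
qed auto

text \<open>The total derivative is an infinite sum, but a function of order \<open>k\<close> has finitely many nonzero
  partial derivatives. Its total derivative has order \<open>k + 1\<close>, since \<open>u\<^sup>\<alpha>\<^sub>I\<^sub>j\<close> enters as a factor.\<close>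

lemma smooth_finite_order_total_derivative:
  assumes "smooth_finite_order n m W f" "j < n"
  shows "smooth_finite_order n m W (\<lambda>z. dir_deriv (jet_coords n m) (total_field j z) f z)"
proof -
  from assms(1) obtain k where f: "smooth (jet_coords n m) W f" and d: "depends_upto n m k W f"
    by (auto simp: smooth_finite_order_def)
  have "smooth_finite_order n m W (\<lambda>z. total_field j z A * pd A f z)"
    if A: "A \<in> jet_coords_upto n m k" for A
  proof (rule smooth_finite_order_mult)
    show "smooth_finite_order n m W (pd A f)"
      using depends_upto_pd[OF d A] smooth_pd[OF f] A
      by (auto simp: smooth_finite_order_def jet_coords_upto_def)
    show "smooth_finite_order n m W (\<lambda>z. total_field j z A)"
    proof (cases A)
      case (Fib \<alpha> I)
      then have "Fib \<alpha> (add_mset j I) \<in> jet_coords n m"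
        using A assms(2)
        by (auto simp: jet_coords_upto_def jet_coords_def base_coords_def multi_indices_def)
      then show ?thesis using Fib smooth_finite_order_coord by simp
    qed (simp add: smooth_finite_order_const)
  qed
  then have "smooth_finite_order n m W (\<lambda>z. \<Sum>A\<in>jet_coords_upto n m k. total_field j z A * pd A f z)"
    by (rule smooth_finite_order_sum)
  then show ?thesis
    by (rule smooth_finite_order_cong) (simp add: dir_deriv_eq_sum[OF d])
qed

end

section \<open>Total derivatives, contractions and wedge products on a coordinate domain\<close>

lemma sum_apply_form: "(\<Sum>x\<in>X. F x) z vs = (\<Sum>x\<in>X. F x z vs)" for F :: "'i \<Rightarrow> form"
  by (induction X rule: infinite_finite_induct) auto

definition scale :: "(point \<Rightarrow> real) \<Rightarrow> form \<Rightarrow> form" where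
  "scale f \<omega> = (\<lambda>z vs. f z * \<omega> z vs)"

lemma scale_apply [simp]: "scale f \<omega> z vs = f z * \<omega> z vs"
  by (simp add: scale_def)

lemma scale_simps [simp]:
  "scale f 0 = 0" "scale (\<lambda>_. 0) \<omega> = 0" "scale (\<lambda>_. 1) \<omega> = \<omega>"
  "scale f (scale g \<omega>) = scale (\<lambda>z. f z * g z) \<omega>"
  by (auto simp: fun_eq_iff)

lemma scale_add: "scale f (\<omega> + \<eta>) = scale f \<omega> + scale f \<eta>"
  by (auto simp: fun_eq_iff algebra_simps)

lemma scale_minus_one: "scale (\<lambda>_. - 1) \<omega> = - \<omega>"
  by (auto simp: fun_eq_iff)

lemma scale_diff: "scale f (\<omega> - \<eta>) = scale f \<omega> - scale f \<eta>"
  by (auto simp: fun_eq_iff algebra_simps)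

lemma scale_sum: "scale f (\<Sum>x\<in>X. F x) = (\<Sum>x\<in>X. scale f (F x))"
  by (auto simp: fun_eq_iff sum_apply_form sum_distrib_left)

abbreviation remove_nth :: "nat \<Rightarrow> 'a list \<Rightarrow> 'a list" where
  "remove_nth i xs \<equiv> take i xs @ drop (Suc i) xs"

text \<open>The position in a list of the entry at position \<open>k\<close> of the list without its \<open>i\<close>-th entry.\<close>

definition skip :: "nat \<Rightarrow> nat \<Rightarrow> nat" where
  "skip i k = (if k < i then k else Suc k)"

lemma length_remove_nth: "i < length xs \<Longrightarrow> length (remove_nth i xs) = length xs - 1"
  by simp

lemma nth_remove_nth:
  "i < length xs \<Longrightarrow> k < length xs - 1 \<Longrightarrow> remove_nth i xs ! k = xs ! skip i k"
  by (auto simp: skip_def nth_append min_def)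

lemma remove_nth_update_skip:
  assumes "i < length xs" "k < length xs - 1"
  shows "remove_nth i (xs[skip i k := x]) = (remove_nth i xs)[k := x]"
proof (rule nth_equalityI)
  fix l assume "l < length (remove_nth i (xs[skip i k := x]))"
  then have l: "l < length xs - 1" using assms by (auto simp: min_def split: if_splits)
  have "skip i k = skip i l \<longleftrightarrow> k = l" by (auto simp: skip_def)
  moreover have "skip i k < length xs" "skip i l < length xs" using assms l by (auto simp: skip_def)
  moreover have "remove_nth i (xs[skip i k := x]) ! l = xs[skip i k := x] ! skip i l"
    using nth_remove_nth[of i "xs[skip i k := x]" l] assms l by simp
  moreover have "(remove_nth i xs)[k := x] ! l = (if k = l then x else xs ! skip i l)"
    using nth_remove_nth[of i xs l] assms l by (simp add: nth_list_update min_def)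
  ultimately show "remove_nth i (xs[skip i k := x]) ! l = (remove_nth i xs)[k := x] ! l"
    by (simp add: nth_list_update)
qed simp

lemma sum_skip:
  fixes f :: "nat \<Rightarrow> real"
  assumes "i < N"
  shows "(\<Sum>k<N. f k) = f i + (\<Sum>k<N - 1. f (skip i k))"
proof -
  have "(\<Sum>k<N. f k) = f i + (\<Sum>k\<in>{..<N} - {i}. f k)"
    using assms by (simp add: sum.remove)
  also have "(\<Sum>k\<in>{..<N} - {i}. f k) = (\<Sum>k<N - 1. f (skip i k))"
    by (rule sum.reindex_bij_witness[of _ "skip i" "\<lambda>k. if k < i then k else k - 1"])
      (use assms in \<open>auto simp: skip_def\<close>)
  finally show ?thesis .
qed

lemma wedge1_add: "wedge1 \<theta> (\<omega> + \<eta>) = wedge1 \<theta> \<omega> + wedge1 \<theta> \<eta>"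
  by (auto simp: fun_eq_iff wedge1_def algebra_simps sum.distrib)

lemma wedge1_scale: "wedge1 \<theta> (scale f \<omega>) = scale f (wedge1 \<theta> \<omega>)"
  by (auto simp: fun_eq_iff wedge1_def algebra_simps sum_distrib_left)

lemma wedge1_0 [simp]: "wedge1 \<theta> 0 = 0"
  by (auto simp: fun_eq_iff wedge1_def)

lemma wedge1_sum: "wedge1 \<theta> (\<Sum>x\<in>X. F x) = (\<Sum>x\<in>X. wedge1 \<theta> (F x))"
  by (induction X rule: infinite_finite_induct) (simp_all add: wedge1_add del: plus_fun_apply zero_fun_apply)

lemma wedge1_minus: "wedge1 \<theta> (- \<omega>) = - wedge1 \<theta> \<omega>"
  using wedge1_scale[of \<theta> "\<lambda>_. - 1" \<omega>] by (simp add: scale_minus_one)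

lemma interior_product_add:
  "interior_product v (\<omega> + \<eta>) = interior_product v \<omega> + interior_product v \<eta>"
  by (auto simp: fun_eq_iff interior_product_def)

lemma interior_product_scale:
  "interior_product v (scale f \<omega>) = scale f (interior_product v \<omega>)"
  by (auto simp: fun_eq_iff interior_product_def)

lemma interior_product_0 [simp]: "interior_product v 0 = 0"
  by (auto simp: fun_eq_iff interior_product_def)

lemma interior_product_wedge1:
  "interior_product v (wedge1 \<theta> \<omega>) =
     scale (\<lambda>z. \<theta> z v) \<omega> - wedge1 \<theta> (interior_product v \<omega>)"
proof (intro ext)
  fix z vs
  show "interior_product v (wedge1 \<theta> \<omega>) z vs =
    (scale (\<lambda>z. \<theta> z v) \<omega> - wedge1 \<theta> (interior_product v \<omega>)) z vs"
    by (simp add: interior_product_def wedge1_def sum.lessThan_Suc_shift sum_negf del: sum.lessThan_Suc)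
qed

lemma wedge1_anticommute: "wedge1 \<theta> (wedge1 \<theta>' \<omega>) = - wedge1 \<theta>' (wedge1 \<theta> \<omega>)"
proof (intro ext)
  fix z and vs :: "point list"
  let ?N = "length vs"
  define P where "P = {..<?N} \<times> {..<?N - 1}"
  define h where "h = (\<lambda>(i, k). (skip i k, if k < i then i - 1 else i))"
  define F :: "(point \<Rightarrow> point \<Rightarrow> real) \<Rightarrow> (point \<Rightarrow> point \<Rightarrow> real) \<Rightarrow> nat \<times> nat \<Rightarrow> real" where
    "F \<theta> \<theta>' = (\<lambda>(i, k). (- 1) ^ (i + k) * (\<theta> z (vs ! i) * \<theta>' z (vs ! skip i k)) *
       \<omega> z (remove_nth k (remove_nth i vs)))" for \<theta> \<theta>'
  have expand: "wedge1 \<theta> (wedge1 \<theta>' \<omega>) z vs = (\<Sum>p\<in>P. F \<theta> \<theta>' p)" for \<theta> \<theta>'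
  proof -
    have "(- 1) ^ i * \<theta> z (vs ! i) * wedge1 \<theta>' \<omega> z (remove_nth i vs) = (\<Sum>k<?N - 1. F \<theta> \<theta>' (i, k))"
      if "i < ?N" for i
    proof -
      have len: "length (remove_nth i vs) = ?N - 1" using that by simp
      have "wedge1 \<theta>' \<omega> z (remove_nth i vs) = (\<Sum>k<?N - 1. (- 1) ^ k * \<theta>' z (vs ! skip i k) *
          \<omega> z (remove_nth k (remove_nth i vs)))"
        unfolding wedge1_def len by (intro sum.cong refl) (use nth_remove_nth[OF that] in simp)
      then show ?thesis
        unfolding F_def by (simp add: sum_distrib_left power_add algebra_simps)
    qed
    note step = this
    have "wedge1 \<theta> (wedge1 \<theta>' \<omega>) z vs =
        (\<Sum>i<?N. (- 1) ^ i * \<theta> z (vs ! i) * wedge1 \<theta>' \<omega> z (remove_nth i vs))"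
      by (rule wedge1_def)
    also have "\<dots> = (\<Sum>i<?N. \<Sum>k<?N - 1. F \<theta> \<theta>' (i, k))"
      by (rule sum.cong[OF refl step]) simp
    also have "\<dots> = (\<Sum>p\<in>P. F \<theta> \<theta>' p)"
      unfolding P_def by (rule sum.cartesian_product'[symmetric])
    finally show ?thesis .
  qed
  \<comment> \<open>Removing the entries \<open>i\<close> and \<open>skip i k\<close> in either order leaves the same list, and the
    position of the second one drops by one exactly when it comes later; hence the sign.\<close>
  have involution: "h (h p) = p \<and> h p \<in> P \<and> - F \<theta>' \<theta> (h p) = F \<theta> \<theta>' p" if p: "p \<in> P" for p
  proof -
    obtain i k where ik: "p = (i, k)" "i < ?N" "k < ?N - 1" using p by (auto simp: P_def)
    have "h (h p) = p" "h p \<in> P" using ik by (auto simp: h_def skip_def P_def)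
    define i' k' where "i' = skip i k" and "k' = (if k < i then i - 1 else i)"
    have "skip i' k' = i" using ik by (auto simp: i'_def k'_def skip_def)
    moreover have "(- 1 :: real) ^ (i' + k') = - ((- 1) ^ (i + k))"
    proof (cases "k < i")
      case True
      then obtain i0 where "i = Suc i0" using gr0_implies_Suc[of i] by auto
      then show ?thesis using True by (simp add: i'_def k'_def skip_def add.commute)
    qed (simp add: i'_def k'_def skip_def add.commute)
    moreover have "remove_nth k' (remove_nth i' vs) = remove_nth k (remove_nth i vs)"
    proof (rule nth_equalityI)
      have bnd: "i' < ?N" "k' < ?N - 1" using ik by (auto simp: i'_def k'_def skip_def)
      have len: "length (remove_nth b (remove_nth a vs)) = ?N - 1 - 1"
        if "a < ?N" "b < ?N - 1" for a b
        using that length_remove_nth[of a vs] length_remove_nth[of b "remove_nth a vs"] by metis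
      then show "length (remove_nth k' (remove_nth i' vs)) = length (remove_nth k (remove_nth i vs))"
        using bnd ik by metis
      fix l assume "l < length (remove_nth k' (remove_nth i' vs))"
      then have l: "l < ?N - 1 - 1" using len[OF bnd] by metis
      have "remove_nth b (remove_nth a vs) ! l = vs ! skip a (skip b l)"
        if "a < ?N" "b < ?N - 1" for a b
      proof -
        have "skip b l < ?N - 1" using l by (auto simp: skip_def)
        then show ?thesis
          using nth_remove_nth[of b "remove_nth a vs" l] nth_remove_nth[of a vs "skip b l"] that l
            length_remove_nth[OF that(1)] by metis
      qed
      moreover have "skip i' (skip k' l) = skip i (skip k l)"
        by (auto simp: i'_def k'_def skip_def)
      ultimately show "remove_nth k' (remove_nth i' vs) ! l = remove_nth k (remove_nth i vs) ! l"
        using bnd ik by metis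
    qed
    ultimately have "- F \<theta>' \<theta> (h p) = F \<theta> \<theta>' p"
      unfolding F_def h_def ik(1) prod.case i'_def[symmetric] k'_def[symmetric] by simp
    with \<open>h (h p) = p\<close> \<open>h p \<in> P\<close> show ?thesis by blast
  qed
  have "(\<Sum>p\<in>P. F \<theta> \<theta>' p) = (\<Sum>p\<in>P. - F \<theta>' \<theta> p)"
    by (rule sum.reindex_bij_witness[of _ h h]) (use involution in blast)+
  then show "wedge1 \<theta> (wedge1 \<theta>' \<omega>) z vs = (- wedge1 \<theta>' (wedge1 \<theta> \<omega>)) z vs"
    by (simp add: expand sum_negf)
qed

lemma contact_form_coord_vector:
  "contact_form n \<alpha> I z (coord_vector (Fib \<beta> J)) = (if \<alpha> = \<beta> \<and> I = J then 1 else 0)"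
  by (simp add: contact_form_def coord_vector_def)

text \<open>The components of the total derivative field are linear in the coordinates, so its
  differential is the same at every point.\<close>

fun shift :: "nat \<Rightarrow> nat \<Rightarrow> nat \<Rightarrow> point \<Rightarrow> point" where
  "shift n m j v (Base i) = 0"
| "shift n m j v (Fib \<alpha> I) =
     (if Fib \<alpha> (add_mset j I) \<in> jet_coords n m then v (Fib \<alpha> (add_mset j I)) else 0)"

lemma dir_deriv_coord: "dir_deriv C v (\<lambda>y. y B) z = (if B \<in> C then v B else 0)"
proof -
  have "dir_deriv C v (\<lambda>y. y B) z = (\<Sum>A\<in>{B} \<inter> C. v A * pd A (\<lambda>y. y B) z)"
    unfolding dir_deriv_def by (rule sum'_eq_sum) (auto simp: pd_coord)
  then show ?thesis by (auto simp: pd_coord)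
qed

lemma differential_total_field:
  "differential (jet_coords n m) (total_field j) z v = shift n m j v"
proof
  fix A show "differential (jet_coords n m) (total_field j) z v A = shift n m j v A"
    by (cases A) (simp_all add: differential_def dir_deriv_coord)
qed

locale jet_open =
  fixes n m :: nat and W :: "point set"
  assumes openW: "openin (powertop_real (jet_coords n m)) W"
begin

abbreviation sf :: "(point \<Rightarrow> real) \<Rightarrow> bool" where
  "sf \<equiv> smooth_finite_order n m W"

lemmas sf_cong = smooth_finite_order_cong[OF openW]
  and sf_add = smooth_finite_order_add[OF openW]
  and sf_mult = smooth_finite_order_mult[OF openW]
  and sf_sum = smooth_finite_order_sum[OF openW]
  and sf_inverse = smooth_finite_order_inverse[OF openW]

text \<open>Forms are normalised to vanish off \<open>W\<close>, so that equality on \<open>W\<close> is equality.\<close>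

definition forms :: "form set" where
  "forms = {\<omega>. (\<forall>vs. sf (\<lambda>z. \<omega> z vs)) \<and> (\<forall>z vs. z \<notin> W \<longrightarrow> \<omega> z vs = 0)}"

definition cut :: "form \<Rightarrow> form" where
  "cut \<omega> = (\<lambda>z vs. if z \<in> W then \<omega> z vs else 0)"

definition tot :: "nat \<Rightarrow> (point \<Rightarrow> real) \<Rightarrow> point \<Rightarrow> real" where
  "tot j f z = dir_deriv (jet_coords n m) (total_field j z) f z"

definition D :: "nat \<Rightarrow> form \<Rightarrow> form" where
  "D j \<omega> = cut (total_deriv n m j \<omega>)"

lemma form_eqI:
  assumes "\<And>z vs. z \<notin> W \<Longrightarrow> \<omega> z vs = 0" "\<And>z vs. z \<notin> W \<Longrightarrow> \<eta> z vs = 0"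
    and "\<And>z vs. z \<in> W \<Longrightarrow> \<omega> z vs = \<eta> z vs"
  shows "\<omega> = (\<eta> :: form)"
  using assms by (metis ext)

lemma forms_sf: "\<omega> \<in> forms \<Longrightarrow> sf (\<lambda>z. \<omega> z vs)"
  by (simp add: forms_def)

lemma forms_off: "\<omega> \<in> forms \<Longrightarrow> z \<notin> W \<Longrightarrow> \<omega> z vs = 0"
  by (simp add: forms_def)

lemma zero_forms [simp]: "0 \<in> forms"
  by (simp add: forms_def smooth_finite_order_const)

lemma add_forms [simp]: "\<omega> \<in> forms \<Longrightarrow> \<eta> \<in> forms \<Longrightarrow> \<omega> + \<eta> \<in> forms"
  using sf_add by (simp add: forms_def)

lemma scale_forms [simp]: "sf f \<Longrightarrow> \<omega> \<in> forms \<Longrightarrow> scale f \<omega> \<in> forms"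
  using sf_mult by (simp add: forms_def)

lemma sf_const [simp]: "sf (\<lambda>_. c)"
  by (rule smooth_finite_order_const)

lemma sum_forms [simp]: "(\<And>x. x \<in> X \<Longrightarrow> F x \<in> forms) \<Longrightarrow> (\<Sum>x\<in>X. F x) \<in> forms"
  by (induction X rule: infinite_finite_induct) (simp_all del: plus_fun_apply zero_fun_apply)

lemma interior_product_forms [simp]: "\<omega> \<in> forms \<Longrightarrow> interior_product v \<omega> \<in> forms"
  by (simp add: forms_def interior_product_def)

lemma wedge1_forms:
  assumes "\<omega> \<in> forms" "\<And>v. sf (\<lambda>z. \<theta> z v)"
  shows "wedge1 \<theta> \<omega> \<in> forms"
proof -
  have "sf (\<lambda>z. wedge1 \<theta> \<omega> z vs)" for vs
    unfolding wedge1_def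
    by (intro sf_sum sf_mult
        forms_sf[OF assms(1)] assms(2) sf_const)
  moreover have "wedge1 \<theta> \<omega> z vs = 0" if "z \<notin> W" for z vs
    using forms_off[OF assms(1) that] by (simp add: wedge1_def)
  ultimately show ?thesis by (simp add: forms_def)
qed

lemma D_apply:
  "z \<in> W \<Longrightarrow> D j \<omega> z vs =
     tot j (\<lambda>y. \<omega> y vs) z + (\<Sum>i<length vs. \<omega> z (vs[i := shift n m j (vs ! i)]))"
  by (simp add: D_def cut_def total_deriv_def lie_deriv_def tot_def differential_total_field)

lemma D_off: "z \<notin> W \<Longrightarrow> D j \<omega> z vs = 0"
  by (simp add: D_def cut_def)

lemma sf_tot: "sf f \<Longrightarrow> j < n \<Longrightarrow> sf (tot j f)"
  using smooth_finite_order_total_derivative[OF openW] by (simp add: tot_def[abs_def])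

lemma D_forms [simp]:
  assumes "\<omega> \<in> forms" "j < n"
  shows "D j \<omega> \<in> forms"
proof -
  have "sf (\<lambda>z. D j \<omega> z vs)" for vs
  proof (rule sf_cong)
    show "sf (\<lambda>z. tot j (\<lambda>y. \<omega> y vs) z + (\<Sum>i<length vs. \<omega> z (vs[i := shift n m j (vs ! i)])))"
      by (intro sf_add sf_sum
          sf_tot[OF _ assms(2)] forms_sf[OF assms(1)])
  qed (simp add: D_apply)
  then show ?thesis by (simp add: forms_def D_off)
qed

lemma D_add:
  assumes "\<omega> \<in> forms" "\<eta> \<in> forms"
  shows "D j (\<omega> + \<eta>) = D j \<omega> + D j \<eta>"
proof (rule form_eqI)
  fix z vs assume "z \<in> W"
  then show "D j (\<omega> + \<eta>) z vs = (D j \<omega> + D j \<eta>) z vs"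
    using dir_deriv_add[OF openW forms_sf[OF assms(1)] forms_sf[OF assms(2)], of z]
    by (simp add: D_apply tot_def sum.distrib)
qed (simp_all add: D_off)

lemma D_scale:
  assumes "sf f" "\<omega> \<in> forms"
  shows "D j (scale f \<omega>) = scale (tot j f) \<omega> + scale f (D j \<omega>)"
proof (rule form_eqI)
  fix z vs assume "z \<in> W"
  then show "D j (scale f \<omega>) z vs = (scale (tot j f) \<omega> + scale f (D j \<omega>)) z vs"
    using dir_deriv_mult[OF openW assms(1) forms_sf[OF assms(2)], of z]
    by (simp add: D_apply tot_def algebra_simps sum_distrib_left)
qed (use forms_off[OF assms(2)] in \<open>simp_all add: D_off\<close>)

lemma D_0 [simp]: "D j 0 = 0"
  using D_add[of 0 0] by simp

lemma tot_const [simp]: "tot j (\<lambda>_. c) = (\<lambda>_. 0)"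
  by (simp add: tot_def[abs_def])

lemma D_scale_const: "\<omega> \<in> forms \<Longrightarrow> D j (scale (\<lambda>_. c) \<omega>) = scale (\<lambda>_. c) (D j \<omega>)"
  by (simp add: D_scale)

text \<open>The total derivative is a derivation. The correction terms of the Lie derivative replace one
  vector at a time; in the \<open>i\<close>-th summand of the wedge product, the replacement of the \<open>i\<close>-th vector
  belongs to the derivative of \<open>\<theta>\<close> and every other one to the derivative of \<open>\<omega>\<close>.\<close>

lemma D_wedge1:
  assumes "\<omega> \<in> forms" "\<And>v. sf (\<lambda>z. \<theta> z v)"
  shows "D j (wedge1 \<theta> \<omega>) =
    wedge1 (\<lambda>z v. tot j (\<lambda>y. \<theta> y v) z + \<theta> z (shift n m j v)) \<omega> + wedge1 \<theta> (D j \<omega>)"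
proof (rule form_eqI)
  fix z and vs :: "point list" assume z: "z \<in> W"
  let ?N = "length vs" and ?s = "shift n m j" and ?C = "jet_coords n m"
  note mult = sf_mult
  have 1: "tot j (\<lambda>y. wedge1 \<theta> \<omega> y vs) z =
    (\<Sum>i<?N. (- 1) ^ i * (tot j (\<lambda>y. \<theta> y (vs ! i)) z * \<omega> z (remove_nth i vs) +
       \<theta> z (vs ! i) * tot j (\<lambda>y. \<omega> y (remove_nth i vs)) z))"
  proof -
    have sm: "sf (\<lambda>y. (- 1) ^ i * \<theta> y (vs ! i))" for i by (intro mult sf_const assms(2))
    have "tot j (\<lambda>y. wedge1 \<theta> \<omega> y vs) z =
      (\<Sum>i<?N. tot j (\<lambda>y. (- 1) ^ i * \<theta> y (vs ! i) * \<omega> y (remove_nth i vs)) z)"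
      unfolding wedge1_def tot_def
      by (intro dir_deriv_sum[OF openW _ z] mult sm forms_sf[OF assms(1)])
    moreover have "tot j (\<lambda>y. (- 1) ^ i * \<theta> y (vs ! i) * \<omega> y (remove_nth i vs)) z =
      (- 1) ^ i * (tot j (\<lambda>y. \<theta> y (vs ! i)) z * \<omega> z (remove_nth i vs) +
       \<theta> z (vs ! i) * tot j (\<lambda>y. \<omega> y (remove_nth i vs)) z)" for i
      unfolding tot_def dir_deriv_mult[OF openW sm forms_sf[OF assms(1)] z]
        dir_deriv_mult[OF openW sf_const assms(2) z] dir_deriv_const
      by (simp add: algebra_simps)
    ultimately show ?thesis by (simp only:)
  qed
  have 2: "(\<Sum>k<?N. \<theta> z (vs[k := ?s (vs ! k)] ! i) * \<omega> z (remove_nth i (vs[k := ?s (vs ! k)]))) =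
    \<theta> z (?s (vs ! i)) * \<omega> z (remove_nth i vs) +
    \<theta> z (vs ! i) * (\<Sum>k<length (remove_nth i vs).
       \<omega> z ((remove_nth i vs)[k := ?s (remove_nth i vs ! k)]))" if i: "i < ?N" for i
  proof -
    have len: "length (remove_nth i vs) = ?N - 1" using i by simp
    have "\<theta> z (vs[skip i k := ?s (vs ! skip i k)] ! i) *
        \<omega> z (remove_nth i (vs[skip i k := ?s (vs ! skip i k)])) =
      \<theta> z (vs ! i) * \<omega> z ((remove_nth i vs)[k := ?s (remove_nth i vs ! k)])" if "k < ?N - 1" for k
    proof -
      have "skip i k \<noteq> i" by (auto simp: skip_def)
      then show ?thesis
        unfolding remove_nth_update_skip[OF i that] nth_remove_nth[OF i that] by simp
    qed
    then have "(\<Sum>k<?N - 1. \<theta> z (vs[skip i k := ?s (vs ! skip i k)] ! i) *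
        \<omega> z (remove_nth i (vs[skip i k := ?s (vs ! skip i k)]))) =
      \<theta> z (vs ! i) * (\<Sum>k<?N - 1. \<omega> z ((remove_nth i vs)[k := ?s (remove_nth i vs ! k)]))"
      unfolding sum_distrib_left by (intro sum.cong) auto
    then show ?thesis
      unfolding sum_skip[OF i] len using i by simp
  qed
  have "(\<Sum>k<?N. wedge1 \<theta> \<omega> z (vs[k := ?s (vs ! k)])) =
    (\<Sum>k<?N. \<Sum>i<?N. (- 1) ^ i * (\<theta> z (vs[k := ?s (vs ! k)] ! i) *
       \<omega> z (remove_nth i (vs[k := ?s (vs ! k)]))))"
    by (simp add: wedge1_def mult.assoc)
  also have "\<dots> = (\<Sum>i<?N. (- 1) ^ i * (\<Sum>k<?N. \<theta> z (vs[k := ?s (vs ! k)] ! i) *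
       \<omega> z (remove_nth i (vs[k := ?s (vs ! k)]))))"
    unfolding sum_distrib_left by (rule sum.swap)
  also have "\<dots> = (\<Sum>i<?N. (- 1) ^ i * (\<theta> z (?s (vs ! i)) * \<omega> z (remove_nth i vs) +
    \<theta> z (vs ! i) * (\<Sum>k<length (remove_nth i vs).
       \<omega> z ((remove_nth i vs)[k := ?s (remove_nth i vs ! k)]))))"
    by (intro sum.cong refl arg_cong2[where f = "(*)"] 2) simp
  finally show "D j (wedge1 \<theta> \<omega>) z vs =
    (wedge1 (\<lambda>z v. tot j (\<lambda>y. \<theta> y v) z + \<theta> z (?s v)) \<omega> + wedge1 \<theta> (D j \<omega>)) z vs"
    unfolding D_apply[OF z] 1 plus_fun_apply wedge1_def[of _ "D j \<omega>"]
    by (simp add: wedge1_def D_apply[OF z] sum.distrib[symmetric] algebra_simps del: length_append length_take length_drop)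
qed (use wedge1_forms[OF assms] forms_off[OF assms(1)] in \<open>simp_all add: D_off wedge1_def\<close>)

text \<open>The correction term of the Lie derivative for the first vector is the contraction with the Lie
  bracket of that vector and the total derivative field.\<close>

lemma interior_product_D:
  assumes "\<omega> \<in> forms"
  shows "interior_product v (D j \<omega>) = D j (interior_product v \<omega>) + interior_product (shift n m j v) \<omega>"
proof (rule form_eqI)
  fix z vs assume z: "z \<in> W"
  show "interior_product v (D j \<omega>) z vs =
    (D j (interior_product v \<omega>) + interior_product (shift n m j v) \<omega>) z vs"
    by (simp add: interior_product_def D_apply[OF z] sum.lessThan_Suc_shift del: sum.lessThan_Suc)
qed (use forms_off[OF assms] in \<open>simp_all add: D_off interior_product_def\<close>)

end

section \<open>Contact monomials and their linear combinations\<close>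

text \<open>The coefficients are functions from a set \<open>R\<close>. Adding one term at a time makes rule induction
  available for all statements on linear combinations.\<close>

inductive_set lin :: "(point \<Rightarrow> real) set \<Rightarrow> form set \<Rightarrow> form set"
  for R :: "(point \<Rightarrow> real) set" and X :: "form set" where
  lin_0: "0 \<in> lin R X"
| lin_step: "\<lbrakk>\<omega> \<in> lin R X; f \<in> R; x \<in> X\<rbrakk> \<Longrightarrow> \<omega> + scale f x \<in> lin R X"

lemma lin_add: "\<eta> \<in> lin R X \<Longrightarrow> \<omega> \<in> lin R X \<Longrightarrow> \<omega> + \<eta> \<in> lin R X"
proof (induction \<eta> rule: lin.induct)
  case (lin_step \<eta> f x)
  then show ?case using lin.lin_step[of "\<omega> + \<eta>" R X f x] by (simp only: add.assoc)
qed (simp only: add_0_right)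

lemma lin_mono: "\<omega> \<in> lin R X \<Longrightarrow> R \<subseteq> R' \<Longrightarrow> X \<subseteq> X' \<Longrightarrow> \<omega> \<in> lin R' X'"
  by (induction rule: lin.induct) (blast intro: lin.intros)+

lemma lin_scale:
  assumes "\<omega> \<in> lin R X" "\<And>g. g \<in> R \<Longrightarrow> (\<lambda>z. f z * g z) \<in> R"
  shows "scale f \<omega> \<in> lin R X"
  using assms(1)
proof (induction rule: lin.induct)
  case (lin_step \<omega> g x)
  then show ?case
    using lin.lin_step[OF lin_step.IH assms(2)] by (simp only: scale_add scale_simps)
qed (simp only: scale_simps lin_0)

lemma lin_sum: "(\<And>i. i \<in> A \<Longrightarrow> F i \<in> lin R X) \<Longrightarrow> (\<Sum>i\<in>A. F i) \<in> lin R X"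
proof (induction A rule: infinite_finite_induct)
  case (insert a A)
  have "F a + (\<Sum>i\<in>A. F i) \<in> lin R X" by (rule lin_add) (use insert in blast)+
  then show ?case using insert.hyps by (simp only: sum.insert not_False_eq_True)
qed (simp_all only: sum.infinite sum.empty lin_0 not_False_eq_True)

context jet_open
begin

abbreviation indices :: "(nat \<times> nat multiset) set" where
  "indices \<equiv> {..<m} \<times> multi_indices n"

abbreviation theta :: "nat \<Rightarrow> nat multiset \<Rightarrow> form \<Rightarrow> form" where
  "theta \<alpha> I \<equiv> wedge1 (contact_form n \<alpha> I)"

definition iota :: "nat \<Rightarrow> nat multiset \<Rightarrow> form \<Rightarrow> form" where
  "iota \<alpha> I = interior_product (coord_vector (Fib \<alpha> I))"

text \<open>The wedge product of the \<open>dx\<^sup>i\<close> for an arbitrary list of indices; the volume form is the case of all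
  indices in order.\<close>

definition vol_of :: "nat list \<Rightarrow> form" where
  "vol_of is = foldr (\<lambda>i. wedge1 (\<lambda>z v. v (Base i))) is (\<lambda>z vs. if z \<in> W \<and> vs = [] then 1 else 0)"

definition contact_mono :: "(nat \<times> nat multiset) list \<Rightarrow> form" where
  "contact_mono K = foldr (\<lambda>(\<alpha>, I). theta \<alpha> I) K (vol_of [0..<n])"

lemma contact_mono_simps [simp]:
  "contact_mono [] = vol_of [0..<n]"
  "contact_mono ((\<alpha>, I) # K) = theta \<alpha> I (contact_mono K)"
  by (simp_all add: contact_mono_def)

lemma vol_of_forms: "vol_of is \<in> forms"
proof (induction "is")
  case Nil
  have "sf (\<lambda>z. if z \<in> W \<and> vs = [] then 1 else 0)" for vs :: "point list"
    by (rule sf_cong[OF sf_const[of "if vs = [] then 1 else 0"]]) simp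
  then show ?case by (simp add: vol_of_def forms_def)
next
  case (Cons i "is")
  have "wedge1 (\<lambda>z v. v (Base i)) (vol_of is) \<in> forms"
    by (rule wedge1_forms[OF Cons]) simp
  then show ?case by (simp add: vol_of_def)
qed

text \<open>The one-forms \<open>dx\<^sup>i\<close> have constant coefficients, and the bracket of \<open>D\<^sub>j\<close> with a constant vector
  field has no base components; so \<open>D\<^sub>j dx\<^sup>i = 0\<close>.\<close>

lemma D_vol: "D j (vol_of is) = 0"
proof (induction "is")
  case Nil
  show ?case
  proof (rule form_eqI)
    fix z vs assume z: "z \<in> W"
    have "tot j (\<lambda>y. vol_of [] y vs) z = tot j (\<lambda>y. if vs = [] then 1 else 0) z"
      unfolding tot_def by (rule dir_deriv_cong[OF openW _ z]) (simp add: vol_of_def)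
    moreover have "vol_of [] z (vs[i := v]) = 0" if "i < length vs" for i v
      using that by (cases vs) (auto simp: vol_of_def split: nat.splits)
    ultimately show "D j (vol_of []) z vs = 0 z vs"
      by (simp add: D_apply[OF z])
  qed (simp_all add: D_off)
next
  case (Cons i "is")
  have eq: "vol_of (i # is) = wedge1 (\<lambda>z v. v (Base i)) (vol_of is)"
    by (simp add: vol_of_def)
  have "wedge1 (\<lambda>z v. 0) \<omega> = 0" for \<omega>
    by (auto simp: wedge1_def fun_eq_iff)
  then show ?case
    unfolding eq by (subst D_wedge1[OF vol_of_forms]) (simp_all add: Cons del: zero_fun_apply)
qed

lemma interior_product_vol:
  assumes "\<And>i. v (Base i) = 0"
  shows "interior_product v (vol_of is) = 0"
proof (induction "is")
  case Nil
  then show ?case by (auto simp: vol_of_def interior_product_def fun_eq_iff)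
next
  case (Cons i "is")
  have eq: "vol_of (i # is) = wedge1 (\<lambda>z v. v (Base i)) (vol_of is)"
    by (simp add: vol_of_def)
  show ?case
    unfolding eq interior_product_wedge1 Cons by (simp add: assms del: zero_fun_apply)
qed

lemma Fib_in_jet_coords: "Fib \<alpha> I \<in> jet_coords n m \<longleftrightarrow> (\<alpha>, I) \<in> indices"
  by (auto simp: jet_coords_def base_coords_def)

lemma add_mset_multi_indices [simp]:
  "add_mset j I \<in> multi_indices n \<longleftrightarrow> j < n \<and> I \<in> multi_indices n"
  by (auto simp: multi_indices_def)

lemma add_mset_indices: "(\<alpha>, I) \<in> indices \<Longrightarrow> j < n \<Longrightarrow> (\<alpha>, add_mset j I) \<in> indices"
  by simp

lemma sf_contact_form:
  assumes "(\<alpha>, I) \<in> indices"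
  shows "sf (\<lambda>z. contact_form n \<alpha> I z v)"
proof -
  have "sf (\<lambda>z. v (Fib \<alpha> I) + (\<Sum>j<n. z (Fib \<alpha> (add_mset j I)) * - v (Base j)))"
    by (intro sf_add sf_sum
        sf_mult sf_const smooth_finite_order_coord)
      (use assms in \<open>simp_all add: Fib_in_jet_coords\<close>)
  then show ?thesis by (simp add: contact_form_def sum_negf)
qed

lemma theta_forms [simp]: "(\<alpha>, I) \<in> indices \<Longrightarrow> \<omega> \<in> forms \<Longrightarrow> theta \<alpha> I \<omega> \<in> forms"
  by (intro wedge1_forms sf_contact_form)

lemma contact_mono_forms:
  assumes "K \<in> lists indices"
  shows "contact_mono K \<in> forms"
  using assms
proof (induction rule: lists.induct)
  case (Cons a K)
  then show ?case by (cases a) (auto intro!: theta_forms simp del: mem_Sigma_iff)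
qed (simp add: vol_of_forms)

text \<open>The rule \<open>D\<^sub>j \<theta>\<^sup>\<alpha>\<^sub>I = \<theta>\<^sup>\<alpha>\<^sub>I\<^sub>j\<close>: the shift of the vector produces \<open>du\<^sup>\<alpha>\<^sub>I\<^sub>j\<close>, and the derivative of the
  coefficients of \<open>\<theta>\<^sup>\<alpha>\<^sub>I\<close> produces the horizontal terms.\<close>

lemma D_theta:
  assumes "(\<alpha>, I) \<in> indices" "\<omega> \<in> forms" "j < n"
  shows "D j (theta \<alpha> I \<omega>) = theta \<alpha> (add_mset j I) \<omega> + theta \<alpha> I (D j \<omega>)"
proof -
  have contact: "tot j (\<lambda>y. contact_form n \<alpha> I y v) z + contact_form n \<alpha> I z (shift n m j v) =
      contact_form n \<alpha> (add_mset j I) z v" if z: "z \<in> W" for z v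
  proof -
    have sm: "sf (\<lambda>y. y (Fib \<alpha> (add_mset k I)))" if "k < n" for k
      using assms(1) that by (intro smooth_finite_order_coord) (simp add: Fib_in_jet_coords)
    have sm': "sf (\<lambda>y. y (Fib \<alpha> (add_mset k I)) * - v (Base k))" if "k < n" for k
      by (intro sf_mult sm that sf_const)
    have "tot j (\<lambda>y. contact_form n \<alpha> I y v) z =
        tot j (\<lambda>y. v (Fib \<alpha> I) + (\<Sum>k<n. y (Fib \<alpha> (add_mset k I)) * - v (Base k))) z"
      by (simp add: contact_form_def sum_negf)
    also have "\<dots> = (\<Sum>k<n. tot j (\<lambda>y. y (Fib \<alpha> (add_mset k I)) * - v (Base k)) z)"
      unfolding tot_def
    proof (subst dir_deriv_add[OF openW _ _ z])
      show "sf (\<lambda>y. \<Sum>k<n. y (Fib \<alpha> (add_mset k I)) * - v (Base k))"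
        by (rule sf_sum[OF sm']) simp
    qed (rule sf_const, subst dir_deriv_sum[OF openW sm' z], simp_all)
    also have "\<dots> = (\<Sum>k<n. z (Fib \<alpha> (add_mset j (add_mset k I))) * - v (Base k))"
    proof (rule sum.cong[OF refl])
      fix k assume "k \<in> {..<n}"
      then have k: "k < n" by simp
      have "(\<alpha>, add_mset k I) \<in> indices" using assms(1) k by (rule add_mset_indices)
      then show "tot j (\<lambda>y. y (Fib \<alpha> (add_mset k I)) * - v (Base k)) z =
          z (Fib \<alpha> (add_mset j (add_mset k I))) * - v (Base k)"
        unfolding tot_def dir_deriv_mult[OF openW sm[OF k] sf_const z] dir_deriv_const dir_deriv_coord
        by (simp add: Fib_in_jet_coords)
    qed
    finally show ?thesis
      using assms(1,3)
      by (simp add: contact_form_def sum_negf Fib_in_jet_coords add_mset_commute)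
  qed
  have "wedge1 (\<lambda>z v. tot j (\<lambda>y. contact_form n \<alpha> I y v) z + contact_form n \<alpha> I z (shift n m j v)) \<omega> =
      theta \<alpha> (add_mset j I) \<omega>"
  proof (rule form_eqI)
    fix z vs assume "z \<in> W"
    then show "wedge1 (\<lambda>z v. tot j (\<lambda>y. contact_form n \<alpha> I y v) z + contact_form n \<alpha> I z (shift n m j v)) \<omega> z vs =
      theta \<alpha> (add_mset j I) \<omega> z vs"
      unfolding wedge1_def by (simp add: contact)
  qed (use forms_off[OF assms(2)] in \<open>simp_all add: wedge1_def\<close>)
  then show ?thesis
    using D_wedge1[OF assms(2), of "contact_form n \<alpha> I" j] sf_contact_form[OF assms(1)] by simp
qed

lemma iota_theta:
  "iota \<beta> J (theta \<alpha> I \<omega>) = (if (\<alpha>, I) = (\<beta>, J) then \<omega> else 0) - theta \<alpha> I (iota \<beta> J \<omega>)"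
proof -
  have "scale (\<lambda>z. contact_form n \<alpha> I z (coord_vector (Fib \<beta> J))) \<omega> =
      (if (\<alpha>, I) = (\<beta>, J) then \<omega> else 0)"
    by (intro ext) (simp add: contact_form_coord_vector)
  then show ?thesis unfolding iota_def interior_product_wedge1 by (simp only:)
qed

lemma iota_vol: "iota \<alpha> I (vol_of is) = 0"
  unfolding iota_def by (rule interior_product_vol) (simp add: coord_vector_def)

lemma iota_add: "iota \<alpha> I (\<omega> + \<eta>) = iota \<alpha> I \<omega> + iota \<alpha> I \<eta>"
  by (simp only: iota_def interior_product_add)

lemma iota_scale: "iota \<alpha> I (scale f \<omega>) = scale f (iota \<alpha> I \<omega>)"
  by (simp only: iota_def interior_product_scale)

lemma iota_0 [simp]: "iota \<alpha> I 0 = 0"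
  by (simp only: iota_def interior_product_0)

lemma iota_forms [simp]: "\<omega> \<in> forms \<Longrightarrow> iota \<alpha> I \<omega> \<in> forms"
  by (simp add: iota_def)

subsection \<open>Combinations with constant and with smooth coefficients\<close>

definition constants :: "(point \<Rightarrow> real) set" where
  "constants = range (\<lambda>c _. c)"

abbreviation combs :: "(point \<Rightarrow> real) set \<Rightarrow> (nat \<times> nat multiset) list set \<Rightarrow> form set" where
  "combs R Q \<equiv> lin R (contact_mono ` Q)"

abbreviation CS :: "(nat \<times> nat multiset) list set \<Rightarrow> form set" where
  "CS \<equiv> combs constants"

abbreviation SP :: "(nat \<times> nat multiset) list set \<Rightarrow> form set" where
  "SP \<equiv> combs (Collect sf)"

abbreviation valid_lists :: "(nat \<times> nat multiset) list set" where
  "valid_lists \<equiv> lists indices"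

text \<open>The weight bound is an integer so that it may be lowered below 0, where the set is empty.\<close>

definition weight_lists :: "nat \<Rightarrow> int \<Rightarrow> (nat \<times> nat multiset) list set" where
  "weight_lists s w = {K \<in> contact_lists n m s. int (\<Sum>(\<alpha>, I)\<leftarrow>K. size I) \<le> w}"

text \<open>For \<open>s \<ge> 1\<close> these monomials span the step \<open>w\<close> of the filtration.\<close>

definition source_lists :: "nat \<Rightarrow> int \<Rightarrow> (nat \<times> nat multiset) list set" where
  "source_lists s w = {K \<in> contact_lists n m s.
     snd (hd K) = {#} \<and> int (\<Sum>(\<alpha>, I)\<leftarrow>tl K. size I) \<le> w}"

lemma weight_lists_mono: "w \<le> w' \<Longrightarrow> weight_lists s w \<subseteq> weight_lists s w'"
  by (auto simp: weight_lists_def)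

lemma weight_lists_valid: "weight_lists s w \<subseteq> valid_lists"
  by (auto simp: weight_lists_def contact_lists_def)

lemma source_lists_weight: "source_lists (Suc s) w \<subseteq> weight_lists (Suc s) w"
proof
  fix K assume K: "K \<in> source_lists (Suc s) w"
  then obtain a K' where "K = a # K'" by (cases K) (auto simp: source_lists_def contact_lists_def)
  then show "K \<in> weight_lists (Suc s) w"
    using K by (cases a) (auto simp: source_lists_def weight_lists_def)
qed

lemma Cons_weight_lists:
  "(\<alpha>, I) # K \<in> weight_lists s w \<longleftrightarrow>
     (\<alpha>, I) \<in> indices \<and> (\<exists>s'. s = Suc s' \<and> K \<in> weight_lists s' (w - int (size I)))"
  by (auto simp: weight_lists_def contact_lists_def)

lemma Cons_source_lists:
  "\<alpha> < m \<Longrightarrow> K \<in> weight_lists s w \<Longrightarrow> (\<alpha>, {#}) # K \<in> source_lists (Suc s) w"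
  by (auto simp: source_lists_def weight_lists_def contact_lists_def multi_indices_def)

text \<open>Combinations with constant and with smooth coefficients are treated together. Closure under
  total derivatives is what the product rule needs.\<close>

definition coeff_ring :: "(point \<Rightarrow> real) set \<Rightarrow> bool" where
  "coeff_ring R \<longleftrightarrow> constants \<subseteq> R \<and> R \<subseteq> Collect sf \<and>
     (\<forall>f\<in>R. \<forall>g\<in>R. (\<lambda>z. f z * g z) \<in> R) \<and> (\<forall>f\<in>R. \<forall>j<n. tot j f \<in> R)"

lemma ring_constants: "coeff_ring constants"
  by (auto simp: coeff_ring_def constants_def)

lemma ring_smooth: "coeff_ring (Collect sf)"
  using sf_mult sf_tot by (auto simp: coeff_ring_def constants_def)

lemma const_in_ring: "coeff_ring R \<Longrightarrow> (\<lambda>_. c) \<in> R"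
  by (auto simp: coeff_ring_def constants_def)

lemma ring_sf: "coeff_ring R \<Longrightarrow> f \<in> R \<Longrightarrow> sf f"
  by (auto simp: coeff_ring_def)

lemma lin_forms:
  assumes "\<omega> \<in> combs R Q" "coeff_ring R" "Q \<subseteq> valid_lists"
  shows "\<omega> \<in> forms"
  using assms(1)
proof (induction rule: lin.induct)
  case (lin_step \<omega> f x)
  then obtain K where K: "K \<in> Q" "x = contact_mono K" by blast
  then have "x \<in> forms" using assms(3) contact_mono_forms[of K] by blast
  then show ?case
    using lin_step.IH ring_sf[OF assms(2) lin_step.hyps(2)] by (intro add_forms scale_forms)
qed (rule zero_forms)

lemmas CS_forms = lin_forms[OF _ ring_constants]
lemmas SP_forms = lin_forms[OF _ ring_smooth]

lemma lin_subset: "\<omega> \<in> combs R Q \<Longrightarrow> Q \<subseteq> Q' \<Longrightarrow> \<omega> \<in> combs R Q'"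
  by (rule lin_mono[OF _ order.refl image_mono])

lemma CS_lin: "\<omega> \<in> CS Q \<Longrightarrow> coeff_ring R \<Longrightarrow> \<omega> \<in> combs R Q"
  by (rule lin_mono) (auto simp: coeff_ring_def)

lemma lin_scale_const:
  "\<omega> \<in> combs R Q \<Longrightarrow> coeff_ring R \<Longrightarrow> f \<in> R \<Longrightarrow>
   scale f \<omega> \<in> combs R Q"
  by (rule lin_scale) (auto simp: coeff_ring_def)

lemma lin_minus:
  "\<omega> \<in> combs R Q \<Longrightarrow> coeff_ring R \<Longrightarrow> - \<omega> \<in> combs R Q"
  using lin_scale_const[OF _ _ const_in_ring, of \<omega> R Q "- 1"] by (simp only: scale_minus_one)

lemma lin_diff:
  "\<omega> \<in> combs R Q \<Longrightarrow> \<eta> \<in> combs R Q \<Longrightarrow> coeff_ring R \<Longrightarrow>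
   \<omega> - \<eta> \<in> combs R Q"
  using lin_add[of "- \<eta>" R _ \<omega>] lin_minus by (simp only: diff_conv_add_uminus)

lemma contact_mono_lin:
  "K \<in> Q \<Longrightarrow> coeff_ring R \<Longrightarrow> contact_mono K \<in> combs R Q"
  using lin_step[OF lin_0 const_in_ring[of R 1], of "contact_mono K" "contact_mono ` Q"]
  by (simp only: scale_simps add_0_left image_eqI)

text \<open>An additive operator maps a span into a span as soon as it does so for multiples of monomials.\<close>

lemma lin_image:
  assumes "\<omega> \<in> combs R Q" "coeff_ring R" "Q \<subseteq> valid_lists"
    and add: "\<And>\<omega> \<eta>. \<omega> \<in> forms \<Longrightarrow> \<eta> \<in> forms \<Longrightarrow> T (\<omega> + \<eta>) = T \<omega> + T \<eta>"
    and base: "\<And>f K. f \<in> R \<Longrightarrow> K \<in> Q \<Longrightarrow> T (scale f (contact_mono K)) \<in> combs R Q'"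
  shows "T \<omega> \<in> combs R Q'"
  using assms(1)
proof (induction rule: lin.induct)
  case lin_0
  have "T 0 = 0" using add[of 0 0] by simp
  then show ?case by (simp only: lin.lin_0)
next
  case (lin_step \<omega> f x)
  then obtain K where K: "K \<in> Q" "x = contact_mono K" by blast
  have "\<omega> \<in> forms" using lin_forms[OF lin_step.hyps(1) assms(2,3)] .
  moreover have "scale f x \<in> forms"
    using K assms(3) contact_mono_forms[of K] ring_sf[OF assms(2) lin_step.hyps(2)]
    by (intro scale_forms) auto
  ultimately have "T (\<omega> + scale f x) = T \<omega> + T (scale f x)" by (rule add)
  then show ?case using lin_add[OF base[OF lin_step.hyps(2) K(1)] lin_step.IH] K by (simp only:)
qed

lemma lin_image_linear:
  assumes "\<omega> \<in> combs R Q" "coeff_ring R" "Q \<subseteq> valid_lists"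
    and add: "\<And>\<omega> \<eta>. T (\<omega> + \<eta>) = T \<omega> + T \<eta>"
    and scale: "\<And>f \<omega>. T (scale f \<omega>) = scale f (T \<omega>)"
    and base: "\<And>K. K \<in> Q \<Longrightarrow> T (contact_mono K) \<in> CS Q'"
  shows "T \<omega> \<in> combs R Q'"
  using assms(1-3) add
proof (rule lin_image)
  fix f K assume "f \<in> R" "K \<in> Q"
  then show "T (scale f (contact_mono K)) \<in> combs R Q'"
    unfolding scale using CS_lin[OF base assms(2)] lin_scale_const assms(2) by blast
qed

lemma theta_lin:
  assumes "\<omega> \<in> combs R (weight_lists s w)" "coeff_ring R" "(\<alpha>, I) \<in> indices"
  shows "theta \<alpha> I \<omega> \<in> combs R (weight_lists (Suc s) (w + int (size I)))"
  using assms(1,2) weight_lists_valid wedge1_add wedge1_scale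
proof (rule lin_image_linear)
  fix K assume K: "K \<in> weight_lists s w"
  have "(\<alpha>, I) # K \<in> weight_lists (Suc s) (w + int (size I))"
    using K assms(3) by (simp add: Cons_weight_lists)
  from contact_mono_lin[OF this ring_constants]
  show "theta \<alpha> I (contact_mono K) \<in> CS (weight_lists (Suc s) (w + int (size I)))" by simp
qed

lemma theta_source_lin:
  assumes "\<omega> \<in> combs R (weight_lists s w)" "coeff_ring R" "\<alpha> < m"
  shows "theta \<alpha> {#} \<omega> \<in> combs R (source_lists (Suc s) w)"
  using assms(1,2) weight_lists_valid wedge1_add wedge1_scale
proof (rule lin_image_linear)
  fix K assume K: "K \<in> weight_lists s w"
  from contact_mono_lin[OF Cons_source_lists[OF assms(3) K] ring_constants]
  show "theta \<alpha> {#} (contact_mono K) \<in> CS (source_lists (Suc s) w)" by simp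
qed

text \<open>Contraction removes one of the factors \<open>\<theta>\<^sup>\<beta>\<^sub>J\<close>, whose share of the weight is \<open>|J|\<close>.\<close>

lemma iota_contact_mono:
  assumes "K \<in> weight_lists (Suc s) w"
  shows "iota \<beta> J (contact_mono K) \<in> CS (weight_lists s (w - int (size J)))"
  using assms
proof (induction K arbitrary: s w)
  case Nil
  then show ?case by (simp add: weight_lists_def contact_lists_def)
next
  case (Cons a K)
  obtain \<alpha> I where a: "a = (\<alpha>, I)" by (cases a)
  have K: "(\<alpha>, I) \<in> indices" "K \<in> weight_lists s (w - int (size I))"
    using Cons.prems unfolding a Cons_weight_lists by auto
  have 1: "(if (\<alpha>, I) = (\<beta>, J) then contact_mono K else 0) \<in> CS (weight_lists s (w - int (size J)))"
  proof (cases "(\<alpha>, I) = (\<beta>, J)")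
    case True
    then show ?thesis using contact_mono_lin[OF K(2) ring_constants] by simp
  next
    case False
    then show ?thesis by (simp only: if_False lin_0)
  qed
  have 2: "theta \<alpha> I (iota \<beta> J (contact_mono K)) \<in> CS (weight_lists s (w - int (size J)))"
  proof (cases s)
    case 0
    then have "K = []" using K by (simp add: weight_lists_def contact_lists_def)
    then show ?thesis by (simp add: iota_vol lin_0 del: zero_fun_apply)
  next
    case (Suc s')
    have "iota \<beta> J (contact_mono K) \<in> CS (weight_lists s' (w - int (size I) - int (size J)))"
      using K Suc by (intro Cons.IH) simp
    from theta_lin[OF this ring_constants K(1)] show ?thesis
      unfolding Suc by (simp add: algebra_simps)
  qed
  show ?case
    unfolding a contact_mono_simps iota_theta by (rule lin_diff[OF 1 2 ring_constants])
qed

lemma iota_lin: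
  assumes "\<omega> \<in> combs R (weight_lists (Suc s) w)" "coeff_ring R"
  shows "iota \<beta> J \<omega> \<in> combs R (weight_lists s (w - int (size J)))"
  using assms weight_lists_valid iota_add iota_scale iota_contact_mono by (rule lin_image_linear)

text \<open>By the product rule, \<open>D\<^sub>j\<close> appends \<open>j\<close> to the multi-index of one factor in each term.\<close>

lemma D_contact_mono:
  assumes "K \<in> weight_lists s w" "j < n"
  shows "D j (contact_mono K) \<in> CS (weight_lists s (w + 1))"
  using assms(1)
proof (induction K arbitrary: s w)
  case Nil
  show ?case by (simp only: contact_mono_simps D_vol lin_0)
next
  case (Cons a K)
  obtain \<alpha> I where a: "a = (\<alpha>, I)" by (cases a)
  obtain s' where K: "(\<alpha>, I) \<in> indices" "s = Suc s'" "K \<in> weight_lists s' (w - int (size I))"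
    using Cons.prems unfolding a Cons_weight_lists by blast
  have "K \<in> valid_lists" using K(3) weight_lists_valid by blast
  then have K': "contact_mono K \<in> forms" by (rule contact_mono_forms)
  have "(\<alpha>, add_mset j I) # K \<in> weight_lists s (w + 1)"
    using K assms(2) by (simp add: Cons_weight_lists)
  from contact_mono_lin[OF this ring_constants]
  have 1: "theta \<alpha> (add_mset j I) (contact_mono K) \<in> CS (weight_lists s (w + 1))" by simp
  have 2: "theta \<alpha> I (D j (contact_mono K)) \<in> CS (weight_lists s (w + 1))"
    using theta_lin[OF Cons.IH[OF K(3)] ring_constants K(1)] K(2)
    by (simp add: algebra_simps)
  show ?case
    unfolding a contact_mono_simps D_theta[OF K(1) K' assms(2)] by (rule lin_add[OF 2 1])
qed

lemma D_lin:
  assumes "\<omega> \<in> combs R (weight_lists s w)" "coeff_ring R" "j < n"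
  shows "D j \<omega> \<in> combs R (weight_lists s (w + 1))"
  using assms(1,2) weight_lists_valid D_add
proof (rule lin_image)
  fix f K assume f: "f \<in> R" and K: "K \<in> weight_lists s w"
  have sf: "sf f" using f assms(2) by (rule ring_sf[rotated])
  have tot: "tot j f \<in> R" using f assms(2,3) by (simp add: coeff_ring_def)
  have Kf: "contact_mono K \<in> forms" using K weight_lists_valid by (intro contact_mono_forms) blast
  have "K \<in> weight_lists s (w + 1)" using K weight_lists_mono[of w "w + 1"] by auto
  then have "scale (tot j f) (contact_mono K) \<in> combs R (weight_lists s (w + 1))"
    using contact_mono_lin lin_scale_const assms(2) tot by blast
  moreover have "scale f (D j (contact_mono K)) \<in> combs R (weight_lists s (w + 1))"
    using CS_lin[OF D_contact_mono[OF K assms(3)] assms(2)] lin_scale_const assms(2) f by blast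
  ultimately show "D j (scale f (contact_mono K)) \<in> combs R (weight_lists s (w + 1))"
    unfolding D_scale[OF sf Kf] by (rule lin_add[rotated])
qed

end

section \<open>The interior Euler operator on a coordinate domain\<close>

context jet_open
begin

definition nD :: "nat multiset \<Rightarrow> form \<Rightarrow> form" where
  "nD I \<omega> = scale (\<lambda>_. (- 1) ^ size I) (foldr D (sorted_list_of_multiset I) \<omega>)"

lemma foldr_D_forms: "set L \<subseteq> {..<n} \<Longrightarrow> \<omega> \<in> forms \<Longrightarrow> foldr D L \<omega> \<in> forms"
  by (induction L) auto

lemma foldr_D_add:
  "set L \<subseteq> {..<n} \<Longrightarrow> \<omega> \<in> forms \<Longrightarrow> \<eta> \<in> forms \<Longrightarrow>
   foldr D L (\<omega> + \<eta>) = foldr D L \<omega> + foldr D L \<eta>"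
  by (induction L) (simp_all add: D_add foldr_D_forms del: plus_fun_apply)

lemma foldr_D_0: "foldr D L 0 = 0"
  by (induction L) (simp_all del: zero_fun_apply)

lemma foldr_D_scale_const:
  "set L \<subseteq> {..<n} \<Longrightarrow> \<omega> \<in> forms \<Longrightarrow> foldr D L (scale (\<lambda>_. c) \<omega>) = scale (\<lambda>_. c) (foldr D L \<omega>)"
  by (induction L) (simp_all add: D_scale_const foldr_D_forms)

lemma foldr_D_lin:
  assumes "\<omega> \<in> combs R (weight_lists s w)" "coeff_ring R" "set L \<subseteq> {..<n}"
  shows "foldr D L \<omega> \<in> combs R (weight_lists s (w + int (length L)))"
  using assms(3)
proof (induction L)
  case (Cons j L)
  then show ?case using D_lin[OF Cons.IH assms(2), of j] by (simp add: algebra_simps)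
qed (use assms(1) in simp)

text \<open>Every derivative that falls on the coefficient \<open>f\<close> instead of the form is lost for the
  weight of the monomials.\<close>

lemma foldr_D_scale_defect:
  assumes "\<kappa> \<in> CS (weight_lists s w)" "sf f" "set L \<subseteq> {..<n}"
  shows "foldr D L (scale f \<kappa>) - scale f (foldr D L \<kappa>) \<in> SP (weight_lists s (w + int (length L) - 1))"
  using assms(3)
proof (induction L)
  case Nil
  show ?case by (simp add: lin_0 del: zero_fun_apply)
next
  case (Cons j L)
  have j: "j < n" and L: "set L \<subseteq> {..<n}" using Cons.prems by auto
  define \<mu> where "\<mu> = foldr D L \<kappa>"
  define \<epsilon> where "\<epsilon> = foldr D L (scale f \<kappa>) - scale f \<mu>"
  have \<mu>: "\<mu> \<in> CS (weight_lists s (w + int (length L)))"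
    unfolding \<mu>_def by (rule foldr_D_lin[OF assms(1) ring_constants L])
  have \<epsilon>: "\<epsilon> \<in> SP (weight_lists s (w + int (length L) - 1))"
    using Cons.IH[OF L] by (simp only: \<epsilon>_def \<mu>_def)
  note \<mu>_form = CS_forms[OF \<mu> weight_lists_valid] and \<epsilon>_form = SP_forms[OF \<epsilon> weight_lists_valid]
  have "D j (foldr D L (scale f \<kappa>)) = D j (scale f \<mu> + \<epsilon>)"
    by (simp add: \<epsilon>_def)
  also have "\<dots> = scale (tot j f) \<mu> + scale f (D j \<mu>) + D j \<epsilon>"
    using \<mu>_form \<epsilon>_form assms(2) by (simp only: D_add scale_forms D_scale)
  finally have "foldr D (j # L) (scale f \<kappa>) - scale f (foldr D (j # L) \<kappa>) =
      scale (tot j f) \<mu> + D j \<epsilon>"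
    by (simp only: \<mu>_def foldr_Cons o_apply diff_eq_eq add_ac)
  moreover have w: "w + int (length (j # L)) - 1 = w + int (length L)" by simp
  moreover have "scale (tot j f) \<mu> \<in> SP (weight_lists s (w + int (length L)))"
    using lin_scale_const[OF CS_lin[OF \<mu> ring_smooth] ring_smooth] sf_tot[OF assms(2) j]
    by simp
  moreover have "D j \<epsilon> \<in> SP (weight_lists s (w + int (length L)))"
    using D_lin[OF \<epsilon> ring_smooth j] by simp
  ultimately show ?case by (simp only: lin_add)
qed

lemma sorted_indices: "I \<in> multi_indices n \<Longrightarrow> set (sorted_list_of_multiset I) \<subseteq> {..<n}"
  by (simp add: multi_indices_def)

lemma length_sorted: "length (sorted_list_of_multiset I) = size I"
  by (metis mset_sorted_list_of_multiset size_mset)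

lemma nD_forms: "I \<in> multi_indices n \<Longrightarrow> \<omega> \<in> forms \<Longrightarrow> nD I \<omega> \<in> forms"
  unfolding nD_def by (intro scale_forms sf_const foldr_D_forms sorted_indices)

lemma nD_0: "nD I 0 = 0"
  by (simp only: nD_def foldr_D_0 scale_simps)

lemma nD_add:
  "I \<in> multi_indices n \<Longrightarrow> \<omega> \<in> forms \<Longrightarrow> \<eta> \<in> forms \<Longrightarrow> nD I (\<omega> + \<eta>) = nD I \<omega> + nD I \<eta>"
  by (simp only: nD_def foldr_D_add sorted_indices scale_add)

lemma nD_scale_const:
  "I \<in> multi_indices n \<Longrightarrow> \<omega> \<in> forms \<Longrightarrow> nD I (scale (\<lambda>_. c) \<omega>) = scale (\<lambda>_. c) (nD I \<omega>)"
  by (simp only: nD_def foldr_D_scale_const sorted_indices scale_simps mult.commute)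

lemma nD_lin:
  assumes "\<omega> \<in> combs R (weight_lists s w)" "coeff_ring R" "I \<in> multi_indices n"
  shows "nD I \<omega> \<in> combs R (weight_lists s (w + int (size I)))"
  using foldr_D_lin[OF assms(1,2) sorted_indices[OF assms(3)]]
  unfolding nD_def length_sorted by (rule lin_scale_const[OF _ assms(2) const_in_ring[OF assms(2)]])

lemma nD_scale_defect:
  assumes "\<kappa> \<in> CS (weight_lists s w)" "sf f" "I \<in> multi_indices n"
  shows "nD I (scale f \<kappa>) - scale f (nD I \<kappa>) \<in> SP (weight_lists s (w + int (size I) - 1))"
proof -
  let ?L = "sorted_list_of_multiset I"
  have "scale (\<lambda>_. (- 1) ^ size I) (foldr D ?L (scale f \<kappa>) - scale f (foldr D ?L \<kappa>))
      \<in> SP (weight_lists s (w + int (size I) - 1))"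
    using foldr_D_scale_defect[OF assms(1,2) sorted_indices[OF assms(3)]]
    unfolding length_sorted
    by (rule lin_scale_const[OF _ ring_smooth const_in_ring[OF ring_smooth]])
  then show ?thesis
    by (simp only: nD_def scale_diff scale_simps mult.commute)
qed

definition E :: "nat \<Rightarrow> form \<Rightarrow> form" where
  "E s \<omega> = cut (euler_local n m s \<omega>)"

text \<open>A finite set of multi-indices to which the sum in the Euler operator can be restricted. The same
  set serves for all indices \<open>\<alpha>\<close>.\<close>

definition supported :: "nat multiset set \<Rightarrow> form \<Rightarrow> bool" where
  "supported S \<omega> \<longleftrightarrow> finite S \<and> S \<subseteq> multi_indices n \<and>
     (\<forall>\<alpha><m. \<forall>I\<in>multi_indices n - S. iota \<alpha> I \<omega> = 0)"

definition eul :: "nat \<Rightarrow> nat multiset set \<Rightarrow> form \<Rightarrow> form" where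
  "eul s S \<omega> = scale (\<lambda>_. 1 / real s) (\<Sum>\<alpha><m. theta \<alpha> {#} (\<Sum>I\<in>S. nD I (iota \<alpha> I \<omega>)))"

lemma eul_forms:
  assumes "\<omega> \<in> forms" "S \<subseteq> multi_indices n"
  shows "eul s S \<omega> \<in> forms"
  unfolding eul_def
proof (intro scale_forms sf_const sum_forms theta_forms)
  fix \<alpha> I assume "\<alpha> \<in> {..<m}" "I \<in> S"
  then show "nD I (iota \<alpha> I \<omega>) \<in> forms" using assms by (intro nD_forms iota_forms) auto
qed (simp add: multi_indices_def)

lemma total_deriv_cong:
  assumes "\<And>y vs. y \<in> W \<Longrightarrow> \<omega> y vs = \<eta> y vs" "z \<in> W"
  shows "total_deriv n m j \<omega> z vs = total_deriv n m j \<eta> z vs"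
  unfolding total_deriv_def lie_deriv_def
  using dir_deriv_cong[OF openW assms(1) assms(2)] assms by (simp only:)

lemma foldr_total_deriv_eq:
  "z \<in> W \<Longrightarrow> foldr (total_deriv n m) L \<omega> z vs = foldr D L \<omega> z vs"
proof (induction L arbitrary: z vs)
  case (Cons j L)
  have "total_deriv n m j (foldr (total_deriv n m) L \<omega>) z vs = total_deriv n m j (foldr D L \<omega>) z vs"
    by (rule total_deriv_cong[OF Cons.IH Cons.prems])
  moreover have "D j \<eta> z vs = total_deriv n m j \<eta> z vs" for \<eta>
    using Cons.prems by (simp add: D_def cut_def)
  ultimately show ?case by (simp only: foldr_Cons o_apply)
qed simp

text \<open>On \<open>W\<close> the local expression of the Euler operator is a finite sum of compositions of operators
  that are additive on forms.\<close>

lemma E_eq_eul: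
  assumes "\<omega> \<in> forms" "supported S \<omega>"
  shows "E s \<omega> = eul s S \<omega>"
proof (rule form_eqI)
  fix z vs assume z: "z \<in> W"
  have "sum' (\<lambda>I. neg_total_deriv n m I (interior_product (coord_vector (Fib \<alpha> I)) \<omega>) z ws) (multi_indices n) =
      (\<Sum>I\<in>S. nD I (iota \<alpha> I \<omega>)) z ws" if \<alpha>: "\<alpha> < m" for \<alpha> ws
  proof -
    have eq: "neg_total_deriv n m I (interior_product (coord_vector (Fib \<alpha> I)) \<omega>) z ws =
        nD I (iota \<alpha> I \<omega>) z ws" for I
      by (simp add: neg_total_deriv_def nD_def iota_def foldr_total_deriv_eq[OF z])
    have "nD I (iota \<alpha> I \<omega>) z ws = 0" if "I \<in> multi_indices n" "I \<notin> S" for I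
    proof -
      have "iota \<alpha> I \<omega> = 0" using assms(2) that \<alpha> by (simp add: supported_def del: zero_fun_apply)
      then show ?thesis by (simp only: nD_0 zero_fun_apply)
    qed
    then show ?thesis
      unfolding eq sum_apply_form using assms(2) by (intro sum'_eq_sum) (auto simp: supported_def)
  qed
  then show "E s \<omega> z vs = eul s S \<omega> z vs"
    unfolding E_def cut_def euler_local_def eul_def wedge1_def
    using z by (simp add: sum_apply_form wedge1_def)
next
  show "eul s S \<omega> z vs = 0" if "z \<notin> W" for z vs
    using eul_forms[OF assms(1)] assms(2) forms_off[OF _ that] by (simp add: supported_def)
qed (simp add: E_def cut_def)

lemma supported_contact_mono:
  assumes "K \<in> valid_lists"
  shows "supported (snd ` set K) (contact_mono K)"
proof -
  have "iota \<alpha> I (contact_mono K) = 0" if "I \<notin> snd ` set K" for \<alpha> I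
    using that
  proof (induction K)
    case (Cons a K)
    obtain \<beta> J where a: "a = (\<beta>, J)" by (cases a)
    have "iota \<alpha> I (contact_mono K) = 0" by (rule Cons.IH) (use Cons.prems in simp)
    moreover have "(\<beta>, J) \<noteq> (\<alpha>, I)" using Cons.prems a by auto
    ultimately show ?case
      unfolding a contact_mono_simps iota_theta by (simp only: if_False wedge1_0 diff_self)
  qed (simp add: iota_vol del: zero_fun_apply)
  moreover have "snd ` set K \<subseteq> multi_indices n" using assms by auto
  ultimately show ?thesis by (simp add: supported_def)
qed

lemma supported_add: "supported S \<omega> \<Longrightarrow> supported S \<eta> \<Longrightarrow> supported S (\<omega> + \<eta>)"
  by (simp add: supported_def iota_add del: plus_fun_apply zero_fun_apply)

lemma supported_scale: "supported S \<omega> \<Longrightarrow> supported S (scale f \<omega>)"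
  by (simp add: supported_def iota_scale del: zero_fun_apply)

lemma supported_Un:
  assumes "supported S \<omega>" "supported S' \<eta>"
  shows "supported (S \<union> S') \<omega>" "supported (S \<union> S') \<eta>"
  using assms unfolding supported_def by blast+

lemma lin_supported:
  assumes "\<omega> \<in> combs R valid_lists"
  obtains S where "supported S \<omega>"
proof -
  have "\<exists>S. supported S \<omega>"
    using assms
  proof (induction rule: lin.induct)
    case lin_0
    have "supported {} 0" by (simp add: supported_def del: zero_fun_apply)
    then show ?case ..
  next
    case (lin_step \<omega> f x)
    then obtain S K where S: "supported S \<omega>" and K: "K \<in> valid_lists" "x = contact_mono K" by blast
    note u = supported_Un[OF S supported_scale[OF supported_contact_mono[OF K(1)], of f]]
    from supported_add[OF u] show ?case unfolding K(2) by blast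
  qed
  then show thesis using that by blast
qed

lemma eul_add:
  assumes "\<omega> \<in> forms" "\<eta> \<in> forms" "S \<subseteq> multi_indices n"
  shows "eul s S (\<omega> + \<eta>) = eul s S \<omega> + eul s S \<eta>"
proof -
  have "nD I (iota \<alpha> I (\<omega> + \<eta>)) = nD I (iota \<alpha> I \<omega>) + nD I (iota \<alpha> I \<eta>)" if "I \<in> S" for \<alpha> I
    using that assms nD_add[of I "iota \<alpha> I \<omega>" "iota \<alpha> I \<eta>"] by (simp add: iota_add subset_iff del: plus_fun_apply)
  then have "(\<Sum>I\<in>S. nD I (iota \<alpha> I (\<omega> + \<eta>))) =
      (\<Sum>I\<in>S. nD I (iota \<alpha> I \<omega>)) + (\<Sum>I\<in>S. nD I (iota \<alpha> I \<eta>))" for \<alpha>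
    unfolding sum.distrib[symmetric] by (intro sum.cong refl)
  then show ?thesis
    by (simp only: eul_def wedge1_add sum.distrib scale_add)
qed

lemma eul_scale_const:
  assumes "\<omega> \<in> forms" "S \<subseteq> multi_indices n"
  shows "eul s S (scale (\<lambda>_. c) \<omega>) = scale (\<lambda>_. c) (eul s S \<omega>)"
proof -
  have "nD I (iota \<alpha> I (scale (\<lambda>_. c) \<omega>)) = scale (\<lambda>_. c) (nD I (iota \<alpha> I \<omega>))" if "I \<in> S" for \<alpha> I
    using that assms nD_scale_const[of I "iota \<alpha> I \<omega>" c] by (simp add: iota_scale subset_iff)
  then have "(\<Sum>I\<in>S. nD I (iota \<alpha> I (scale (\<lambda>_. c) \<omega>))) =
      scale (\<lambda>_. c) (\<Sum>I\<in>S. nD I (iota \<alpha> I \<omega>))" for \<alpha>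
    unfolding scale_sum by (intro sum.cong refl)
  then show ?thesis
    by (simp only: eul_def wedge1_scale scale_sum[symmetric] scale_simps mult.commute)
qed

lemma SP_valid:
  assumes "\<omega> \<in> combs R Q" "coeff_ring R" "Q \<subseteq> valid_lists"
  shows "\<omega> \<in> SP valid_lists"
  by (rule lin_mono[OF assms(1)]) (use assms in \<open>auto simp: coeff_ring_def\<close>)

lemma E_add:
  assumes "\<omega> \<in> SP valid_lists" "\<eta> \<in> SP valid_lists"
  shows "E s (\<omega> + \<eta>) = E s \<omega> + E s \<eta>"
proof -
  obtain S S' where "supported S \<omega>" "supported S' \<eta>"
    using assms lin_supported by metis
  note u = supported_Un[OF this]
  have S: "S \<union> S' \<subseteq> multi_indices n" using u by (simp add: supported_def)
  have f: "\<omega> \<in> forms" "\<eta> \<in> forms" using assms SP_forms by blast+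
  show ?thesis
    using E_eq_eul[OF add_forms[OF f] supported_add[OF u]] E_eq_eul[OF f(1) u(1)] E_eq_eul[OF f(2) u(2)]
      eul_add[OF f S] by (simp only:)
qed

lemma E_scale_const:
  assumes "\<omega> \<in> SP valid_lists"
  shows "E s (scale (\<lambda>_. c) \<omega>) = scale (\<lambda>_. c) (E s \<omega>)"
proof -
  obtain S where u: "supported S \<omega>" using assms lin_supported by metis
  then have S: "S \<subseteq> multi_indices n" by (simp add: supported_def)
  have f: "\<omega> \<in> forms" using assms SP_forms by blast
  show ?thesis
    using E_eq_eul[OF scale_forms[OF sf_const f] supported_scale[OF u]] E_eq_eul[OF f u]
      eul_scale_const[OF f S] by (simp only:)
qed

text \<open>Contracting with \<open>\<partial>\<^sup>I\<^sub>\<alpha>\<close> lowers the weight by \<open>|I|\<close> and \<open>(-D)\<^sub>I\<close> raises it by at most as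
  much.\<close>

lemma E_lin:
  assumes "\<omega> \<in> combs R (weight_lists (Suc s) w)" "coeff_ring R"
  shows "E (Suc s) \<omega> \<in> combs R (source_lists (Suc s) w)"
proof -
  have v: "\<omega> \<in> SP valid_lists" by (rule SP_valid[OF assms weight_lists_valid])
  then obtain S where S: "supported S \<omega>" using lin_supported by metis
  have "nD I (iota \<alpha> I \<omega>) \<in> combs R (weight_lists s w)" if "I \<in> S" for \<alpha> I
    using nD_lin[OF iota_lin[OF assms, where \<beta> = \<alpha> and J = I] assms(2), of I] that S by (auto simp: supported_def)
  then have "theta \<alpha> {#} (\<Sum>I\<in>S. nD I (iota \<alpha> I \<omega>)) \<in> combs R (source_lists (Suc s) w)"
    if "\<alpha> < m" for \<alpha>
    using that assms(2) by (intro theta_source_lin lin_sum)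
  then have "eul (Suc s) S \<omega> \<in> combs R (source_lists (Suc s) w)"
    unfolding eul_def using assms(2) by (intro lin_scale_const const_in_ring lin_sum) auto
  then show ?thesis
    using E_eq_eul[OF SP_forms[OF v order.refl] S] by (simp only:)
qed

text \<open>Contractions and wedge products are linear over functions, so the defect comes from the total
  derivatives only, where it is of lower weight.\<close>

lemma E_scale_defect_constants:
  assumes "\<kappa> \<in> CS (weight_lists (Suc s) w)" "sf f"
  shows "E (Suc s) (scale f \<kappa>) - scale f (E (Suc s) \<kappa>) \<in> SP (source_lists (Suc s) (w - 1))"
proof -
  have v: "\<kappa> \<in> SP valid_lists"
    by (rule SP_valid[OF assms(1) ring_constants weight_lists_valid])
  then obtain S where S: "supported S \<kappa>" using lin_supported by metis
  have \<kappa>: "\<kappa> \<in> forms" by (rule SP_forms[OF v order.refl])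
  have "nD I (scale f (iota \<alpha> I \<kappa>)) - scale f (nD I (iota \<alpha> I \<kappa>)) \<in> SP (weight_lists s (w - 1))"
    if "I \<in> S" for \<alpha> I
    using nD_scale_defect[OF iota_lin[OF assms(1) ring_constants, where \<beta> = \<alpha> and J = I] assms(2), of I] that S
    by (auto simp: supported_def)
  then have "theta \<alpha> {#} (\<Sum>I\<in>S. nD I (scale f (iota \<alpha> I \<kappa>)) - scale f (nD I (iota \<alpha> I \<kappa>)))
      \<in> SP (source_lists (Suc s) (w - 1))" if "\<alpha> < m" for \<alpha>
    using that ring_smooth by (intro theta_source_lin lin_sum)
  then have "scale (\<lambda>_. 1 / real (Suc s)) (\<Sum>\<alpha><m. theta \<alpha> {#}
      (\<Sum>I\<in>S. nD I (scale f (iota \<alpha> I \<kappa>)) - scale f (nD I (iota \<alpha> I \<kappa>))))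
      \<in> SP (source_lists (Suc s) (w - 1))" (is "?d \<in> _")
    using ring_smooth by (intro lin_scale_const const_in_ring lin_sum) auto
  moreover have "?d = eul (Suc s) S (scale f \<kappa>) - scale f (eul (Suc s) S \<kappa>)"
  proof -
    have "theta \<alpha> {#} (\<omega> - \<eta>) = theta \<alpha> {#} \<omega> - theta \<alpha> {#} \<eta>" for \<alpha> \<omega> \<eta>
      using wedge1_add[of _ \<omega> "- \<eta>"] by (simp only: wedge1_minus diff_conv_add_uminus)
    then show ?thesis
      unfolding eul_def iota_scale
      by (simp only: sum_subtractf scale_diff scale_sum wedge1_scale wedge1_sum scale_simps mult.commute)
  qed
  ultimately show ?thesis
    using E_eq_eul[OF scale_forms[OF assms(2) \<kappa>] supported_scale[OF S]] E_eq_eul[OF \<kappa> S]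
    by (simp only:)
qed

end

section \<open>Idempotence modulo lower weight\<close>

context jet_open
begin

lemma valid_weight: "K \<in> valid_lists \<Longrightarrow> \<exists>w. K \<in> weight_lists (length K) w"
  by (auto simp: weight_lists_def contact_lists_def in_lists_conv_set)

lemma D_valid:
  assumes "\<kappa> \<in> CS valid_lists" "j < n"
  shows "D j \<kappa> \<in> CS valid_lists"
  using assms(1) ring_constants order.refl D_add
proof (rule lin_image)
  fix f K assume f: "f \<in> constants" and K: "K \<in> valid_lists"
  obtain c where c: "f = (\<lambda>_. c)" using f by (auto simp: constants_def)
  obtain w where "K \<in> weight_lists (length K) w" using valid_weight[OF K] by blast
  then have "D j (contact_mono K) \<in> CS valid_lists"
    using lin_subset[OF D_contact_mono[OF _ assms(2)] weight_lists_valid] by blast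
  then show "D j (scale f (contact_mono K)) \<in> CS valid_lists"
    unfolding c D_scale_const[OF contact_mono_forms[OF K]]
    by (rule lin_scale_const[OF _ ring_constants const_in_ring[OF ring_constants]])
qed

lemma theta_valid:
  assumes "\<kappa> \<in> CS valid_lists" "(\<alpha>, I) \<in> indices"
  shows "theta \<alpha> I \<kappa> \<in> CS valid_lists"
  using assms(1) ring_constants order.refl wedge1_add wedge1_scale
proof (rule lin_image_linear)
  fix K assume "K \<in> valid_lists"
  then have "(\<alpha>, I) # K \<in> valid_lists" using assms(2) by simp
  from contact_mono_lin[OF this ring_constants]
  show "theta \<alpha> I (contact_mono K) \<in> CS valid_lists" by simp
qed

lemma iota_valid:
  assumes "\<kappa> \<in> CS valid_lists"
  shows "iota \<alpha> I \<kappa> \<in> CS valid_lists"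
  using assms ring_constants order.refl iota_add iota_scale
proof (rule lin_image_linear)
  fix K assume K: "K \<in> valid_lists"
  obtain w where w: "K \<in> weight_lists (length K) w" using valid_weight[OF K] by blast
  show "iota \<alpha> I (contact_mono K) \<in> CS valid_lists"
  proof (cases K)
    case Nil
    show ?thesis unfolding Nil contact_mono_simps iota_vol by (rule lin_0)
  next
    case (Cons a K')
    then show ?thesis
      using lin_subset[OF iota_contact_mono weight_lists_valid] w by (metis length_Cons)
  qed
qed

lemma const_valid: "\<kappa> \<in> CS valid_lists \<Longrightarrow> scale (\<lambda>_. c) \<kappa> \<in> CS valid_lists"
  by (rule lin_scale_const[OF _ ring_constants const_in_ring[OF ring_constants]])

lemma CS_SP: "\<kappa> \<in> CS valid_lists \<Longrightarrow> \<kappa> \<in> SP valid_lists"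
  by (rule CS_lin[OF _ ring_smooth])

lemma CS_forms': "\<kappa> \<in> CS valid_lists \<Longrightarrow> \<kappa> \<in> forms"
  by (rule CS_forms[OF _ order.refl])

lemma foldr_D_valid: "\<kappa> \<in> CS valid_lists \<Longrightarrow> set L \<subseteq> {..<n} \<Longrightarrow> foldr D L \<kappa> \<in> CS valid_lists"
  by (induction L) (simp_all add: D_valid)

text \<open>For constant coefficients no second derivatives of coefficient functions occur, and the
  total derivatives commute by the product rule alone.\<close>

lemma D_commute:
  assumes "\<kappa> \<in> CS valid_lists" "i < n" "j < n"
  shows "D i (D j \<kappa>) = D j (D i \<kappa>)"
proof -
  have mono: "D i (D j (contact_mono K)) = D j (D i (contact_mono K))" if "K \<in> valid_lists" for K
    using that
  proof (induction rule: lists.induct)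
    case Nil
    show ?case by (simp only: contact_mono_simps D_vol D_0)
  next
    case (Cons a K)
    obtain \<alpha> I where a: "a = (\<alpha>, I)" by (cases a)
    have I: "(\<alpha>, I) \<in> indices" using Cons a by simp
    have mu: "contact_mono K \<in> forms" by (rule contact_mono_forms) (use Cons in simp)
    have step: "D i (D j (theta \<alpha> I (contact_mono K))) =
        theta \<alpha> (add_mset i (add_mset j I)) (contact_mono K) + theta \<alpha> (add_mset j I) (D i (contact_mono K)) +
        (theta \<alpha> (add_mset i I) (D j (contact_mono K)) + theta \<alpha> I (D i (D j (contact_mono K))))"
      if "i < n" "j < n" for i j
    proof -
      have Ij: "(\<alpha>, add_mset j I) \<in> indices" by (rule add_mset_indices[OF I that(2)])
      have Dj: "D j (contact_mono K) \<in> forms" by (rule D_forms[OF mu that(2)])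
      show ?thesis
        unfolding D_theta[OF I mu that(2)] D_add[OF theta_forms[OF Ij mu] theta_forms[OF I Dj]]
          D_theta[OF Ij mu that(1)] D_theta[OF I Dj that(1)] by (rule refl)
    qed
    show ?case
      unfolding a contact_mono_simps step[OF assms(2,3)] step[OF assms(3,2)] Cons.IH
        add_mset_commute[of i j] by (simp only: add_ac)
  qed
  show ?thesis
    using assms(1)
  proof (induction rule: lin.induct)
    case lin_0
    show ?case by (simp only: D_0)
  next
    case (lin_step \<omega> f x)
    obtain c K where c: "f = (\<lambda>_. c)" and K: "K \<in> valid_lists" "x = contact_mono K"
      using lin_step.hyps by (auto simp: constants_def)
    have x: "x \<in> forms" unfolding K(2) by (rule contact_mono_forms[OF K(1)])
    note \<omega> = CS_forms'[OF lin_step.hyps(1)]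
    show ?case
      unfolding c using x \<omega> assms(2,3) mono[OF K(1), folded K(2)] lin_step.IH
      by (simp only: D_add D_forms scale_forms sf_const D_scale_const)
  qed
qed

lemma foldr_D_swap:
  "\<kappa> \<in> CS valid_lists \<Longrightarrow> j < n \<Longrightarrow> set L \<subseteq> {..<n} \<Longrightarrow> foldr D L (D j \<kappa>) = D j (foldr D L \<kappa>)"
proof (induction L)
  case (Cons i L)
  then show ?case using D_commute[OF foldr_D_valid[OF Cons.prems(1)], of L i j] by simp
qed simp

text \<open>\<open>(-D)\<^sub>I\<close> applies the derivatives in the order of a sorted list. As they commute, the new index \<open>j\<close> may
  be applied first.\<close>

lemma nD_add_mset:
  assumes "\<kappa> \<in> CS valid_lists" "j < n" "I \<in> multi_indices n"
  shows "nD (add_mset j I) \<kappa> = - nD I (D j \<kappa>)"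
proof -
  have insort: "foldr D (insort j L) \<kappa> = foldr D L (D j \<kappa>)" if "set L \<subseteq> {..<n}" for L
    using that
  proof (induction L)
    case (Cons i L)
    then show ?case using foldr_D_swap[OF assms(1,2), of "i # L"] by simp
  qed simp
  have "nD (add_mset j I) \<kappa> =
      scale (\<lambda>_. - 1) (scale (\<lambda>_. (- 1) ^ size I) (foldr D (sorted_list_of_multiset I) (D j \<kappa>)))"
    unfolding nD_def sorted_list_of_multiset_insert insort[OF sorted_indices[OF assms(3)]]
    by (simp only: scale_simps size_add_mset power_Suc)
  then show ?thesis unfolding nD_def scale_minus_one .
qed

text \<open>Contact monomials are linear in the vectors. The zero vector occurs as the bracket \<open>[\<partial>\<^sup>I\<^sub>\<alpha>, D\<^sub>j]\<close> when \<open>j\<close> is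
  not an entry of \<open>I\<close>.\<close>

lemma interior_product_zero_vector:
  assumes "\<kappa> \<in> CS valid_lists"
  shows "interior_product (\<lambda>_. 0) \<kappa> = 0"
proof -
  have mono: "interior_product (\<lambda>_. 0) (contact_mono K) = 0" for K
  proof (induction K)
    case Nil
    show ?case unfolding contact_mono_simps by (rule interior_product_vol) simp
  next
    case (Cons a K)
    obtain \<alpha> I where a: "a = (\<alpha>, I)" by (cases a)
    show ?case
      unfolding a contact_mono_simps interior_product_wedge1 Cons.IH
      by (simp only: contact_form_def mult_zero_right sum.neutral_const diff_self scale_simps wedge1_0)
  qed
  show ?thesis
    using assms
  proof (induction rule: lin.induct)
    case (lin_step \<omega> f x)
    then obtain K where "x = contact_mono K" by blast
    then show ?case
      using lin_step.IH mono[of K]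
      by (simp only: interior_product_add interior_product_scale scale_simps add_0_left)
  qed (rule interior_product_0)
qed

lemma shift_coord_vector:
  assumes "(\<alpha>, I) \<in> indices"
  shows "shift n m j (coord_vector (Fib \<alpha> I)) =
    (if j \<in># I then coord_vector (Fib \<alpha> (I - {#j#})) else (\<lambda>_. 0))"
proof
  fix A
  show "shift n m j (coord_vector (Fib \<alpha> I)) A =
    (if j \<in># I then coord_vector (Fib \<alpha> (I - {#j#})) else (\<lambda>_. 0)) A"
  proof (cases A)
    case (Fib \<beta> J)
    have "add_mset j J = I \<longleftrightarrow> j \<in># I \<and> J = I - {#j#}" by auto
    then have rhs: "(if j \<in># I then coord_vector (Fib \<alpha> (I - {#j#})) else (\<lambda>_. 0)) A =
        (if \<beta> = \<alpha> \<and> add_mset j J = I then 1 else 0)"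
      using Fib by (auto simp: coord_vector_def)
    have "Fib \<beta> (add_mset j J) \<in> jet_coords n m" if "\<beta> = \<alpha>" "add_mset j J = I"
      unfolding Fib_in_jet_coords that by (rule assms)
    then show ?thesis unfolding rhs Fib by (auto simp: coord_vector_def)
  qed (simp add: coord_vector_def)
qed

lemma iota_D:
  assumes "\<kappa> \<in> CS valid_lists" "(\<alpha>, I) \<in> indices"
  shows "iota \<alpha> I (D j \<kappa>) = D j (iota \<alpha> I \<kappa>) + (if j \<in># I then iota \<alpha> (I - {#j#}) \<kappa> else 0)"
  unfolding iota_def interior_product_D[OF CS_forms'[OF assms(1)]] shift_coord_vector[OF assms(2)]
  by (cases "j \<in># I") (simp_all only: if_True if_False interior_product_zero_vector[OF assms(1)] simp_thms)

text \<open>Since \<open>[\<partial>\<^sup>I\<^sub>\<alpha>, D\<^sub>j]\<close> is \<open>\<partial>\<close> with one \<open>j\<close> removed from \<open>I\<close>, the sum over \<open>I\<close> telescopes: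
  the Euler operator annihilates total derivatives.\<close>

lemma E_D_eq_0:
  assumes \<kappa>: "\<kappa> \<in> CS valid_lists" and j: "j < n"
  shows "E s (D j \<kappa>) = 0"
proof -
  obtain S where S: "supported S \<kappa>" using CS_SP[OF \<kappa>] lin_supported by metis
  have fin: "finite S" and S_sub: "S \<subseteq> multi_indices n" using S by (simp_all add: supported_def)
  define S' where "S' = S \<union> add_mset j ` S"
  have S'_sub: "S' \<subseteq> multi_indices n" using S_sub j by (auto simp: S'_def)
  have zero: "iota \<alpha> I \<kappa> = 0" if "\<alpha> < m" "I \<in> multi_indices n" "I \<notin> S" for \<alpha> I
    using S that unfolding supported_def by blast
  have idx: "(\<alpha>, I) \<in> indices" if "\<alpha> < m" "I \<in> multi_indices n" for \<alpha> I
    using that by simp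
  have "supported S' (D j \<kappa>)"
    unfolding supported_def
  proof (intro conjI allI impI ballI)
    show "finite S'" using fin by (simp add: S'_def)
    show "S' \<subseteq> multi_indices n" by (rule S'_sub)
    fix \<alpha> I assume \<alpha>: "\<alpha> < m" and I: "I \<in> multi_indices n - S'"
    have "iota \<alpha> I \<kappa> = 0" using zero \<alpha> I by (auto simp: S'_def)
    moreover have "iota \<alpha> (I - {#j#}) \<kappa> = 0" if "j \<in># I"
    proof (rule zero[OF \<alpha>])
      have eq: "I = add_mset j (I - {#j#})" using that by simp
      then have "add_mset j (I - {#j#}) \<in> multi_indices n" using I by simp
      then show "I - {#j#} \<in> multi_indices n" by simp
      show "I - {#j#} \<notin> S" using I eq unfolding S'_def by blast
    qed
    ultimately show "iota \<alpha> I (D j \<kappa>) = 0"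
      unfolding iota_D[OF \<kappa> idx[OF \<alpha> DiffD1[OF I]]]
      by (cases "j \<in># I") (simp_all only: D_0 if_True if_False add_0_left)
  qed
  from E_eq_eul[OF D_forms[OF CS_forms'[OF \<kappa>] j] this]
  have E: "E s (D j \<kappa>) = eul s S' (D j \<kappa>)" .
  have "(\<Sum>I\<in>S'. nD I (iota \<alpha> I (D j \<kappa>))) = 0" if \<alpha>: "\<alpha> < m" for \<alpha>
  proof -
    have inner: "nD I (iota \<alpha> I (D j \<kappa>)) =
        - nD (add_mset j I) (iota \<alpha> I \<kappa>) + (if j \<in># I then nD I (iota \<alpha> (I - {#j#}) \<kappa>) else 0)"
      if I: "I \<in> S'" for I
    proof -
      have MI: "I \<in> multi_indices n" using I S'_sub by blast
      have forms: "iota \<alpha> J \<kappa> \<in> forms" for J by (rule iota_forms[OF CS_forms'[OF \<kappa>]])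
      have "nD I (D j (iota \<alpha> I \<kappa>)) = - nD (add_mset j I) (iota \<alpha> I \<kappa>)"
        using nD_add_mset[OF iota_valid[OF \<kappa>] j MI] by (simp only: minus_minus)
      moreover have "(if j \<in># I then iota \<alpha> (I - {#j#}) \<kappa> else 0) \<in> forms"
        by (cases "j \<in># I") (simp_all only: if_True if_False forms zero_forms)
      moreover have "nD I (if j \<in># I then iota \<alpha> (I - {#j#}) \<kappa> else 0) =
          (if j \<in># I then nD I (iota \<alpha> (I - {#j#}) \<kappa>) else 0)"
        by (cases "j \<in># I") (simp_all only: if_True if_False nD_0)
      ultimately show ?thesis
        unfolding iota_D[OF \<kappa> idx[OF \<alpha> MI]] using nD_add[OF MI D_forms[OF forms j]] by (simp only:)
    qed
    have "(\<Sum>I\<in>S'. if j \<in># I then nD I (iota \<alpha> (I - {#j#}) \<kappa>) else 0) =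
        (\<Sum>I\<in>add_mset j ` S. nD I (iota \<alpha> (I - {#j#}) \<kappa>))"
    proof (rule sum.mono_neutral_cong_right)
      show "\<forall>I\<in>S' - add_mset j ` S. (if j \<in># I then nD I (iota \<alpha> (I - {#j#}) \<kappa>) else 0) = 0"
      proof
        fix I assume I: "I \<in> S' - add_mset j ` S"
        show "(if j \<in># I then nD I (iota \<alpha> (I - {#j#}) \<kappa>) else 0) = 0"
        proof (cases "j \<in># I")
          case True
          then have eq: "I = add_mset j (I - {#j#})" by simp
          have "add_mset j (I - {#j#}) \<in> multi_indices n" using I S'_sub eq by auto
          then have "I - {#j#} \<in> multi_indices n" by simp
          moreover have "I - {#j#} \<notin> S" using I eq by blast
          ultimately have "iota \<alpha> (I - {#j#}) \<kappa> = 0" by (rule zero[OF \<alpha>])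
          then show ?thesis using True by (simp only: if_True nD_0)
        qed (simp only: if_False)
      qed
    qed (use fin in \<open>auto simp: S'_def\<close>)
    also have "\<dots> = (\<Sum>I\<in>S. nD (add_mset j I) (iota \<alpha> I \<kappa>))"
      by (subst sum.reindex) (simp_all add: inj_on_def)
    also have "\<dots> = (\<Sum>I\<in>S'. nD (add_mset j I) (iota \<alpha> I \<kappa>))"
    proof (rule sum.mono_neutral_left)
      show "\<forall>I\<in>S' - S. nD (add_mset j I) (iota \<alpha> I \<kappa>) = 0"
      proof
        fix I assume "I \<in> S' - S"
        then have "iota \<alpha> I \<kappa> = 0" using S'_sub by (intro zero[OF \<alpha>]) auto
        then show "nD (add_mset j I) (iota \<alpha> I \<kappa>) = 0" by (simp only: nD_0)
      qed
    qed (use fin in \<open>auto simp: S'_def\<close>)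
    finally have "(\<Sum>I\<in>S'. if j \<in># I then nD I (iota \<alpha> (I - {#j#}) \<kappa>) else 0) =
        (\<Sum>I\<in>S'. nD (add_mset j I) (iota \<alpha> I \<kappa>))" .
    moreover have "(\<Sum>I\<in>S'. nD I (iota \<alpha> I (D j \<kappa>))) =
        (\<Sum>I\<in>S'. - nD (add_mset j I) (iota \<alpha> I \<kappa>) +
          (if j \<in># I then nD I (iota \<alpha> (I - {#j#}) \<kappa>) else 0))"
      by (rule sum.cong[OF refl inner])
    ultimately show ?thesis by (simp only: sum.distrib sum_negf add.left_inverse)
  qed
  then have "(\<Sum>\<alpha><m. theta \<alpha> {#} (\<Sum>I\<in>S'. nD I (iota \<alpha> I (D j \<kappa>)))) = 0"
    by (intro sum.neutral ballI) (simp only: lessThan_iff wedge1_0)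
  then show ?thesis unfolding E eul_def by (simp only: scale_simps)
qed

text \<open>These are the forms modulo which integration by parts is carried out.\<close>

inductive_set divergences :: "form set" where
  divergence_0: "0 \<in> divergences"
| divergence_step: "\<lbrakk>\<omega> \<in> divergences; \<kappa> \<in> CS valid_lists; j < n\<rbrakk> \<Longrightarrow> \<omega> + D j \<kappa> \<in> divergences"

lemma divergences_add: "\<eta> \<in> divergences \<Longrightarrow> \<omega> \<in> divergences \<Longrightarrow> \<omega> + \<eta> \<in> divergences"
proof (induction \<eta> rule: divergences.induct)
  case (divergence_step \<eta> \<kappa> j)
  then show ?case
    using divergences.divergence_step[of "\<omega> + \<eta>" \<kappa> j] by (simp only: add.assoc)
qed (simp only: add_0_right)

lemma divergences_D: "\<kappa> \<in> CS valid_lists \<Longrightarrow> j < n \<Longrightarrow> D j \<kappa> \<in> divergences"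
  using divergence_step[OF divergence_0] by (simp only: add_0_left)

lemma divergences_minus: "\<omega> \<in> divergences \<Longrightarrow> - \<omega> \<in> divergences"
proof (induction rule: divergences.induct)
  case (divergence_step \<omega> \<kappa> j)
  have "- (D j \<kappa>) = D j (scale (\<lambda>_. - 1) \<kappa>)"
    unfolding D_scale_const[OF CS_forms'[OF divergence_step.hyps(2)]] by (simp only: scale_minus_one)
  then show ?case
    using divergences.divergence_step[OF divergence_step.IH const_valid[OF divergence_step.hyps(2)]
        divergence_step.hyps(3), of "- 1"] by (simp only: minus_add_distrib)
qed (simp only: minus_zero divergence_0)

lemma divergences_sum: "(\<And>i. i \<in> A \<Longrightarrow> F i \<in> divergences) \<Longrightarrow> (\<Sum>i\<in>A. F i) \<in> divergences"
proof (induction A rule: infinite_finite_induct)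
  case (insert a A)
  have "F a + (\<Sum>i\<in>A. F i) \<in> divergences" by (rule divergences_add) (use insert in blast)+
  then show ?case using insert.hyps by (simp only: sum.insert not_False_eq_True)
qed (simp_all only: sum.infinite sum.empty divergence_0 not_False_eq_True)

lemma divergences_CS: "\<omega> \<in> divergences \<Longrightarrow> \<omega> \<in> CS valid_lists"
proof (induction rule: divergences.induct)
  case (divergence_step \<omega> \<kappa> j)
  then show ?case using lin_add[OF D_valid[OF divergence_step.hyps(2,3)]] by blast
qed (rule lin_0)

lemma E_divergences: "\<omega> \<in> divergences \<Longrightarrow> E s \<omega> = 0"
proof (induction rule: divergences.induct)
  case divergence_0
  have "E s (0 + 0) = E s 0 + E s 0" by (rule E_add) (rule lin_0)+
  then show ?case by (metis add_cancel_right_left)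
next
  case (divergence_step \<omega> \<kappa> j)
  show ?case
    unfolding E_add[OF CS_SP[OF divergences_CS[OF divergence_step.hyps(1)]]
        CS_SP[OF D_valid[OF divergence_step.hyps(2,3)]]]
      divergence_step.IH E_D_eq_0[OF divergence_step.hyps(2,3)] by (simp only: add_0_left)
qed

lemma diff_minus_telescope: "a - - b = (a + c) - (c - b)" for a b c :: "'x :: ab_group_add"
  by simp

text \<open>Integration by parts moves the derivatives from the contact form to the other factor.\<close>

lemma theta_by_parts:
  assumes "\<kappa> \<in> CS valid_lists" "(\<alpha>, I) \<in> indices"
  shows "theta \<alpha> I \<kappa> - theta \<alpha> {#} (nD I \<kappa>) \<in> divergences"
  using assms
proof (induction I arbitrary: \<kappa>)
  case empty
  have "nD {#} \<kappa> = \<kappa>" by (simp add: nD_def)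
  then show ?case by (simp only: diff_self divergence_0)
next
  case (add j I)
  have I: "(\<alpha>, I) \<in> indices" "I \<in> multi_indices n" and j: "j < n" using add.prems(2) by auto
  note Dk = D_valid[OF add.prems(1) j]
  have "D j (theta \<alpha> I \<kappa>) - (theta \<alpha> I (D j \<kappa>) - theta \<alpha> {#} (nD I (D j \<kappa>))) \<in> divergences"
    using divergences_add[OF divergences_minus[OF add.IH[OF Dk I(1)]]
        divergences_D[OF theta_valid[OF add.prems(1) I(1)] j]]
    by (simp only: diff_conv_add_uminus)
  moreover have "theta \<alpha> (add_mset j I) \<kappa> - theta \<alpha> {#} (nD (add_mset j I) \<kappa>) =
      D j (theta \<alpha> I \<kappa>) - (theta \<alpha> I (D j \<kappa>) - theta \<alpha> {#} (nD I (D j \<kappa>)))"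
    unfolding nD_add_mset[OF add.prems(1) j I(2)] D_theta[OF I(1) CS_forms'[OF add.prems(1)] j]
      wedge1_minus by (rule diff_minus_telescope)
  ultimately show ?case by (simp only:)
qed

text \<open>The operator \<open>\<Sum> \<theta>\<^sup>\<alpha>\<^sub>I \<and> (\<partial>\<^sup>I\<^sub>\<alpha> \<lrcorner> \<cdot>)\<close> counts the contact factors.\<close>

lemma sum_theta_iota:
  assumes "K \<in> valid_lists" "finite S" "snd ` set K \<subseteq> S"
  shows "(\<Sum>A\<in>{..<m} \<times> S. theta (fst A) (snd A) (iota (fst A) (snd A) (contact_mono K))) =
    scale (\<lambda>_. real (length K)) (contact_mono K)"
  using assms(1,3)
proof (induction rule: lists.induct)
  case Nil
  show ?case by (simp only: contact_mono_simps iota_vol wedge1_0 sum.neutral_const list.size of_nat_0 scale_simps)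
next
  case (Cons a K)
  let ?F = "\<lambda>A. theta (fst A) (snd A)" and ?\<mu> = "contact_mono K"
  obtain \<beta> J where a: "a = (\<beta>, J)" by (cases a)
  have "(\<beta>, J) \<in> indices" "K \<in> valid_lists" using Cons.hyps unfolding a by blast+
  then have aS: "(\<beta>, J) \<in> {..<m} \<times> S" using Cons.prems a by simp
  have fin: "finite ({..<m} \<times> S)" using assms(2) by simp
  have IH: "(\<Sum>A\<in>{..<m} \<times> S. ?F A (iota (fst A) (snd A) ?\<mu>)) = scale (\<lambda>_. real (length K)) ?\<mu>"
    by (rule Cons.IH) (use Cons.prems in simp)
  have "?F A (iota (fst A) (snd A) (theta \<beta> J ?\<mu>)) =
      (if A = (\<beta>, J) then theta \<beta> J ?\<mu> else 0) + theta \<beta> J (?F A (iota (fst A) (snd A) ?\<mu>))" for A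
  proof -
    have "?F A (iota (fst A) (snd A) (theta \<beta> J ?\<mu>)) =
        ?F A (if (\<beta>, J) = A then ?\<mu> else 0) + ?F A (- theta \<beta> J (iota (fst A) (snd A) ?\<mu>))"
      unfolding iota_theta diff_conv_add_uminus wedge1_add prod.collapse by (rule refl)
    moreover have "?F A (if (\<beta>, J) = A then ?\<mu> else 0) = (if A = (\<beta>, J) then theta \<beta> J ?\<mu> else 0)"
      unfolding eq_commute[of A]
      by (cases "(\<beta>, J) = A") (auto simp only: if_True if_False wedge1_0 fst_conv snd_conv refl)
    moreover have "?F A (- theta \<beta> J (iota (fst A) (snd A) ?\<mu>)) = theta \<beta> J (?F A (iota (fst A) (snd A) ?\<mu>))"
      using wedge1_anticommute[of "contact_form n \<beta> J" "contact_form n (fst A) (snd A)"]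
      by (simp only: wedge1_minus)
    ultimately show ?thesis by (simp only:)
  qed
  then have "(\<Sum>A\<in>{..<m} \<times> S. ?F A (iota (fst A) (snd A) (theta \<beta> J ?\<mu>))) =
      theta \<beta> J ?\<mu> + theta \<beta> J (scale (\<lambda>_. real (length K)) ?\<mu>)"
    using aS fin by (simp only: sum.distrib sum.delta if_True wedge1_sum[symmetric] IH)
  also have "\<dots> = scale (\<lambda>_. real (length (a # K))) (theta \<beta> J ?\<mu>)"
    by (intro ext) (simp add: wedge1_scale algebra_simps)
  finally show ?case unfolding a contact_mono_simps .
qed

text \<open>For a monomial \<open>\<mu>\<close> the forms \<open>\<mu>\<close> and \<open>E \<mu>\<close> differ by a divergence, up to the factor \<open>s + 1\<close>: count the
  factors of \<open>\<mu>\<close> and integrate by parts. Applying \<open>E\<close> to the difference gives the claim.\<close>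

lemma E_idempotent_constants:
  assumes "\<kappa> \<in> CS (weight_lists (Suc s) w)"
  shows "E (Suc s) (E (Suc s) \<kappa>) = E (Suc s) \<kappa>"
proof -
  let ?E = "E (Suc s)" and ?r = "scale (\<lambda>_. real (Suc s))"
  have E_CS: "?E \<kappa> \<in> CS valid_lists" if "\<kappa> \<in> CS (weight_lists (Suc s) w)" for \<kappa>
    using lin_subset[OF E_lin[OF that ring_constants]] source_lists_weight weight_lists_valid
    by (meson order.trans)
  have mono: "?E (?E (contact_mono K)) = ?E (contact_mono K)" if K: "K \<in> weight_lists (Suc s) w" for K
  proof -
    have v: "K \<in> valid_lists" and len: "length K = Suc s"
      using K weight_lists_valid by (auto simp: weight_lists_def contact_lists_def)
    have \<mu>: "contact_mono K \<in> CS valid_lists" by (rule contact_mono_lin[OF v ring_constants])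
    let ?S = "snd ` set K"
    have S: "supported ?S (contact_mono K)" by (rule supported_contact_mono[OF v])
    have S_sub: "?S \<subseteq> multi_indices n" using v by auto
    have "?E (contact_mono K) = eul (Suc s) ?S (contact_mono K)"
      by (rule E_eq_eul[OF contact_mono_forms[OF v] S])
    then have "?r (?E (contact_mono K)) =
        (\<Sum>\<alpha><m. theta \<alpha> {#} (\<Sum>I\<in>?S. nD I (iota \<alpha> I (contact_mono K))))"
      by (simp add: eul_def)
    also have "\<dots> = (\<Sum>A\<in>{..<m} \<times> ?S. theta (fst A) {#} (nD (snd A) (iota (fst A) (snd A) (contact_mono K))))"
      by (simp only: wedge1_sum sum.cartesian_product' fst_conv snd_conv)
    finally have rE: "?r (?E (contact_mono K)) = \<dots>" .
    have "(\<Sum>A\<in>{..<m} \<times> ?S. theta (fst A) (snd A) (iota (fst A) (snd A) (contact_mono K)) -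
        theta (fst A) {#} (nD (snd A) (iota (fst A) (snd A) (contact_mono K)))) \<in> divergences"
    proof (intro divergences_sum theta_by_parts iota_valid \<mu>)
      fix A assume "A \<in> {..<m} \<times> ?S"
      then show "(fst A, snd A) \<in> indices" using S_sub by auto
    qed
    then have d: "?r (contact_mono K) - ?r (?E (contact_mono K)) \<in> divergences" (is "?d \<in> _")
      using sum_theta_iota[OF v finite_imageI[OF finite_set] order.refl]
      unfolding sum_subtractf rE len by (simp only:)
    have E\<mu>: "?E (contact_mono K) \<in> CS valid_lists"
      by (rule E_CS[OF contact_mono_lin[OF K ring_constants]])
    have "?r (contact_mono K) = ?r (?E (contact_mono K)) + ?d" by simp
    then have "?E (?r (contact_mono K)) = ?E (?r (?E (contact_mono K)) + ?d)"
      by (rule arg_cong)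
    also have "\<dots> = ?E (?r (?E (contact_mono K))) + ?E ?d"
      by (rule E_add[OF CS_SP[OF const_valid[OF E\<mu>]] CS_SP[OF divergences_CS[OF d]]])
    finally have "?r (?E (contact_mono K)) = ?r (?E (?E (contact_mono K)))"
      unfolding E_divergences[OF d] E_scale_const[OF CS_SP[OF \<mu>]] E_scale_const[OF CS_SP[OF E\<mu>]]
      by (simp only: add_0_right)
    then have "scale (\<lambda>_. 1 / real (Suc s)) (?r (?E (contact_mono K))) =
        scale (\<lambda>_. 1 / real (Suc s)) (?r (?E (?E (contact_mono K))))" by (simp only:)
    then show ?thesis by simp
  qed
  have v: "\<eta> \<in> SP valid_lists" if "\<eta> \<in> CS (weight_lists (Suc s) w)" for \<eta>
    by (rule SP_valid[OF that ring_constants weight_lists_valid])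
  show ?thesis
    using assms
  proof (induction rule: lin.induct)
    case lin_0
    have "?E 0 = 0" by (rule E_divergences[OF divergence_0])
    then show ?case by (simp only:)
  next
    case (lin_step \<omega> f x)
    obtain c K where c: "f = (\<lambda>_. c)" and K: "K \<in> weight_lists (Suc s) w" "x = contact_mono K"
      using lin_step.hyps by (auto simp: constants_def)
    have x: "x \<in> CS (weight_lists (Suc s) w)"
      unfolding K(2) by (rule contact_mono_lin[OF K(1) ring_constants])
    have cx: "scale f x \<in> CS (weight_lists (Suc s) w)"
      by (rule lin_scale_const[OF x ring_constants lin_step.hyps(2)])
    note Ex = CS_SP[OF E_CS[OF x]]
    have E1: "?E (\<omega> + scale f x) = ?E \<omega> + scale f (?E x)"
      unfolding E_add[OF v[OF lin_step.hyps(1)] v[OF cx]] by (simp only: c E_scale_const[OF v[OF x]])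
    have "?E (?E \<omega> + scale f (?E x)) = ?E (?E \<omega>) + scale f (?E (?E x))"
      unfolding c
        E_add[OF CS_SP[OF E_CS[OF lin_step.hyps(1)]] CS_SP[OF const_valid[OF E_CS[OF x]]]]
        E_scale_const[OF Ex] by (rule refl)
    then show ?case unfolding E1 lin_step.IH mono[OF K(1), folded K(2)] .
  qed
qed

text \<open>From multiples of monomials to sums: both \<open>E (f g x)\<close> and \<open>f (E (g x))\<close> agree with \<open>f g (E x)\<close> up to lower
  weight.\<close>

lemma E_scale_defect:
  assumes "\<omega> \<in> SP (weight_lists (Suc s) w)" "sf f"
  shows "E (Suc s) (scale f \<omega>) - scale f (E (Suc s) \<omega>) \<in> SP (source_lists (Suc s) (w - 1))"
  using assms(1)
proof (induction rule: lin.induct)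
  case lin_0
  have "E (Suc s) 0 = 0" by (rule E_divergences[OF divergence_0])
  then show ?case by (simp only: scale_simps diff_self lin.lin_0)
next
  case (lin_step \<omega> g x)
  let ?E = "E (Suc s)"
  obtain K where K: "K \<in> weight_lists (Suc s) w" "x = contact_mono K" using lin_step.hyps by blast
  have g: "sf g" using lin_step.hyps by simp
  have fg: "sf (\<lambda>z. f z * g z)" by (rule sf_mult[OF assms(2) g])
  have x: "x \<in> CS (weight_lists (Suc s) w)"
    unfolding K(2) by (rule contact_mono_lin[OF K(1) ring_constants])
  have v: "\<eta> \<in> SP valid_lists" if "\<eta> \<in> SP (weight_lists (Suc s) w)" for \<eta>
    by (rule SP_valid[OF that ring_smooth weight_lists_valid])
  have sc: "scale h \<eta> \<in> SP (weight_lists (Suc s) w)"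
    if "sf h" "\<eta> \<in> SP (weight_lists (Suc s) w)" for h \<eta>
    using lin_scale_const[OF that(2) ring_smooth] that(1) by simp
  note xSP = CS_lin[OF x ring_smooth]
  have "scale f (?E (scale g x) - scale g (?E x)) \<in> SP (source_lists (Suc s) (w - 1))"
    using lin_scale_const[OF E_scale_defect_constants[OF x g] ring_smooth] assms(2) by simp
  from lin_diff[OF E_scale_defect_constants[OF x fg] this ring_smooth]
  have "?E (scale (\<lambda>z. f z * g z) x) - scale f (?E (scale g x)) \<in> SP (source_lists (Suc s) (w - 1))"
    unfolding scale_diff scale_simps by (simp only: diff_diff_eq2 diff_add_cancel)
  from lin_add[OF this lin_step.IH]
  have "?E (scale f \<omega>) - scale f (?E \<omega>) + (?E (scale (\<lambda>z. f z * g z) x) - scale f (?E (scale g x)))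
      \<in> SP (source_lists (Suc s) (w - 1))" .
  moreover have "?E (\<omega> + scale g x) = ?E \<omega> + ?E (scale g x)"
    by (rule E_add[OF v[OF lin_step.hyps(1)] v[OF sc[OF g xSP]]])
  moreover have "?E (scale f (\<omega> + scale g x)) = ?E (scale f \<omega>) + ?E (scale (\<lambda>z. f z * g z) x)"
    unfolding scale_add scale_simps
    by (rule E_add[OF v[OF sc[OF assms(2) lin_step.hyps(1)]] v[OF sc[OF fg xSP]]])
  ultimately show ?case by (simp only: scale_add algebra_simps)
qed

text \<open>The coefficients pass through both applications of \<open>E\<close> up to lower weight, and what remains is
  the idempotence for constant coefficients.\<close>

lemma E_idempotent_defect:
  assumes "\<omega> \<in> SP (weight_lists (Suc s) w)"
  shows "E (Suc s) (E (Suc s) \<omega>) - E (Suc s) \<omega> \<in> SP (source_lists (Suc s) (w - 1))"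
  using assms
proof (induction rule: lin.induct)
  case lin_0
  have "E (Suc s) 0 = 0" by (rule E_divergences[OF divergence_0])
  then show ?case by (simp only: diff_self lin.lin_0)
next
  case (lin_step \<omega> g x)
  let ?E = "E (Suc s)"
  obtain K where K: "K \<in> weight_lists (Suc s) w" "x = contact_mono K" using lin_step.hyps by blast
  have g: "sf g" using lin_step.hyps by simp
  have x: "x \<in> CS (weight_lists (Suc s) w)"
    unfolding K(2) by (rule contact_mono_lin[OF K(1) ring_constants])
  have v: "\<eta> \<in> SP valid_lists" if "\<eta> \<in> SP (weight_lists (Suc s) w)" for \<eta> w
    by (rule SP_valid[OF that ring_smooth weight_lists_valid])
  have weight: "\<eta> \<in> SP (weight_lists (Suc s) w)" if "\<eta> \<in> SP (source_lists (Suc s) w)" for \<eta> w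
    by (rule lin_subset[OF that source_lists_weight])
  have sc: "scale g \<eta> \<in> SP (weight_lists (Suc s) w)" if "\<eta> \<in> SP (weight_lists (Suc s) w)" for \<eta>
    using lin_scale_const[OF that ring_smooth] g by simp
  note xSP = CS_lin[OF x ring_smooth]
  have Ex: "?E x \<in> CS (weight_lists (Suc s) w)"
    by (rule lin_subset[OF E_lin[OF x ring_constants] source_lists_weight])
  note ExSP = CS_lin[OF Ex ring_smooth]
  \<comment> \<open>Both applications of the operator commute with \<open>g\<close> up to lower weight.\<close>
  define \<delta> where "\<delta> = ?E (scale g x) - scale g (?E x)"
  define \<delta>' where "\<delta>' = ?E (scale g (?E x)) - scale g (?E (?E x))"
  have \<delta>: "\<delta> \<in> SP (source_lists (Suc s) (w - 1))"
    unfolding \<delta>_def by (rule E_scale_defect_constants[OF x g])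
  have \<delta>': "\<delta>' \<in> SP (source_lists (Suc s) (w - 1))"
    unfolding \<delta>'_def by (rule E_scale_defect_constants[OF Ex g])
  have E\<delta>: "?E \<delta> \<in> SP (source_lists (Suc s) (w - 1))"
    by (rule E_lin[OF weight[OF \<delta>] ring_smooth])
  have eq: "?E (scale g x) = scale g (?E x) + \<delta>" by (simp only: \<delta>_def add_diff_eq add_diff_cancel_left')
  have "?E (?E (scale g x)) = ?E (scale g (?E x)) + ?E \<delta>"
    unfolding eq by (rule E_add[OF v[OF sc[OF ExSP]] v[OF weight[OF \<delta>]]])
  also have "?E (scale g (?E x)) = scale g (?E x) + \<delta>'"
    unfolding \<delta>'_def E_idempotent_constants[OF x] by (simp only: add_diff_eq add_diff_cancel_left')
  finally have "?E (?E (scale g x)) - ?E (scale g x) = \<delta>' + ?E \<delta> - \<delta>"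
    unfolding eq by (simp only: algebra_simps)
  then have x_part: "?E (?E (scale g x)) - ?E (scale g x) \<in> SP (source_lists (Suc s) (w - 1))"
    using lin_diff[OF lin_add[OF E\<delta> \<delta>'] \<delta> ring_smooth] by (simp only:)
  have E1: "?E (\<omega> + scale g x) = ?E \<omega> + ?E (scale g x)"
    by (rule E_add[OF v[OF lin_step.hyps(1)] v[OF sc[OF xSP]]])
  have E2: "?E (?E \<omega> + ?E (scale g x)) = ?E (?E \<omega>) + ?E (?E (scale g x))"
    using E_lin[OF lin_step.hyps(1) ring_smooth] E_lin[OF sc[OF xSP] ring_smooth]
    by (intro E_add v weight)
  have "?E (?E (\<omega> + scale g x)) - ?E (\<omega> + scale g x) =
      ?E (?E \<omega>) - ?E \<omega> + (?E (?E (scale g x)) - ?E (scale g x))"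
    unfolding E1 E2 by (simp only: algebra_simps)
  then show ?case using lin_add[OF x_part lin_step.IH] by (simp only:)
qed

end

section \<open>Maps induced on a quotient module\<close>

locale quotient_by_submodule =
  fixes R :: "('r, 'c) ring_scheme" and X :: "('r, 'a) module" (structure) and N :: "'a set"
  assumes module: "Module.module R X"
    and N_subset: "N \<subseteq> carrier X"
    and N_zero: "\<zero> \<in> N"
    and N_add: "\<lbrakk>x \<in> N; y \<in> N\<rbrakk> \<Longrightarrow> x \<oplus> y \<in> N"
    and N_minus: "x \<in> N \<Longrightarrow> \<ominus> x \<in> N"
    and N_smult: "\<lbrakk>a \<in> carrier R; x \<in> N\<rbrakk> \<Longrightarrow> a \<odot> x \<in> N"
begin

interpretation X: Module.module R X by (rule module)

lemma abelian_subgroup: "abelian_subgroup N X"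
proof (rule abelian_subgroupI3)
  show "additive_subgroup N X"
    using N_subset N_zero N_add N_minus
    by (intro additive_subgroupI) (unfold_locales, auto simp: a_inv_def)
qed (rule X.abelian_group_axioms)

interpretation N: abelian_subgroup N X by (rule abelian_subgroup)

lemma coset_eqI:
  assumes "x \<in> carrier X" "k \<in> N"
  shows "N +> (k \<oplus> x) = N +> x"
proof -
  have "k \<oplus> x \<in> N +> x" using assms by (auto simp: a_r_coset_def')
  then show ?thesis using N.a_repr_independence' assms by metis
qed

lemma coset_elem:
  assumes "y \<in> N +> x"
  obtains k where "k \<in> N" "y = k \<oplus> x"
  using assms by (auto simp: a_r_coset_def')

lemma coset_self: "x \<in> carrier X \<Longrightarrow> x \<in> N +> x"
  by (rule N.a_rcos_self)

lemma carrier_quotient: "carrier (quotient_module X N) = (\<lambda>x. N +> x) ` carrier X"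
  by (auto simp: quotient_module_def A_RCOSETS_def')

lemma coset_carrier: "x \<in> carrier X \<Longrightarrow> N +> x \<in> carrier (quotient_module X N)"
  unfolding carrier_quotient by blast

lemma zero_quotient: "\<zero>\<^bsub>quotient_module X N\<^esub> = N +> \<zero>"
  by (simp add: quotient_module_def X.a_coset_add_zero[OF N_subset])

lemma add_quotient:
  "x \<in> carrier X \<Longrightarrow> y \<in> carrier X \<Longrightarrow>
   (N +> x) \<oplus>\<^bsub>quotient_module X N\<^esub> (N +> y) = N +> (x \<oplus> y)"
  by (simp add: quotient_module_def N.a_rcos_sum)

text \<open>A map that sends congruent elements to congruent elements acts on cosets by the union of
  the cosets of its values.\<close>

lemma Union_coset:
  assumes "x \<in> carrier X" "\<And>k. k \<in> N \<Longrightarrow> N +> h (k \<oplus> x) = N +> h x"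
  shows "(\<Union>y\<in>N +> x. N +> h y) = N +> h x"
proof -
  have "N +> h y = N +> h x" if "y \<in> N +> x" for y
    using that assms(2) by (elim coset_elem) simp
  then show ?thesis using coset_self[OF assms(1)] by blast
qed

lemma smult_quotient:
  assumes "a \<in> carrier R" "x \<in> carrier X"
  shows "a \<odot>\<^bsub>quotient_module X N\<^esub> (N +> x) = N +> (a \<odot> x)"
proof -
  have "N +> (a \<odot> (k \<oplus> x)) = N +> (a \<odot> x)" if k: "k \<in> N" for k
  proof -
    have "a \<odot> (k \<oplus> x) = a \<odot> k \<oplus> a \<odot> x"
      using assms k N_subset by (intro X.smult_r_distr) auto
    then show ?thesis using coset_eqI[of "a \<odot> x" "a \<odot> k"] N_smult assms k by simp
  qed
  then show ?thesis
    using Union_coset[OF assms(2), of "\<lambda>y. a \<odot> y"] by (simp add: quotient_module_def)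
qed

lemma quotient_is_module: "Module.module R (quotient_module X N)"
proof (rule moduleI)
  show "cring R" by unfold_locales
  show "abelian_group (quotient_module X N)"
  proof (rule abelian_groupI)
    show "\<exists>y\<in>carrier (quotient_module X N). y \<oplus>\<^bsub>quotient_module X N\<^esub> x = \<zero>\<^bsub>quotient_module X N\<^esub>"
      if x: "x \<in> carrier (quotient_module X N)" for x
    proof -
      obtain x' where x': "x' \<in> carrier X" "x = N +> x'" using x by (auto simp: carrier_quotient)
      then have "(N +> (\<ominus> x')) \<oplus>\<^bsub>quotient_module X N\<^esub> x = \<zero>\<^bsub>quotient_module X N\<^esub>"
        by (simp add: add_quotient zero_quotient X.l_neg)
      then show ?thesis using coset_carrier x'(1) X.a_inv_closed by blast
    qed
  qed (auto simp: carrier_quotient add_quotient zero_quotient X.a_ac)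
qed (auto simp: carrier_quotient add_quotient smult_quotient X.smult_l_distr X.smult_r_distr X.smult_assoc1)

text \<open>Each of the last two hypotheses on \<open>h\<close> is an identity modulo \<open>N\<close> and becomes exact on cosets.\<close>

lemma quotient_map_properties:
  assumes h_closed: "\<And>x. x \<in> carrier X \<Longrightarrow> h x \<in> carrier X"
    and h_add: "\<And>x y. x \<in> carrier X \<Longrightarrow> y \<in> carrier X \<Longrightarrow> h (x \<oplus> y) = h x \<oplus> h y"
    and h_N: "\<And>x. x \<in> N \<Longrightarrow> h x \<in> N"
    and h_smult: "\<And>a x. a \<in> carrier R \<Longrightarrow> x \<in> carrier X \<Longrightarrow> \<exists>k\<in>N. h (a \<odot> x) = k \<oplus> a \<odot> h x"
    and h_idem: "\<And>x. x \<in> carrier X \<Longrightarrow> \<exists>k\<in>N. h (h x) = k \<oplus> h x"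
  defines "H \<equiv> \<lambda>Q. \<Union>x\<in>Q. N +> h x"
  shows "\<forall>x\<in>carrier X. H (N +> x) = N +> h x"
    and "module_homomorphism R (quotient_module X N) (quotient_module X N) H"
    and "\<forall>Q\<in>carrier (quotient_module X N). H (H Q) = H Q"
proof -
  have H: "H (N +> x) = N +> h x" if x: "x \<in> carrier X" for x
    unfolding H_def
  proof (rule Union_coset[OF x])
    fix k assume k: "k \<in> N"
    then have "h (k \<oplus> x) = h k \<oplus> h x" using h_add x N_subset by blast
    then show "N +> h (k \<oplus> x) = N +> h x" using coset_eqI[OF h_closed[OF x] h_N[OF k]] by simp
  qed
  then show "\<forall>x\<in>carrier X. H (N +> x) = N +> h x" by blast
  show "module_homomorphism R (quotient_module X N) (quotient_module X N) H"
    unfolding module_homomorphism_def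
  proof (intro conjI ballI quotient_is_module)
    show "H \<in> carrier (quotient_module X N) \<rightarrow> carrier (quotient_module X N)"
      using H h_closed by (auto simp: carrier_quotient)
    fix P assume "P \<in> carrier (quotient_module X N)"
    then obtain x where x: "x \<in> carrier X" "P = N +> x" by (auto simp: carrier_quotient)
    show "H (P \<oplus>\<^bsub>quotient_module X N\<^esub> Q) = H P \<oplus>\<^bsub>quotient_module X N\<^esub> H Q"
      if Q: "Q \<in> carrier (quotient_module X N)" for Q
    proof -
      obtain y where "y \<in> carrier X" "Q = N +> y" using Q by (auto simp: carrier_quotient)
      then show ?thesis using x by (simp add: add_quotient H h_add h_closed)
    qed
    show "H (a \<odot>\<^bsub>quotient_module X N\<^esub> P) = a \<odot>\<^bsub>quotient_module X N\<^esub> H P" if a: "a \<in> carrier R" for a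
    proof -
      obtain k where "k \<in> N" "h (a \<odot> x) = k \<oplus> a \<odot> h x" using h_smult a x by blast
      then have "N +> h (a \<odot> x) = N +> (a \<odot> h x)"
        using coset_eqI[of "a \<odot> h x" k] a x h_closed by simp
      then show ?thesis using x a by (simp add: smult_quotient H h_closed)
    qed
  qed
  show "\<forall>Q\<in>carrier (quotient_module X N). H (H Q) = H Q"
  proof
    fix Q assume "Q \<in> carrier (quotient_module X N)"
    then obtain x where x: "x \<in> carrier X" "Q = N +> x" by (auto simp: carrier_quotient)
    obtain k where "k \<in> N" "h (h x) = k \<oplus> h x" using h_idem x by blast
    then have "N +> h (h x) = N +> h x" using coset_eqI[of "h x" k] h_closed x by simp
    then show "H (H Q) = H Q" using x H h_closed by simp
  qed
qed

end

section \<open>Functions and forms on the infinite jet space\<close>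

lemma smooth_form_uptoD:
  assumes "smooth_form_upto n m k p W \<omega>"
  shows "length vs = p \<Longrightarrow> smooth (jet_coords n m) W (\<lambda>z. \<omega> z vs)"
    and "length vs = p \<Longrightarrow> depends_upto n m k W (\<lambda>z. \<omega> z vs)"
    and "\<lbrakk>z \<in> W; length vs = p; list_all2 (\<lambda>v w. \<forall>A\<in>jet_coords_upto n m k. v A = w A) vs ws\<rbrakk> \<Longrightarrow>
      \<omega> z vs = \<omega> z ws"
    and "\<lbrakk>z \<in> W; length vs = p; i < p\<rbrakk> \<Longrightarrow>
      \<omega> z (vs[i := \<lambda>A. a * v A + b * w A]) = a * \<omega> z (vs[i := v]) + b * \<omega> z (vs[i := w])"
    and "\<lbrakk>z \<in> W; length vs = p; i < j; j < p; vs ! i = vs ! j\<rbrakk> \<Longrightarrow> \<omega> z vs = 0"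
proof -
  note D = assms[unfolded smooth_form_upto_def]
  show "length vs = p \<Longrightarrow> smooth (jet_coords n m) W (\<lambda>z. \<omega> z vs)"
    by (rule D[THEN conjunct1, rule_format, THEN conjunct1])
  show "length vs = p \<Longrightarrow> depends_upto n m k W (\<lambda>z. \<omega> z vs)"
    by (rule D[THEN conjunct1, rule_format, THEN conjunct2])
  show "\<lbrakk>z \<in> W; length vs = p; list_all2 (\<lambda>v w. \<forall>A\<in>jet_coords_upto n m k. v A = w A) vs ws\<rbrakk> \<Longrightarrow>
      \<omega> z vs = \<omega> z ws"
    by (rule D[THEN conjunct2, THEN conjunct1, rule_format, OF _ conjI])
  show "\<lbrakk>z \<in> W; length vs = p; i < p\<rbrakk> \<Longrightarrow>
      \<omega> z (vs[i := \<lambda>A. a * v A + b * w A]) = a * \<omega> z (vs[i := v]) + b * \<omega> z (vs[i := w])"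
    by (rule D[THEN conjunct2, THEN conjunct2, THEN conjunct1, rule_format, OF _ conjI])
  show "\<lbrakk>z \<in> W; length vs = p; i < j; j < p; vs ! i = vs ! j\<rbrakk> \<Longrightarrow> \<omega> z vs = 0"
    by (rule D[THEN conjunct2, THEN conjunct2, THEN conjunct2, rule_format, of z vs i j]) (assumption | intro conjI)+
qed

lemma smooth_form_uptoI:
  assumes "\<And>vs. length vs = p \<Longrightarrow> smooth (jet_coords n m) W (\<lambda>z. \<omega> z vs)"
    and "\<And>vs. length vs = p \<Longrightarrow> depends_upto n m k W (\<lambda>z. \<omega> z vs)"
    and "\<And>z vs ws. \<lbrakk>z \<in> W; length vs = p;
      list_all2 (\<lambda>v w. \<forall>A\<in>jet_coords_upto n m k. v A = w A) vs ws\<rbrakk> \<Longrightarrow> \<omega> z vs = \<omega> z ws"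
    and "\<And>z vs i v w a b. \<lbrakk>z \<in> W; length vs = p; i < p\<rbrakk> \<Longrightarrow>
      \<omega> z (vs[i := \<lambda>A. a * v A + b * w A]) = a * \<omega> z (vs[i := v]) + b * \<omega> z (vs[i := w])"
    and "\<And>z vs i j. \<lbrakk>z \<in> W; length vs = p; i < j; j < p; vs ! i = vs ! j\<rbrakk> \<Longrightarrow> \<omega> z vs = 0"
  shows "smooth_form_upto n m k p W \<omega>"
  unfolding smooth_form_upto_def
  apply (intro conjI allI impI ballI)
      apply (rule assms(1), assumption)
     apply (rule assms(2), assumption)
    apply (elim conjE, rule assms(3), assumption+)
   apply (elim conjE, rule assms(4), assumption+)
  apply (elim conjE, rule assms(5), assumption+)
  done

lemma smooth_form_upto_mono:
  assumes \<omega>: "smooth_form_upto n m k p W \<omega>" and k: "k \<le> k'"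
  shows "smooth_form_upto n m k' p W \<omega>"
proof -
  have sub: "jet_coords_upto n m k \<subseteq> jet_coords_upto n m k'"
    using k by (auto simp: jet_coords_upto_def)
  have mono: "list_all2 (\<lambda>v w. \<forall>A\<in>jet_coords_upto n m k. v A = w A) vs ws"
    if "list_all2 (\<lambda>v w. \<forall>A\<in>jet_coords_upto n m k'. v A = w A) vs ws" for vs ws :: "point list"
    using that by (rule list_all2_mono) (use sub in blast)
  note D = smooth_form_uptoD[OF \<omega>]
  show ?thesis
    by (rule smooth_form_uptoI)
      (rule D(1) depends_upto_mono[OF D(2) k order.refl] D(3)[OF _ _ mono] D(4) D(5); assumption)+
qed

lemma smooth_form_upto_add:
  assumes W: "openin (powertop_real (jet_coords n m)) W"
    and \<omega>: "smooth_form_upto n m k p W \<omega>" and \<eta>: "smooth_form_upto n m k p W \<eta>"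
  shows "smooth_form_upto n m k p W (\<lambda>z vs. \<omega> z vs + \<eta> z vs)"
proof -
  note D = smooth_form_uptoD[OF \<omega>] and D' = smooth_form_uptoD[OF \<eta>]
  show ?thesis
  proof (rule smooth_form_uptoI)
    fix vs :: "point list" assume p: "length vs = p"
    show "smooth (jet_coords n m) W (\<lambda>z. \<omega> z vs + \<eta> z vs)"
      by (rule smooth_add[OF W D(1)[OF p] D'(1)[OF p]])
    show "depends_upto n m k W (\<lambda>z. \<omega> z vs + \<eta> z vs)"
      using depends_upto_combine[OF D(2)[OF p] D'(2)[OF p], of "(+)"] by simp
  next
    fix z and vs ws :: "point list"
    assume "z \<in> W" "length vs = p" "list_all2 (\<lambda>v w. \<forall>A\<in>jet_coords_upto n m k. v A = w A) vs ws"
    from D(3)[OF this] D'(3)[OF this] show "\<omega> z vs + \<eta> z vs = \<omega> z ws + \<eta> z ws" by simp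
  next
    fix z and vs :: "point list" and i :: nat and v w :: point and a b :: real
    assume "z \<in> W" "length vs = p" "i < p"
    note D(4)[OF this, of a v b w] D'(4)[OF this, of a v b w]
    then show "\<omega> z (vs[i := \<lambda>A. a * v A + b * w A]) + \<eta> z (vs[i := \<lambda>A. a * v A + b * w A]) =
        a * (\<omega> z (vs[i := v]) + \<eta> z (vs[i := v])) + b * (\<omega> z (vs[i := w]) + \<eta> z (vs[i := w]))"
      by (simp add: algebra_simps)
  next
    fix z and vs :: "point list" and i j :: nat
    assume "z \<in> W" "length vs = p" "i < j" "j < p" "vs ! i = vs ! j"
    from D(5)[OF this] D'(5)[OF this] show "\<omega> z vs + \<eta> z vs = 0" by simp
  qed
qed

lemma smooth_form_upto_scale:
  assumes W: "openin (powertop_real (jet_coords n m)) W"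
    and \<omega>: "smooth_form_upto n m k p W \<omega>"
    and f: "smooth (jet_coords n m) W f" "depends_upto n m k W f"
  shows "smooth_form_upto n m k p W (\<lambda>z vs. f z * \<omega> z vs)"
proof -
  note D = smooth_form_uptoD[OF \<omega>]
  show ?thesis
  proof (rule smooth_form_uptoI)
    fix vs :: "point list" assume p: "length vs = p"
    show "smooth (jet_coords n m) W (\<lambda>z. f z * \<omega> z vs)"
      by (rule smooth_mult[OF W f(1) D(1)[OF p]])
    show "depends_upto n m k W (\<lambda>z. f z * \<omega> z vs)"
      using depends_upto_combine[OF f(2) D(2)[OF p], of "(*)"] by simp
  next
    fix z and vs ws :: "point list"
    assume "z \<in> W" "length vs = p" "list_all2 (\<lambda>v w. \<forall>A\<in>jet_coords_upto n m k. v A = w A) vs ws"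
    from D(3)[OF this] show "f z * \<omega> z vs = f z * \<omega> z ws" by simp
  next
    fix z and vs :: "point list" and i :: nat and v w :: point and a b :: real
    assume "z \<in> W" "length vs = p" "i < p"
    from D(4)[OF this, of a v b w] show "f z * \<omega> z (vs[i := \<lambda>A. a * v A + b * w A]) =
        a * (f z * \<omega> z (vs[i := v])) + b * (f z * \<omega> z (vs[i := w]))"
      by (simp add: algebra_simps)
  next
    fix z and vs :: "point list" and i j :: nat
    assume "z \<in> W" "length vs = p" "i < j" "j < p" "vs ! i = vs ! j"
    from D(5)[OF this] show "f z * \<omega> z vs = 0" by simp
  qed
qed

lemma adapted_chartsD:
  assumes "((U, \<xi>), (V, \<psi>)) \<in> adapted_charts B"
  shows "(U, \<xi>) \<in> base_charts B"
    and "openin (powertop_real (total_coords B)) (\<psi> ` V)"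
    and "inj_on \<xi> U"
    and "e \<in> V \<Longrightarrow> proj B e \<in> U"
    and "e \<in> V \<Longrightarrow> restrict (\<psi> e) (base_coords (bdim B)) = \<xi> (proj B e)"
proof -
  show base: "(U, \<xi>) \<in> base_charts B"
    using assms by (simp add: adapted_charts_def)
  show "openin (powertop_real (total_coords B)) (\<psi> ` V)"
    using assms by (simp add: adapted_charts_def charts_def is_chart_def)
  have "openin (mtop (base_space B)) U"
    and "homeomorphic_map (subtopology (mtop (base_space B)) U)
      (subtopology (powertop_real (base_coords (bdim B))) (\<xi> ` U)) \<xi>"
    using base by (simp_all add: charts_def is_chart_def)
  then show "inj_on \<xi> U"
    using homeomorphic_imp_injective_map openin_subset by (fastforce simp: inf.absorb2)
  show "e \<in> V \<Longrightarrow> proj B e \<in> U"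
    and "e \<in> V \<Longrightarrow> restrict (\<psi> e) (base_coords (bdim B)) = \<xi> (proj B e)"
    using assms by (auto simp: adapted_charts_def)
qed

lemma base_coords_total: "base_coords (bdim B) \<subseteq> total_coords B"
  by (auto simp: jet_coords_upto_def jet_coords_def base_coords_def)

lemma total_coords_inf: "total_coords B \<subseteq> inf_coords B"
  by (auto simp: jet_coords_upto_def)

lemma openin_jet_domain:
  assumes "c \<in> adapted_charts B"
  shows "openin (powertop_real (inf_coords B)) (jet_domain B c)"
proof -
  obtain U \<xi> V \<psi> where c: "c = ((U, \<xi>), (V, \<psi>))" by (metis surj_pair)
  have "continuous_map (powertop_real (inf_coords B)) (powertop_real (total_coords B))
      (\<lambda>z. restrict z (total_coords B))"
    using total_coords_inf
    by (auto simp: continuous_map_componentwise intro: continuous_map_product_projection)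
  from openin_continuous_map_preimage[OF this adapted_chartsD(2)[OF assms[unfolded c]]]
  show ?thesis by (simp add: c jet_domain_def)
qed

lemma restrict_base_in_chart:
  assumes "((U, \<xi>), (V, \<psi>)) \<in> adapted_charts B" "z \<in> jet_domain B ((U, \<xi>), (V, \<psi>))"
  shows "restrict z (base_coords (bdim B)) \<in> \<xi> ` U"
proof -
  obtain e where e: "e \<in> V" "restrict z (total_coords B) = \<psi> e"
    using assms(2) by (auto simp: jet_domain_def)
  have "restrict z (base_coords (bdim B)) = restrict (restrict z (total_coords B)) (base_coords (bdim B))"
    by (simp add: Int_absorb1 base_coords_total)
  also have "\<dots> = \<xi> (proj B e)" using adapted_chartsD(5)[OF assms(1) e(1)] e(2) by simp
  finally show ?thesis using adapted_chartsD(4)[OF assms(1) e(1)] by simp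
qed

text \<open>The coordinates of order 0 of a jet \<open>j\<^sub>p\<sigma>\<close> are the coordinates of the point \<open>\<sigma> p\<close>, which lies in the chart
  domain; those of higher order are arbitrary.\<close>

lemma jet_chart_in_domain:
  assumes c: "c \<in> adapted_charts B" and J: "J \<in> jet_space_over B V'" and V': "V' \<subseteq> fst (snd c)"
  shows "jet_chart B c J \<in> jet_domain B c"
proof -
  obtain U \<xi> V \<psi> where c_eq: "c = ((U, \<xi>), (V, \<psi>))" by (metis surj_pair)
  note ad = adapted_chartsD[OF c[unfolded c_eq]]
  obtain p j where J_eq: "J = (p, j)" by (cases J)
  have js: "(p, j) \<in> jet_space B" and over: "\<And>\<sigma>. \<sigma> \<in> j 0 \<Longrightarrow> \<sigma> p \<in> V'"
    using J J_eq by (auto simp: jet_space_over_def)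
  obtain \<tau> where \<tau>: "\<tau> \<in> local_sections B p" "j 0 = jet B 0 p \<tau>"
    using js unfolding jet_space_def by blast
  define \<sigma> where "\<sigma> = (SOME \<sigma>. \<sigma> \<in> j 0)"
  have "\<tau> \<in> j 0" using \<tau> by (simp add: jet_def)
  then have \<sigma>: "\<sigma> \<in> j 0" unfolding \<sigma>_def by (rule someI[of "\<lambda>\<sigma>. \<sigma> \<in> j 0"])
  then have "\<sigma> \<in> local_sections B p" using \<tau>(2) by (simp add: jet_def)
  then have pr: "proj B (\<sigma> p) = p" by (auto simp: local_sections_def)
  have \<sigma>V: "\<sigma> p \<in> V" using over[OF \<sigma>] V' c_eq by auto
  have pU: "p \<in> U" using ad(4)[OF \<sigma>V] pr by simp
  have inv: "inv_into U \<xi> (\<xi> p) = p" by (rule inv_into_f_f[OF ad(3) pU])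
  have "jet_chart B c J A = \<psi> (\<sigma> p) A" if A: "A \<in> total_coords B" for A
  proof -
    have A': "A \<in> inf_coords B" "coord_order A = 0" using A by (auto simp: jet_coords_upto_def)
    have "jet_chart B c J A = section_coords B c p \<sigma> A"
      using A' by (simp add: jet_chart_def J_eq \<sigma>_def)
    also have "\<dots> = \<psi> (\<sigma> p) A"
    proof (cases A)
      case (Base i)
      then have "A \<in> base_coords (bdim B)" using A' by (auto simp: jet_coords_def)
      then have "\<psi> (\<sigma> p) A = \<xi> p A" using ad(5)[OF \<sigma>V] pr by (metis restrict_apply')
      then show ?thesis using Base A' by (simp add: section_coords_def c_eq)
    next
      case (Fib \<alpha> I)
      then have "I = {#}" using A' by simp
      then show ?thesis using Fib A' by (simp add: section_coords_def c_eq inv)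
    qed
    finally show ?thesis .
  qed
  moreover have "\<psi> (\<sigma> p) \<in> extensional (total_coords B)"
    using openin_subset[OF ad(2)] \<sigma>V by (auto simp: PiE_iff)
  ultimately have "restrict (jet_chart B c J) (total_coords B) = \<psi> (\<sigma> p)"
    by (auto simp: fun_eq_iff extensional_def restrict_def)
  moreover have "jet_chart B c J \<in> topspace (powertop_real (inf_coords B))"
    by (auto simp: jet_chart_def J_eq)
  ultimately show ?thesis using \<sigma>V by (auto simp: jet_domain_def c_eq)
qed

lemma jet_function_transition:
  assumes "f \<in> jet_functions B" "c \<in> adapted_charts B" "c' \<in> adapted_charts B" "J \<in> jet_overlap B c c'"
  shows "f c' (jet_transition B c c' (jet_chart B c J)) = f c (jet_chart B c J)"
proof -
  define J' where "J' = inv_into (jet_overlap B c c') (jet_chart B c) (jet_chart B c J)"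
  have J': "J' \<in> jet_overlap B c c'" "jet_chart B c J' = jet_chart B c J"
    using assms(4) unfolding J'_def by (simp_all add: inv_into_into f_inv_into_f)
  have "f c (jet_chart B c J') = f c' (jet_chart B c' J')"
    using assms(1-3) J'(1) by (simp add: jet_functions_def)
  then show ?thesis using J'(2) by (simp add: jet_transition_def J'_def[symmetric])
qed

lemma jet_functionsD:
  assumes "f \<in> jet_functions B"
  shows "c \<notin> adapted_charts B \<or> z \<notin> jet_domain B c \<Longrightarrow> f c z = 0"
    and "\<lbrakk>c \<in> adapted_charts B; c' \<in> adapted_charts B; J \<in> jet_overlap B c c'\<rbrakk> \<Longrightarrow>
      f c (jet_chart B c J) = f c' (jet_chart B c' J)"
  using assms unfolding jet_functions_def by blast+

lemma jet_functions_order: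
  assumes "f \<in> jet_functions B"
  obtains k where "\<And>c. c \<in> adapted_charts B \<Longrightarrow> smooth (inf_coords B) (jet_domain B c) (f c)"
    "\<And>c. c \<in> adapted_charts B \<Longrightarrow> depends_upto (bdim B) (fdim B) k (jet_domain B c) (f c)"
  using assms unfolding jet_functions_def by blast

lemma jet_functionsI:
  assumes "\<And>c z. c \<notin> adapted_charts B \<or> z \<notin> jet_domain B c \<Longrightarrow> f c z = 0"
    and "\<And>c. c \<in> adapted_charts B \<Longrightarrow> smooth (inf_coords B) (jet_domain B c) (f c)"
    and "\<And>c. c \<in> adapted_charts B \<Longrightarrow> depends_upto (bdim B) (fdim B) k (jet_domain B c) (f c)"
    and "\<And>c c' J. \<lbrakk>c \<in> adapted_charts B; c' \<in> adapted_charts B; J \<in> jet_overlap B c c'\<rbrakk> \<Longrightarrow>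
      f c (jet_chart B c J) = f c' (jet_chart B c' J)"
  shows "f \<in> jet_functions B"
  unfolding jet_functions_def using assms by blast

lemma jet_functions_combine:
  assumes f: "f \<in> jet_functions B" and g: "g \<in> jet_functions B" and "h 0 0 = 0"
    and smooth: "\<And>c. c \<in> adapted_charts B \<Longrightarrow> smooth (inf_coords B) (jet_domain B c) (f c) \<Longrightarrow>
      smooth (inf_coords B) (jet_domain B c) (g c) \<Longrightarrow>
      smooth (inf_coords B) (jet_domain B c) (\<lambda>z. h (f c z) (g c z))"
  shows "(\<lambda>c z. h (f c z) (g c z)) \<in> jet_functions B"
proof -
  obtain k where k: "\<And>c. c \<in> adapted_charts B \<Longrightarrow> smooth (inf_coords B) (jet_domain B c) (f c)"
    "\<And>c. c \<in> adapted_charts B \<Longrightarrow> depends_upto (bdim B) (fdim B) k (jet_domain B c) (f c)"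
    using jet_functions_order[OF f] by blast
  obtain k' where k': "\<And>c. c \<in> adapted_charts B \<Longrightarrow> smooth (inf_coords B) (jet_domain B c) (g c)"
    "\<And>c. c \<in> adapted_charts B \<Longrightarrow> depends_upto (bdim B) (fdim B) k' (jet_domain B c) (g c)"
    using jet_functions_order[OF g] by blast
  show ?thesis
  proof (rule jet_functionsI)
    fix c assume c: "c \<in> adapted_charts B"
    show "smooth (inf_coords B) (jet_domain B c) (\<lambda>z. h (f c z) (g c z))"
      by (rule smooth[OF c k(1)[OF c] k'(1)[OF c]])
    show "depends_upto (bdim B) (fdim B) (max k k') (jet_domain B c) (\<lambda>z. h (f c z) (g c z))"
      by (rule depends_upto_combine[OF k(2)[OF c] k'(2)[OF c]])
  qed (use jet_functionsD[OF f] jet_functionsD[OF g] assms(3) in simp_all)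
qed

lemma jet_functions_add:
  "f \<in> jet_functions B \<Longrightarrow> g \<in> jet_functions B \<Longrightarrow> (\<lambda>c z. f c z + g c z) \<in> jet_functions B"
  by (rule jet_functions_combine) (simp_all add: smooth_add[OF openin_jet_domain])

lemma jet_functions_mult:
  "f \<in> jet_functions B \<Longrightarrow> g \<in> jet_functions B \<Longrightarrow> (\<lambda>c z. f c z * g c z) \<in> jet_functions B"
  by (rule jet_functions_combine) (simp_all add: smooth_mult[OF openin_jet_domain])

text \<open>A constant function has to vanish off the chart domains to be a family of local expressions. It
  is compatible on overlaps because chart images of overlaps lie in the chart domains.\<close>

definition const_jfun :: "('m, 'e, 'f) fbundle \<Rightarrow> real \<Rightarrow> ('m, 'e) jfun" where
  "const_jfun B a = (\<lambda>c z. if c \<in> adapted_charts B \<and> z \<in> jet_domain B c then a else 0)"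

lemma const_jfun_jet_functions: "const_jfun B a \<in> jet_functions B"
proof (rule jet_functionsI)
  fix c assume c: "c \<in> adapted_charts B"
  show "smooth (inf_coords B) (jet_domain B c) (const_jfun B a c)"
  proof (rule smooth_cong[OF openin_jet_domain[OF c]])
    show "smooth (inf_coords B) (jet_domain B c) (\<lambda>_. a)"
      by (simp add: smooth_iff smooth_upto_const)
  qed (simp add: const_jfun_def c)
  show "depends_upto (bdim B) (fdim B) 0 (jet_domain B c) (const_jfun B a c)"
    by (simp add: depends_upto_def const_jfun_def)
  fix c' J assume c': "c' \<in> adapted_charts B" and J: "J \<in> jet_overlap B c c'"
  have "jet_chart B c J \<in> jet_domain B c" "jet_chart B c' J \<in> jet_domain B c'"
    using jet_chart_in_domain[OF c J[unfolded jet_overlap_def]]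
      jet_chart_in_domain[OF c' J[unfolded jet_overlap_def]] by simp_all
  then show "const_jfun B a c (jet_chart B c J) = const_jfun B a c' (jet_chart B c' J)"
    using c c' by (simp add: const_jfun_def)
qed (auto simp: const_jfun_def)

lemma const_jfun_mult: "f \<in> jet_functions B \<Longrightarrow> const_jfun B a c z * f c z = a * f c z"
  using jet_functionsD(1)[of f B c z] by (auto simp: const_jfun_def)

lemma cring_jet_ring: "cring (jet_ring B)"
proof (rule cringI)
  show "abelian_group (jet_ring B)"
  proof (rule abelian_groupI)
    fix f assume "f \<in> carrier (jet_ring B)"
    then have f: "f \<in> jet_functions B" by (simp add: jet_ring_def)
    have "(\<lambda>c z. const_jfun B (- 1) c z * f c z) \<in> jet_functions B"
      by (rule jet_functions_mult[OF const_jfun_jet_functions f])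
    moreover have "(\<lambda>c z. const_jfun B (- 1) c z * f c z + f c z) = (\<lambda>c z. 0)"
      by (intro ext) (simp add: const_jfun_mult[OF f])
    ultimately show "\<exists>g\<in>carrier (jet_ring B). g \<oplus>\<^bsub>jet_ring B\<^esub> f = \<zero>\<^bsub>jet_ring B\<^esub>"
      by (intro bexI[of _ "\<lambda>c z. const_jfun B (- 1) c z * f c z"]) (simp_all add: jet_ring_def)
  next
    have "const_jfun B 0 = (\<lambda>c z. 0)" by (auto simp: const_jfun_def fun_eq_iff)
    then show "\<zero>\<^bsub>jet_ring B\<^esub> \<in> carrier (jet_ring B)"
      using const_jfun_jet_functions[of B 0] by (simp add: jet_ring_def)
  qed (auto simp: jet_ring_def jet_functions_add add_ac)
  show "Group.comm_monoid (jet_ring B)"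
  proof (rule comm_monoidI)
    show "\<one>\<^bsub>jet_ring B\<^esub> \<in> carrier (jet_ring B)"
      using const_jfun_jet_functions[of B 1] by (simp add: jet_ring_def const_jfun_def)
    fix f assume "f \<in> carrier (jet_ring B)"
    then show "\<one>\<^bsub>jet_ring B\<^esub> \<otimes>\<^bsub>jet_ring B\<^esub> f = f"
      using jet_functionsD(1)[of f B] by (auto simp: jet_ring_def fun_eq_iff)
  qed (auto simp: jet_ring_def jet_functions_mult mult_ac)
qed (auto simp: jet_ring_def algebra_simps)

lemma jet_formsD:
  assumes "\<omega> \<in> jet_forms B p"
  shows "c \<notin> adapted_charts B \<or> z \<notin> jet_domain B c \<or> length vs \<noteq> p \<Longrightarrow> \<omega> c z vs = 0"
    and "\<lbrakk>c \<in> adapted_charts B; c' \<in> adapted_charts B; J \<in> jet_overlap B c c'\<rbrakk> \<Longrightarrow>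
      \<omega> c (jet_chart B c J) vs =
      pullback (inf_coords B) (jet_transition B c c') (\<omega> c') (jet_chart B c J) vs"
  using assms unfolding jet_forms_def by blast+

lemma jet_forms_order:
  assumes "\<omega> \<in> jet_forms B p"
  obtains k where
    "\<And>c. c \<in> adapted_charts B \<Longrightarrow> smooth_form_upto (bdim B) (fdim B) k p (jet_domain B c) (\<omega> c)"
  using assms unfolding jet_forms_def by blast

lemma jet_formsI:
  assumes "\<And>c z vs. c \<notin> adapted_charts B \<or> z \<notin> jet_domain B c \<or> length vs \<noteq> p \<Longrightarrow> \<omega> c z vs = 0"
    and "\<And>c. c \<in> adapted_charts B \<Longrightarrow> smooth_form_upto (bdim B) (fdim B) k p (jet_domain B c) (\<omega> c)"
    and "\<And>c c' J vs. \<lbrakk>c \<in> adapted_charts B; c' \<in> adapted_charts B; J \<in> jet_overlap B c c'\<rbrakk> \<Longrightarrow>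
      \<omega> c (jet_chart B c J) vs =
      pullback (inf_coords B) (jet_transition B c c') (\<omega> c') (jet_chart B c J) vs"
  shows "\<omega> \<in> jet_forms B p"
  unfolding jet_forms_def using assms by blast

lemma jet_forms_add:
  assumes \<omega>: "\<omega> \<in> jet_forms B p" and \<eta>: "\<eta> \<in> jet_forms B p"
  shows "(\<lambda>c z vs. \<omega> c z vs + \<eta> c z vs) \<in> jet_forms B p"
proof -
  obtain k where k:
    "\<And>c. c \<in> adapted_charts B \<Longrightarrow> smooth_form_upto (bdim B) (fdim B) k p (jet_domain B c) (\<omega> c)"
    using jet_forms_order[OF \<omega>] by blast
  obtain k' where k':
    "\<And>c. c \<in> adapted_charts B \<Longrightarrow> smooth_form_upto (bdim B) (fdim B) k' p (jet_domain B c) (\<eta> c)"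
    using jet_forms_order[OF \<eta>] by blast
  show ?thesis
  proof (rule jet_formsI)
    fix c assume c: "c \<in> adapted_charts B"
    show "smooth_form_upto (bdim B) (fdim B) (max k k') p (jet_domain B c) (\<lambda>z vs. \<omega> c z vs + \<eta> c z vs)"
      by (intro smooth_form_upto_add[OF openin_jet_domain[OF c]]
          smooth_form_upto_mono[OF k[OF c]] smooth_form_upto_mono[OF k'[OF c]]) simp_all
  next
    fix c c' J vs assume J: "c \<in> adapted_charts B" "c' \<in> adapted_charts B" "J \<in> jet_overlap B c c'"
    show "\<omega> c (jet_chart B c J) vs + \<eta> c (jet_chart B c J) vs =
        pullback (inf_coords B) (jet_transition B c c') (\<lambda>z vs. \<omega> c' z vs + \<eta> c' z vs) (jet_chart B c J) vs"
      unfolding jet_formsD(2)[OF \<omega> J] jet_formsD(2)[OF \<eta> J] pullback_def ..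
  qed (use jet_formsD(1)[OF \<omega>] jet_formsD(1)[OF \<eta>] in simp)
qed

lemma jet_forms_smult:
  assumes f: "f \<in> jet_functions B" and \<omega>: "\<omega> \<in> jet_forms B p"
  shows "(\<lambda>c z vs. f c z * \<omega> c z vs) \<in> jet_forms B p"
proof -
  obtain k where k:
    "\<And>c. c \<in> adapted_charts B \<Longrightarrow> smooth_form_upto (bdim B) (fdim B) k p (jet_domain B c) (\<omega> c)"
    using jet_forms_order[OF \<omega>] by blast
  obtain k' where k': "\<And>c. c \<in> adapted_charts B \<Longrightarrow> smooth (inf_coords B) (jet_domain B c) (f c)"
    "\<And>c. c \<in> adapted_charts B \<Longrightarrow> depends_upto (bdim B) (fdim B) k' (jet_domain B c) (f c)"
    using jet_functions_order[OF f] by blast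
  show ?thesis
  proof (rule jet_formsI)
    fix c assume c: "c \<in> adapted_charts B"
    show "smooth_form_upto (bdim B) (fdim B) (max k k') p (jet_domain B c) (\<lambda>z vs. f c z * \<omega> c z vs)"
      by (intro smooth_form_upto_scale[OF openin_jet_domain[OF c] _ k'(1)[OF c]]
          smooth_form_upto_mono[OF k[OF c]] depends_upto_mono[OF k'(2)[OF c]]) simp_all
  next
    fix c c' J vs assume J: "c \<in> adapted_charts B" "c' \<in> adapted_charts B" "J \<in> jet_overlap B c c'"
    show "f c (jet_chart B c J) * \<omega> c (jet_chart B c J) vs =
        pullback (inf_coords B) (jet_transition B c c') (\<lambda>z vs. f c' z * \<omega> c' z vs) (jet_chart B c J) vs"
      unfolding jet_formsD(2)[OF \<omega> J] pullback_def jet_function_transition[OF f J] ..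
  qed (use jet_formsD(1)[OF \<omega>] in simp)
qed

lemma zero_form_jet_forms: "zero_form \<in> jet_forms B p"
proof (rule jet_formsI)
  fix c assume "c \<in> adapted_charts B"
  have "smooth (inf_coords B) (jet_domain B c) (\<lambda>_. 0)"
    by (simp add: smooth_iff smooth_upto_const)
  then show "smooth_form_upto (bdim B) (fdim B) 0 p (jet_domain B c) (zero_form c)"
    by (simp add: smooth_form_upto_def zero_form_def depends_upto_def)
qed (simp_all add: zero_form_def pullback_def)

section \<open>Local spans in adapted charts\<close>

context jet_open
begin

lemma vol_of_length: "length vs \<noteq> length is \<Longrightarrow> vol_of is z vs = 0"
  and coord_volume_eq_vol_of: "z \<in> W \<Longrightarrow>
    foldr (\<lambda>i. wedge1 (\<lambda>z v. v (Base i))) is (\<lambda>z vs. if vs = [] then 1 else 0) x vs = vol_of is z vs"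
proof (induction "is" arbitrary: vs)
  case (Cons i "is")
  case 1
  have "vol_of is z (remove_nth l vs) = 0" if "l < length vs" for l
    using 1 that length_remove_nth[OF that] by (intro Cons.IH(1)) auto
  then show ?case by (simp add: vol_of_def[of "i # is"] vol_of_def[of "is", symmetric] wedge1_def)
next
  case (Cons i "is")
  case 2
  then show ?case
    using Cons.IH(2)
    by (simp add: vol_of_def[of "i # is"] vol_of_def[of "is", symmetric] wedge1_def)
qed (auto simp: vol_of_def)

lemma contact_mono_length: "length vs \<noteq> n + length K \<Longrightarrow> contact_mono K z vs = 0"
proof (induction K arbitrary: vs)
  case Nil
  then show ?case by (simp add: vol_of_length)
next
  case (Cons a K)
  obtain \<alpha> I where a: "a = (\<alpha>, I)" by (cases a)
  have "contact_mono K z (remove_nth l vs) = 0" if "l < length vs" for l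
    using Cons.prems that length_remove_nth[OF that] by (intro Cons.IH) auto
  then show ?case unfolding a contact_mono_simps wedge1_def by simp
qed

lemma SP_length:
  assumes "\<omega> \<in> SP Q" "Q \<subseteq> contact_lists n m s" "length vs \<noteq> n + s"
  shows "\<omega> z vs = 0"
  using assms(1)
proof (induction rule: lin.induct)
  case (lin_step \<omega> f x)
  then obtain K where K: "K \<in> Q" "x = contact_mono K" by blast
  then have "length K = s" using assms(2) by (auto simp: contact_lists_def)
  then show ?case using lin_step.IH contact_mono_length[of vs K z] assms(3) K by simp
qed simp

text \<open>Terms with the same monomial are collected by adding their coefficients.\<close>

lemma SP_elim:
  assumes "\<omega> \<in> SP Q"
  obtains \<K> g where "finite \<K>" "\<K> \<subseteq> Q" "\<And>K. K \<in> \<K> \<Longrightarrow> sf (g K)"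
    "\<omega> = (\<Sum>K\<in>\<K>. scale (g K) (contact_mono K))"
proof -
  have "\<exists>\<K> g. finite \<K> \<and> \<K> \<subseteq> Q \<and> (\<forall>K\<in>\<K>. sf (g K)) \<and> \<omega> = (\<Sum>K\<in>\<K>. scale (g K) (contact_mono K))"
    using assms
  proof (induction rule: lin.induct)
    case lin_0
    show ?case by (rule exI[of _ "{}"]) simp
  next
    case (lin_step \<omega> f x)
    then obtain \<K> g where g: "finite \<K>" "\<K> \<subseteq> Q" "\<forall>K\<in>\<K>. sf (g K)"
      and \<omega>: "\<omega> = (\<Sum>K\<in>\<K>. scale (g K) (contact_mono K))" by blast
    obtain K where K: "K \<in> Q" "x = contact_mono K" using lin_step.hyps by blast
    have f: "sf f" using lin_step.hyps by simp
    define g' where "g' = g(K := \<lambda>z. (if K \<in> \<K> then g K z else 0) + f z)"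
    have "\<omega> + scale f x = (\<Sum>L\<in>insert K \<K>. scale (g' L) (contact_mono L))"
    proof (intro ext)
      fix z vs
      have rest: "(\<Sum>L\<in>\<K> - {K}. g' L z * contact_mono L z vs) = (\<Sum>L\<in>\<K> - {K}. g L z * contact_mono L z vs)"
        by (intro sum.cong refl) (simp add: g'_def)
      have "\<omega> z vs = (if K \<in> \<K> then g K z * contact_mono K z vs else 0) +
          (\<Sum>L\<in>\<K> - {K}. g L z * contact_mono L z vs)"
        using g(1) by (simp add: \<omega> sum_apply_form sum.remove)
      then show "(\<omega> + scale f x) z vs = (\<Sum>L\<in>insert K \<K>. scale (g' L) (contact_mono L)) z vs"
        using g(1) rest by (simp add: sum_apply_form sum.insert_remove K(2) g'_def algebra_simps)
    qed
    moreover have "\<forall>L\<in>insert K \<K>. sf (g' L)"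
    proof
      fix L assume L: "L \<in> insert K \<K>"
      have "sf (\<lambda>z. if K \<in> \<K> then g K z else 0)" using g(3) by (cases "K \<in> \<K>") auto
      from sf_add[OF this f] show "sf (g' L)"
        using L g(3) by (cases "L = K") (auto simp: g'_def)
    qed
    moreover have "finite (insert K \<K>)" "insert K \<K> \<subseteq> Q" using g K(1) by blast+
    ultimately show ?case by blast
  qed
  then show thesis using that by blast
qed

lemma cut_add: "cut (\<lambda>z vs. \<omega> z vs + \<eta> z vs) = cut \<omega> + cut \<eta>"
  by (auto simp: cut_def fun_eq_iff)

lemma cut_scale: "cut (\<lambda>z vs. f z * \<omega> z vs) = scale f (cut \<omega>)"
  by (auto simp: cut_def fun_eq_iff)

text \<open>The Euler operator is built from derivatives and pointwise operations, so it depends on germs only.\<close>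

lemma euler_local_cong:
  assumes "\<And>y vs. y \<in> W \<Longrightarrow> \<omega> y vs = \<eta> y vs" "z \<in> W"
  shows "euler_local n m s \<omega> z vs = euler_local n m s \<eta> z vs"
proof -
  have "foldr (total_deriv n m) L (interior_product v \<omega>) y ws =
      foldr (total_deriv n m) L (interior_product v \<eta>) y ws" if "y \<in> W" for L v y ws
    using that
  proof (induction L arbitrary: y ws)
    case Nil
    then show ?case by (simp add: interior_product_def assms(1))
  next
    case (Cons j L)
    show ?case
      unfolding foldr_Cons o_apply by (rule total_deriv_cong[OF Cons.IH Cons.prems])
  qed
  then show ?thesis
    using assms(2) by (simp add: euler_local_def wedge1_def neg_total_deriv_def)
qed

end

text \<open>The monomials here are built with the coordinate volume form instead of \<open>\<nu>\<close>, which makes the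
  calculus of the coordinate domain applicable to \<open>\<eta>\<close>.\<close>

abbreviation local_span ::
  "('m, 'e, 'f) fbundle \<Rightarrow> (nat \<times> nat multiset) list set \<Rightarrow> point set \<Rightarrow> form \<Rightarrow> bool" where
  "local_span B Q W \<eta> \<equiv> jet_open.cut W \<eta> \<in>
     lin (Collect (smooth_finite_order (bdim B) (fdim B) W)) (jet_open.contact_mono (bdim B) W ` Q)"

abbreviation chart_open :: "('m, 'e, 'f) fbundle \<Rightarrow> ('m, 'e) bchart \<Rightarrow> point set \<Rightarrow> bool" where
  "chart_open B c W \<equiv> openin (powertop_real (inf_coords B)) W \<and> W \<subseteq> jet_domain B c"

abbreviation expansion ::
  "('m, 'e, 'f) fbundle \<Rightarrow> ('m chart \<Rightarrow> form) \<Rightarrow> ('m, 'e) bchart \<Rightarrow> nat \<Rightarrow>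
   (nat \<times> nat multiset) list set \<Rightarrow> point set \<Rightarrow> form \<Rightarrow> bool" where
  "expansion B \<nu> c s Q W \<eta> \<equiv> \<exists>\<K> g. finite \<K> \<and> \<K> \<subseteq> Q \<and>
     (\<forall>K\<in>\<K>. smooth_finite_order (bdim B) (fdim B) W (g K)) \<and>
     (\<forall>y\<in>W. \<forall>vs. length vs = bdim B + s \<longrightarrow>
        \<eta> y vs = (\<Sum>K\<in>\<K>. g K y * contact_monomial B \<nu> c K y vs))"

lemma locally_spanned_iff:
  "locally_spanned B \<nu> s P \<omega> \<longleftrightarrow> (\<forall>c\<in>adapted_charts B. \<forall>z\<in>jet_domain B c. \<exists>W. chart_open B c W \<and> z \<in> W \<and>
     expansion B \<nu> c s {K \<in> contact_lists (bdim B) (fdim B) s. P K} W (\<omega> c))"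
  unfolding locally_spanned_def
  by (intro ball_cong refl arg_cong[where f = Ex] ext) (simp only: conj_ac)

lemma expansion_mono:
  assumes "expansion B \<nu> c s Q W \<eta>" "Q \<subseteq> Q'" "W' \<subseteq> W"
  shows "expansion B \<nu> c s Q' W' \<eta>"
proof -
  obtain \<K> g where "finite \<K>" "\<K> \<subseteq> Q" "\<And>K. K \<in> \<K> \<Longrightarrow> smooth_finite_order (bdim B) (fdim B) W (g K)"
    and "\<And>y vs. y \<in> W \<Longrightarrow> length vs = bdim B + s \<Longrightarrow>
      \<eta> y vs = (\<Sum>K\<in>\<K>. g K y * contact_monomial B \<nu> c K y vs)"
    using assms(1) by blast
  then show ?thesis
    using assms(2,3) smooth_finite_order_subset[OF _ assms(3)]
    by (intro exI[of _ \<K>] exI[of _ g]) blast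
qed

lemma locally_spanned_mono:
  assumes span: "locally_spanned B \<nu> s P \<omega>" and mono: "\<And>K. P K \<Longrightarrow> P' K"
  shows "locally_spanned B \<nu> s P' \<omega>"
  unfolding locally_spanned_iff
proof (intro ballI)
  fix c z assume c: "c \<in> adapted_charts B" and z: "z \<in> jet_domain B c"
  obtain W where "chart_open B c W \<and> z \<in> W \<and>
      expansion B \<nu> c s {K \<in> contact_lists (bdim B) (fdim B) s. P K} W (\<omega> c)"
    by (rule exE[OF bspec[OF bspec[OF span[unfolded locally_spanned_iff] c] z]])
  note W = conjunct1[OF this] conjunct1[OF conjunct2[OF this]] and e = conjunct2[OF conjunct2[OF this]]
  show "\<exists>W. chart_open B c W \<and> z \<in> W \<and>
      expansion B \<nu> c s {K \<in> contact_lists (bdim B) (fdim B) s. P' K} W (\<omega> c)"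
    by (intro exI[of _ W] conjI[OF W(1)] conjI[OF W(2)] expansion_mono[OF e _ order.refl]) (use mono in blast)
qed

context
  fixes B :: "('m, 'e, 'f) fbundle" and \<nu> :: "'m chart \<Rightarrow> form"
  assumes volume: "volume_form (bdim B) (base_space B) \<nu>"
begin

text \<open>The density of the volume form is a nowhere vanishing function of the base coordinates, so
  that \<open>\<nu>\<close> may be replaced by the coordinate volume form.\<close>

lemma contact_monomial_density:
  assumes c: "c \<in> adapted_charts B" and W: "chart_open B c W"
  obtains \<rho> where "smooth_finite_order (bdim B) (fdim B) W \<rho>" "\<And>z. z \<in> W \<Longrightarrow> \<rho> z \<noteq> 0"
    "\<And>z K vs. z \<in> W \<Longrightarrow>
       contact_monomial B \<nu> c K z vs = \<rho> z * jet_open.contact_mono (bdim B) W K z vs"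
proof -
  interpret jet_open "bdim B" "fdim B" W by unfold_locales (use W in blast)
  obtain U \<xi> V \<psi> where c_eq: "c = ((U, \<xi>), (V, \<psi>))" by (metis surj_pair)
  let ?C = "base_coords (bdim B)"
  have "(U, \<xi>) \<in> base_charts B" using adapted_chartsD(1)[OF c[unfolded c_eq]] .
  then obtain r where r: "smooth ?C (\<xi> ` U) r"
    "\<And>x. x \<in> \<xi> ` U \<Longrightarrow> r x \<noteq> 0" "\<And>x vs. x \<in> \<xi> ` U \<Longrightarrow> \<nu> (U, \<xi>) x vs = r x * coord_volume (bdim B) x vs"
    using volume unfolding volume_form_def by blast
  have base: "restrict z ?C \<in> \<xi> ` U" if "z \<in> W" for z
    using restrict_base_in_chart[OF c[unfolded c_eq], of z] W that c_eq by blast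
  define \<rho> where "\<rho> = (\<lambda>z. r (restrict z ?C))"
  have "smooth (inf_coords B) W \<rho>"
    unfolding \<rho>_def
    by (rule smooth_restrict[OF r(1) _ openW base]) (use base_coords_total total_coords_inf in blast)+
  moreover have "depends_upto (bdim B) (fdim B) 0 W \<rho>"
    unfolding depends_upto_def
  proof (intro ballI impI)
    fix z z' :: point assume eq: "\<forall>A\<in>total_coords B. z A = z' A"
    have "restrict z ?C = restrict z' ?C"
      by (rule restrict_ext) (use eq base_coords_total in blast)
    then show "\<rho> z = \<rho> z'" by (simp only: \<rho>_def)
  qed
  ultimately have sf: "sf \<rho>" unfolding smooth_finite_order_def by blast
  have nonzero: "\<rho> z \<noteq> 0" if "z \<in> W" for z
    unfolding \<rho>_def by (rule r(2)[OF base[OF that]])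
  have "contact_monomial B \<nu> c K z vs = \<rho> z * contact_mono K z vs" if z: "z \<in> W" for z K vs
  proof (induction K arbitrary: vs)
    case Nil
    show ?case
      using r(3)[OF base[OF z]] coord_volume_eq_vol_of[OF z, of "[0..<bdim B]" "restrict z ?C" vs]
      by (simp add: contact_monomial_def c_eq coord_volume_def \<rho>_def del: restrict_apply)
  next
    case (Cons a K)
    obtain \<alpha> I where a: "a = (\<alpha>, I)" by (cases a)
    have "contact_monomial B \<nu> c (a # K) = wedge1 (contact_form (bdim B) \<alpha> I) (contact_monomial B \<nu> c K)"
      by (simp add: contact_monomial_def a)
    then show ?case
      unfolding a contact_mono_simps by (simp add: wedge1_def Cons sum_distrib_left algebra_simps)
  qed
  then show thesis using that sf nonzero by blast
qed

lemma local_span_iff: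
  assumes c: "c \<in> adapted_charts B" and W: "chart_open B c W"
    and Q: "Q \<subseteq> contact_lists (bdim B) (fdim B) s"
    and \<eta>: "\<And>z vs. length vs \<noteq> bdim B + s \<Longrightarrow> \<eta> z vs = 0"
  shows "expansion B \<nu> c s Q W \<eta> \<longleftrightarrow> local_span B Q W \<eta>" (is "?L \<longleftrightarrow> ?R")
proof -
  interpret jet_open "bdim B" "fdim B" W by unfold_locales (use W in blast)
  obtain \<rho> where \<rho>: "sf \<rho>" "\<And>z. z \<in> W \<Longrightarrow> \<rho> z \<noteq> 0"
    "\<And>z K vs. z \<in> W \<Longrightarrow> contact_monomial B \<nu> c K z vs = \<rho> z * contact_mono K z vs"
    using contact_monomial_density[OF c W] by blast
  have valid: "Q \<subseteq> valid_lists" using Q by (auto simp: contact_lists_def)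
  show ?thesis
  proof
    assume ?L
    then obtain \<K> g where g: "finite \<K>" "\<K> \<subseteq> Q" "\<And>K. K \<in> \<K> \<Longrightarrow> sf (g K)"
      and eq: "\<And>y vs. y \<in> W \<Longrightarrow> length vs = bdim B + s \<Longrightarrow>
        \<eta> y vs = (\<Sum>K\<in>\<K>. g K y * contact_monomial B \<nu> c K y vs)" by blast
    have "(\<Sum>K\<in>\<K>. scale (\<lambda>z. g K z * \<rho> z) (contact_mono K)) \<in> SP Q" (is "?S \<in> _")
    proof (rule lin_sum)
      fix K assume K: "K \<in> \<K>"
      have "sf (\<lambda>z. g K z * \<rho> z)" by (rule sf_mult[OF g(3)[OF K] \<rho>(1)])
      then show "scale (\<lambda>z. g K z * \<rho> z) (contact_mono K) \<in> SP Q"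
        using contact_mono_lin[OF subsetD[OF g(2) K] ring_smooth]
        by (intro lin_scale_const[OF _ ring_smooth]) simp_all
    qed
    moreover have "cut \<eta> = ?S"
    proof (rule form_eqI)
      show "?S z vs = 0" if "z \<notin> W" for z vs
        using SP_forms[OF calculation valid] that by (rule forms_off)
      fix z vs assume z: "z \<in> W"
      show "cut \<eta> z vs = ?S z vs"
      proof (cases "length vs = bdim B + s")
        case True
        then show ?thesis
          using z by (simp add: cut_def eq \<rho>(3) sum_apply_form mult.assoc)
      next
        case False
        then show ?thesis using SP_length[OF calculation Q False] \<eta> by (simp add: cut_def)
      qed
    qed (simp add: cut_def)
    ultimately show ?R by (simp only:)
  next
    assume ?R
    then obtain \<K> g where g: "finite \<K>" "\<K> \<subseteq> Q" "\<And>K. K \<in> \<K> \<Longrightarrow> sf (g K)"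
      and eq: "cut \<eta> = (\<Sum>K\<in>\<K>. scale (g K) (contact_mono K))"
      by (rule SP_elim) blast
    have "sf (\<lambda>z. g K z * inverse (\<rho> z))" if "K \<in> \<K>" for K
      by (intro sf_mult sf_inverse g(3) that \<rho>)
    moreover have "\<eta> y vs = (\<Sum>K\<in>\<K>. g K y * inverse (\<rho> y) * contact_monomial B \<nu> c K y vs)"
      if y: "y \<in> W" for y vs
    proof -
      have "\<eta> y vs = cut \<eta> y vs" using y by (simp add: cut_def)
      moreover have "g K y * contact_mono K y vs = g K y * inverse (\<rho> y) * contact_monomial B \<nu> c K y vs" for K
        using \<rho>(2)[OF y] by (simp add: \<rho>(3)[OF y] field_simps)
      ultimately show ?thesis by (simp add: eq sum_apply_form)
    qed
    ultimately show ?L using g(1,2)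
      by (intro exI[of _ \<K>] exI[of _ "\<lambda>K z. g K z * inverse (\<rho> z)"]) blast
  qed
qed

lemma local_span_subset:
  assumes c: "c \<in> adapted_charts B" and W: "chart_open B c W" and W': "chart_open B c W'" "W' \<subseteq> W"
    and Q: "Q \<subseteq> contact_lists (bdim B) (fdim B) s"
    and \<eta>: "\<And>z vs. length vs \<noteq> bdim B + s \<Longrightarrow> \<eta> z vs = 0"
    and span: "local_span B Q W \<eta>"
  shows "local_span B Q W' \<eta>"
proof -
  have iff: "expansion B \<nu> c s Q V \<eta> \<longleftrightarrow> local_span B Q V \<eta>" if "chart_open B c V" for V
    by (rule local_span_iff[OF c that Q]) (rule \<eta>)
  have "expansion B \<nu> c s Q W' \<eta>"
    by (rule expansion_mono[OF iffD2[OF iff[OF W] span] order.refl W'(2)])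
  then show ?thesis by (rule iffD1[OF iff[OF W'(1)]])
qed

abbreviation filt_lists :: "nat \<Rightarrow> int \<Rightarrow> (nat \<times> nat multiset) list set" where
  "filt_lists \<equiv> jet_open.source_lists (bdim B) (fdim B)"

text \<open>For negative \<open>l\<close> no monomial is admitted, and the description of the filtration by local
  spans remains valid.\<close>

lemma filt_iff_locally_spanned:
  "\<omega> \<in> filt B \<nu> s l \<longleftrightarrow> \<omega> \<in> jet_forms B (bdim B + s) \<and> locally_spanned B \<nu> s
     (\<lambda>K. snd (hd K) = {#} \<and> int (\<Sum>(\<alpha>, I)\<leftarrow>tl K. size I) \<le> l) \<omega>"
  (is "_ \<longleftrightarrow> _ \<and> locally_spanned B \<nu> s (?P l) \<omega>")
proof (cases "l < 0")
  case True
  have zero: "\<omega> = zero_form" if \<omega>: "\<omega> \<in> jet_forms B (bdim B + s)" and span: "locally_spanned B \<nu> s (?P l) \<omega>"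
  proof (intro ext)
    fix c z vs
    show "\<omega> c z vs = zero_form c z vs"
    proof (cases "c \<in> adapted_charts B \<and> z \<in> jet_domain B c \<and> length vs = bdim B + s")
      case True
      then have c: "c \<in> adapted_charts B" and z: "z \<in> jet_domain B c" by auto
      obtain W where "z \<in> W" "expansion B \<nu> c s {K \<in> contact_lists (bdim B) (fdim B) s. ?P l K} W (\<omega> c)"
        using bspec[OF bspec[OF span[unfolded locally_spanned_iff] c] z] by blast
      moreover have "{K \<in> contact_lists (bdim B) (fdim B) s. ?P l K} = {}" using \<open>l < 0\<close> by auto
      ultimately show ?thesis using True by (auto simp: zero_form_def)
    next
      case False
      then show ?thesis using jet_formsD(1)[OF \<omega>, of c z vs] by (simp add: zero_form_def)
    qed
  qed
  have "locally_spanned B \<nu> s (?P l) zero_form"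
    unfolding locally_spanned_iff
  proof (intro ballI)
    fix c z assume "c \<in> adapted_charts B" "z \<in> jet_domain B c"
    then show "\<exists>W. chart_open B c W \<and> z \<in> W \<and>
        expansion B \<nu> c s {K \<in> contact_lists (bdim B) (fdim B) s. ?P l K} W (zero_form c)"
      using openin_jet_domain[of c B]
      by (intro exI[of _ "jet_domain B c"] conjI exI[of _ "{}"]) (auto simp: zero_form_def)
  qed
  then show ?thesis using True zero zero_form_jet_forms by (auto simp: filt_def)
next
  case False
  note weaken = locally_spanned_mono[of B \<nu> s "?P l" \<omega>]
  show ?thesis
    using False weaken[of "\<lambda>K. True"] weaken[of "\<lambda>K. snd (hd K) = {#}"]
    unfolding filt_def Omega_ns0_def Omega_ns_def by auto
qed

lemma filt_forms: "\<omega> \<in> filt B \<nu> s l \<Longrightarrow> \<omega> \<in> jet_forms B (bdim B + s)"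
  by (simp only: filt_iff_locally_spanned)

lemma filt_Omega:
  assumes "\<omega> \<in> filt B \<nu> s l"
  shows "\<omega> \<in> Omega_ns B \<nu> s"
proof -
  have "locally_spanned B \<nu> s (\<lambda>K. True) \<omega>"
    by (rule locally_spanned_mono[OF conjunct2[OF assms[unfolded filt_iff_locally_spanned]]]) (rule TrueI)
  then show ?thesis using filt_forms[OF assms] by (simp add: Omega_ns_def)
qed

lemma filt_lists_eq:
  assumes "c \<in> adapted_charts B"
  shows "{K \<in> contact_lists (bdim B) (fdim B) s. snd (hd K) = {#} \<and>
    int (\<Sum>(\<alpha>, I)\<leftarrow>tl K. size I) \<le> l} = filt_lists s l"
proof -
  interpret jet_open "bdim B" "fdim B" "jet_domain B c"
    by unfold_locales (rule openin_jet_domain[OF assms])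
  show ?thesis by (simp only: source_lists_def)
qed

lemma filt_lists_contact: "c \<in> adapted_charts B \<Longrightarrow> filt_lists s l \<subseteq> contact_lists (bdim B) (fdim B) s"
  using filt_lists_eq[of c s l] by blast

lemma filtI:
  assumes \<omega>: "\<omega> \<in> jet_forms B (bdim B + s)"
    and "\<And>c z. c \<in> adapted_charts B \<Longrightarrow> z \<in> jet_domain B c \<Longrightarrow>
      \<exists>W. chart_open B c W \<and> z \<in> W \<and> local_span B (filt_lists s l) W (\<omega> c)"
  shows "\<omega> \<in> filt B \<nu> s l"
  unfolding filt_iff_locally_spanned locally_spanned_iff
proof (intro conjI ballI \<omega>)
  fix c z assume c: "c \<in> adapted_charts B" and z: "z \<in> jet_domain B c"
  obtain W where W: "chart_open B c W" "z \<in> W" and span: "local_span B (filt_lists s l) W (\<omega> c)"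
    using assms(2)[OF c z] by blast
  have len: "\<omega> c z vs = 0" if "length vs \<noteq> bdim B + s" for z vs
    using jet_formsD(1)[OF \<omega>] that by blast
  from iffD2[OF local_span_iff[where \<eta> = "\<omega> c", OF c W(1) filt_lists_contact[OF c] len] span]
  show "\<exists>W. chart_open B c W \<and> z \<in> W \<and> expansion B \<nu> c s {K \<in> contact_lists (bdim B) (fdim B) s.
      snd (hd K) = {#} \<and> int (\<Sum>(\<alpha>, I)\<leftarrow>tl K. size I) \<le> l} W (\<omega> c)"
    unfolding filt_lists_eq[OF c] using W by blast
qed

lemma filt_local:
  assumes \<omega>: "\<omega> \<in> filt B \<nu> s l" and c: "c \<in> adapted_charts B" and z: "z \<in> jet_domain B c"
  obtains W where "chart_open B c W" "z \<in> W" "local_span B (filt_lists s l) W (\<omega> c)"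
proof -
  obtain W where W: "chart_open B c W" "z \<in> W"
    and span: "expansion B \<nu> c s (filt_lists s l) W (\<omega> c)"
    using bspec[OF bspec[OF conjunct2[OF \<omega>[unfolded filt_iff_locally_spanned], unfolded locally_spanned_iff] c] z]
    unfolding filt_lists_eq[OF c] by blast
  have len: "\<omega> c z vs = 0" if "length vs \<noteq> bdim B + s" for z vs
    using jet_formsD(1)[OF filt_forms[OF \<omega>]] that by blast
  from iffD1[OF local_span_iff[where \<eta> = "\<omega> c", OF c W(1) filt_lists_contact[OF c] len] span]
  show thesis using that W by blast
qed

lemma filt_local2:
  assumes \<omega>: "\<omega> \<in> filt B \<nu> s l" and \<eta>: "\<eta> \<in> filt B \<nu> s l"
    and c: "c \<in> adapted_charts B" and z: "z \<in> jet_domain B c"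
  obtains W where "chart_open B c W" "z \<in> W"
    "local_span B (filt_lists s l) W (\<omega> c)" "local_span B (filt_lists s l) W (\<eta> c)"
proof -
  obtain W1 where W1: "chart_open B c W1" "z \<in> W1" "local_span B (filt_lists s l) W1 (\<omega> c)"
    using filt_local[OF \<omega> c z] by blast
  obtain W2 where W2: "chart_open B c W2" "z \<in> W2" "local_span B (filt_lists s l) W2 (\<eta> c)"
    using filt_local[OF \<eta> c z] by blast
  have W: "chart_open B c (W1 \<inter> W2)" using W1(1) W2(1) by (auto intro: openin_Int)
  have "local_span B (filt_lists s l) (W1 \<inter> W2) (\<omega> c)"
    by (rule local_span_subset[OF c W1(1) W _ filt_lists_contact[OF c] _ W1(3)])
      (use jet_formsD(1)[OF filt_forms[OF \<omega>]] in blast)+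
  moreover have "local_span B (filt_lists s l) (W1 \<inter> W2) (\<eta> c)"
    by (rule local_span_subset[OF c W2(1) W _ filt_lists_contact[OF c] _ W2(3)])
      (use jet_formsD(1)[OF filt_forms[OF \<eta>]] in blast)+
  ultimately show thesis using that[OF W] W1 W2 by blast
qed

text \<open>Membership in the filtration can be checked on the coordinate domains over which a given form of
  the filtration has an expansion in monomials.\<close>

lemma filt_transfer:
  assumes \<omega>: "\<omega> \<in> filt B \<nu> s l" and \<eta>: "\<eta> \<in> jet_forms B (bdim B + s)"
    and "\<And>c W. c \<in> adapted_charts B \<Longrightarrow> chart_open B c W \<Longrightarrow>
      local_span B (filt_lists s l) W (\<omega> c) \<Longrightarrow> local_span B (filt_lists s l') W (\<eta> c)"
  shows "\<eta> \<in> filt B \<nu> s l'"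
proof (rule filtI[OF \<eta>])
  fix c z assume c: "c \<in> adapted_charts B" and z: "z \<in> jet_domain B c"
  obtain W where "chart_open B c W" "z \<in> W" "local_span B (filt_lists s l) W (\<omega> c)"
    using filt_local[OF \<omega> c z] by blast
  then show "\<exists>W. chart_open B c W \<and> z \<in> W \<and> local_span B (filt_lists s l') W (\<eta> c)"
    using assms(3)[OF c] by blast
qed

lemma filt_add:
  assumes "\<omega> \<in> filt B \<nu> s l" "\<eta> \<in> filt B \<nu> s l"
  shows "(\<lambda>c z vs. \<omega> c z vs + \<eta> c z vs) \<in> filt B \<nu> s l"
proof (rule filtI)
  show "(\<lambda>c z vs. \<omega> c z vs + \<eta> c z vs) \<in> jet_forms B (bdim B + s)"
    using assms filt_forms by (intro jet_forms_add)
  fix c z assume c: "c \<in> adapted_charts B" and z: "z \<in> jet_domain B c"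
  obtain W where W: "chart_open B c W" "z \<in> W"
    "local_span B (filt_lists s l) W (\<omega> c)" "local_span B (filt_lists s l) W (\<eta> c)"
    using filt_local2[OF assms c z] by blast
  interpret jet_open "bdim B" "fdim B" W by unfold_locales (use W in blast)
  have "local_span B (filt_lists s l) W (\<lambda>z vs. \<omega> c z vs + \<eta> c z vs)"
    unfolding cut_add by (rule lin_add[OF W(4,3)])
  then show "\<exists>W. chart_open B c W \<and> z \<in> W \<and>
      local_span B (filt_lists s l) W (\<lambda>z vs. \<omega> c z vs + \<eta> c z vs)" using W by blast
qed

lemma jet_function_local:
  assumes "f \<in> jet_functions B" "c \<in> adapted_charts B" "W \<subseteq> jet_domain B c"
  shows "smooth_finite_order (bdim B) (fdim B) W (f c)"
proof -
  have "smooth_finite_order (bdim B) (fdim B) (jet_domain B c) (f c)"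
    using jet_functions_order[OF assms(1)] assms(2) unfolding smooth_finite_order_def by metis
  then show ?thesis by (rule smooth_finite_order_subset[OF _ assms(3)])
qed

lemma filt_smult:
  assumes f: "f \<in> jet_functions B" and \<omega>: "\<omega> \<in> filt B \<nu> s l"
  shows "(\<lambda>c z vs. f c z * \<omega> c z vs) \<in> filt B \<nu> s l"
proof (rule filt_transfer[OF \<omega> jet_forms_smult[OF f filt_forms[OF \<omega>]]])
  fix c W assume c: "c \<in> adapted_charts B" and W: "chart_open B c W"
    and span: "local_span B (filt_lists s l) W (\<omega> c)"
  interpret jet_open "bdim B" "fdim B" W by unfold_locales (use W in blast)
  have "f c \<in> Collect sf" using jet_function_local[OF f c] W by blast
  then show "local_span B (filt_lists s l) W (\<lambda>z vs. f c z * \<omega> c z vs)"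
    unfolding cut_scale by (rule lin_scale_const[OF span ring_smooth])
qed

lemma filt_mono:
  assumes "l \<le> l'"
  shows "filt B \<nu> s l \<subseteq> filt B \<nu> s l'"
proof
  fix \<omega> assume \<omega>: "\<omega> \<in> filt B \<nu> s l"
  have "locally_spanned B \<nu> s (\<lambda>K. snd (hd K) = {#} \<and> int (\<Sum>(\<alpha>, I)\<leftarrow>tl K. size I) \<le> l') \<omega>"
    by (rule locally_spanned_mono[OF conjunct2[OF \<omega>[unfolded filt_iff_locally_spanned]]])
      (use assms in auto)
  then show "\<omega> \<in> filt B \<nu> s l'" using filt_forms[OF \<omega>] by (simp only: filt_iff_locally_spanned)
qed

lemma zero_form_filt: "zero_form \<in> filt B \<nu> s l"
proof -
  have "zero_form \<in> filt B \<nu> s (- 1)" by (simp add: filt_def)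
  then show ?thesis
    using filt_mono[of "- 1" l s] by (cases "l < 0") (auto simp: filt_def)
qed

lemma const_smult:
  assumes "\<omega> \<in> filt B \<nu> s l"
  shows "(\<lambda>c z vs. const_jfun B a c z * \<omega> c z vs) = (\<lambda>c z vs. a * \<omega> c z vs)"
proof (intro ext)
  fix c z vs
  show "const_jfun B a c z * \<omega> c z vs = a * \<omega> c z vs"
    using jet_formsD(1)[OF filt_forms[OF assms], of c z vs] by (auto simp: const_jfun_def)
qed

lemma filt_minus:
  assumes "\<omega> \<in> filt B \<nu> s l"
  shows "(\<lambda>c z vs. - 1 * \<omega> c z vs) \<in> filt B \<nu> s l"
  using filt_smult[OF const_jfun_jet_functions assms, of "- 1"] unfolding const_smult[OF assms] .

lemma filt_module_is_module: "Module.module (jet_ring B) (filt_module B \<nu> s l)"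
proof (rule moduleI)
  show "abelian_group (filt_module B \<nu> s l)"
  proof (rule abelian_groupI)
    fix \<omega> assume "\<omega> \<in> carrier (filt_module B \<nu> s l)"
    then have "(\<lambda>c z vs. - 1 * \<omega> c z vs) \<in> filt B \<nu> s l"
      by (intro filt_minus) (simp add: filt_module_def)
    then show "\<exists>\<eta>\<in>carrier (filt_module B \<nu> s l). \<eta> \<oplus>\<^bsub>filt_module B \<nu> s l\<^esub> \<omega> = \<zero>\<^bsub>filt_module B \<nu> s l\<^esub>"
      by (intro bexI[of _ "\<lambda>c z vs. - 1 * \<omega> c z vs"]) (simp_all add: filt_module_def zero_form_def)
  qed (use zero_form_filt in \<open>auto simp: filt_module_def filt_add zero_form_def add_ac\<close>)
  show "\<one>\<^bsub>jet_ring B\<^esub> \<odot>\<^bsub>filt_module B \<nu> s l\<^esub> \<omega> = \<omega>" if "\<omega> \<in> carrier (filt_module B \<nu> s l)" for \<omega>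
    using const_smult[of \<omega> s l 1] that by (simp add: filt_module_def jet_ring_def const_jfun_def)
qed (rule cring_jet_ring, auto simp: filt_module_def jet_ring_def filt_smult algebra_simps)

lemma quotient_by_filt: "quotient_by_submodule (jet_ring B) (filt_module B \<nu> s l) (filt B \<nu> s (l - 1))"
proof -
  interpret F: Module.module "jet_ring B" "filt_module B \<nu> s l" by (rule filt_module_is_module)
  show ?thesis
  proof (rule quotient_by_submodule.intro)
    show "Module.module (jet_ring B) (filt_module B \<nu> s l)" by (rule filt_module_is_module)
    show sub: "filt B \<nu> s (l - 1) \<subseteq> carrier (filt_module B \<nu> s l)"
      using filt_mono[of "l - 1" l] by (simp add: filt_module_def)
    fix \<omega> assume \<omega>: "\<omega> \<in> filt B \<nu> s (l - 1)"
    have "\<ominus>\<^bsub>filt_module B \<nu> s l\<^esub> \<omega> = (\<lambda>c z vs. - 1 * \<omega> c z vs)"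
    proof (rule F.minus_equality)
      show "\<omega> \<in> carrier (filt_module B \<nu> s l)" using \<omega> sub by blast
      show "(\<lambda>c z vs. - 1 * \<omega> c z vs) \<in> carrier (filt_module B \<nu> s l)"
        using filt_minus[OF \<omega>] sub by blast
    qed (simp add: filt_module_def zero_form_def)
    then show "\<ominus>\<^bsub>filt_module B \<nu> s l\<^esub> \<omega> \<in> filt B \<nu> s (l - 1)" using filt_minus[OF \<omega>] by simp
  qed (auto simp: filt_module_def jet_ring_def zero_form_filt filt_add filt_smult)
qed

section \<open>The interior Euler operator on the filtration\<close>

context
  fixes Eul :: "('m, 'e) jform \<Rightarrow> ('m, 'e) jform" and r :: nat
  assumes euler: "interior_euler_operator B \<nu> (Suc r) Eul"
begin

lemma Eul_forms: "\<omega> \<in> filt B \<nu> (Suc r) l \<Longrightarrow> Eul \<omega> \<in> jet_forms B (bdim B + Suc r)"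
  using euler filt_Omega unfolding interior_euler_operator_def Omega_ns_def by blast

text \<open>The formula for \<open>Eul\<close> concerns lists of \<open>n + r + 1\<close> vectors. On lists of any other length both sides
  vanish, the right-hand one because it is again a combination of monomials with \<open>r + 1\<close> contact
  factors.\<close>

lemma Eul_local:
  assumes \<omega>: "\<omega> \<in> filt B \<nu> (Suc r) l" and c: "c \<in> adapted_charts B"
    and W: "chart_open B c W"
    and span: "local_span B (filt_lists (Suc r) l) W (\<omega> c)"
  shows "jet_open.cut W (Eul \<omega> c) = jet_open.E (bdim B) (fdim B) W (Suc r) (jet_open.cut W (\<omega> c))"
proof -
  interpret jet_open "bdim B" "fdim B" W by unfold_locales (use W in blast)
  have E_span: "E (Suc r) (cut (\<omega> c)) \<in> SP (source_lists (Suc r) l)"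
    by (rule E_lin[OF lin_subset[OF span source_lists_weight] ring_smooth])
  show ?thesis
  proof (rule form_eqI)
    fix z vs assume z: "z \<in> W"
    show "cut (Eul \<omega> c) z vs = E (Suc r) (cut (\<omega> c)) z vs"
    proof (cases "length vs = bdim B + Suc r")
      case True
      have "Eul \<omega> c z vs = euler_local (bdim B) (fdim B) (Suc r) (\<omega> c) z vs"
        using euler filt_Omega[OF \<omega>] c z W True unfolding interior_euler_operator_def by blast
      also have "\<dots> = euler_local (bdim B) (fdim B) (Suc r) (cut (\<omega> c)) z vs"
        by (rule euler_local_cong[OF _ z]) (simp add: cut_def)
      finally show ?thesis using z by (simp add: E_def cut_def)
    next
      case False
      then show ?thesis
        using jet_formsD(1)[OF Eul_forms[OF \<omega>], of c z vs]
          SP_length[OF E_span filt_lists_contact[OF c] False] by (simp add: cut_def)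
    qed
  qed (simp_all add: cut_def E_def)
qed

lemma Eul_filt:
  assumes \<omega>: "\<omega> \<in> filt B \<nu> (Suc r) l"
  shows "Eul \<omega> \<in> filt B \<nu> (Suc r) l"
proof (rule filt_transfer[OF \<omega> Eul_forms[OF \<omega>]])
  fix c W assume c: "c \<in> adapted_charts B" and W: "chart_open B c W"
    and span: "local_span B (filt_lists (Suc r) l) W (\<omega> c)"
  interpret jet_open "bdim B" "fdim B" W by unfold_locales (use W in blast)
  show "local_span B (filt_lists (Suc r) l) W (Eul \<omega> c)"
    unfolding Eul_local[OF \<omega> c W span]
    by (rule E_lin[OF lin_subset[OF span source_lists_weight] ring_smooth])
qed

lemma Eul_add:
  assumes \<omega>: "\<omega> \<in> filt B \<nu> (Suc r) l" and \<eta>: "\<eta> \<in> filt B \<nu> (Suc r) l"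
  shows "Eul (\<lambda>c z vs. \<omega> c z vs + \<eta> c z vs) = (\<lambda>c z vs. Eul \<omega> c z vs + Eul \<eta> c z vs)"
proof (intro ext)
  fix c z vs
  note sum = filt_add[OF \<omega> \<eta>]
  show "Eul (\<lambda>c z vs. \<omega> c z vs + \<eta> c z vs) c z vs = Eul \<omega> c z vs + Eul \<eta> c z vs"
  proof (cases "c \<in> adapted_charts B \<and> z \<in> jet_domain B c")
    case True
    then have c: "c \<in> adapted_charts B" and z: "z \<in> jet_domain B c" by auto
    obtain W where W: "chart_open B c W" "z \<in> W"
      and s: "local_span B (filt_lists (Suc r) l) W (\<omega> c)" "local_span B (filt_lists (Suc r) l) W (\<eta> c)"
      using filt_local2[OF \<omega> \<eta> c z] by blast
    interpret jet_open "bdim B" "fdim B" W by unfold_locales (use W in blast)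
    have s_sum: "local_span B (filt_lists (Suc r) l) W (\<lambda>z vs. \<omega> c z vs + \<eta> c z vs)"
      unfolding cut_add by (rule lin_add[OF s(2,1)])
    have valid: "source_lists (Suc r) l \<subseteq> valid_lists"
      using source_lists_weight weight_lists_valid by (rule order.trans)
    have "cut (Eul (\<lambda>c z vs. \<omega> c z vs + \<eta> c z vs) c) = E (Suc r) (cut (\<omega> c) + cut (\<eta> c))"
      using Eul_local[OF sum c W(1) s_sum] by (simp only: cut_add)
    also have "\<dots> = E (Suc r) (cut (\<omega> c)) + E (Suc r) (cut (\<eta> c))"
      using s valid by (intro E_add lin_subset[OF s(1)] lin_subset[OF s(2)])
    also have "\<dots> = cut (Eul \<omega> c) + cut (Eul \<eta> c)"
      by (simp only: Eul_local[OF \<omega> c W(1) s(1)] Eul_local[OF \<eta> c W(1) s(2)])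
    finally have "cut (Eul (\<lambda>c z vs. \<omega> c z vs + \<eta> c z vs) c) z vs = (cut (Eul \<omega> c) + cut (Eul \<eta> c)) z vs"
      by (simp only:)
    then show ?thesis using W(2) by (simp add: cut_def)
  next
    case False
    then have off: "c \<notin> adapted_charts B \<or> z \<notin> jet_domain B c \<or> length vs \<noteq> bdim B + Suc r" by blast
    show ?thesis
      unfolding jet_formsD(1)[OF Eul_forms[OF sum] off] jet_formsD(1)[OF Eul_forms[OF \<omega>] off]
        jet_formsD(1)[OF Eul_forms[OF \<eta>] off] by simp
  qed
qed

lemma Eul_smult_defect:
  assumes f: "f \<in> jet_functions B" and \<omega>: "\<omega> \<in> filt B \<nu> (Suc r) l"
  shows "(\<lambda>c z vs. Eul (\<lambda>c z vs. f c z * \<omega> c z vs) c z vs + - 1 * (f c z * Eul \<omega> c z vs))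
    \<in> filt B \<nu> (Suc r) (l - 1)"
proof (rule filt_transfer[OF \<omega>])
  note f\<omega> = filt_smult[OF f \<omega>]
  note fE = filt_smult[OF f Eul_filt[OF \<omega>]]
  show "(\<lambda>c z vs. Eul (\<lambda>c z vs. f c z * \<omega> c z vs) c z vs + - 1 * (f c z * Eul \<omega> c z vs))
      \<in> jet_forms B (bdim B + Suc r)"
    by (rule jet_forms_add[OF Eul_forms[OF f\<omega>] filt_forms[OF filt_minus[OF fE]]])
  fix c W assume c: "c \<in> adapted_charts B" and W: "chart_open B c W"
    and span: "local_span B (filt_lists (Suc r) l) W (\<omega> c)"
  interpret jet_open "bdim B" "fdim B" W by unfold_locales (use W in blast)
  have sf: "sf (f c)" by (rule jet_function_local[OF f c conjunct2[OF W]])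
  have span_f: "local_span B (filt_lists (Suc r) l) W (\<lambda>z vs. f c z * \<omega> c z vs)"
    unfolding cut_scale by (rule lin_scale_const[OF span ring_smooth]) (simp add: sf)
  have "cut (\<lambda>z vs. Eul (\<lambda>c z vs. f c z * \<omega> c z vs) c z vs + - 1 * (f c z * Eul \<omega> c z vs)) =
      E (Suc r) (scale (f c) (cut (\<omega> c))) - scale (f c) (E (Suc r) (cut (\<omega> c)))"
    unfolding cut_add cut_scale Eul_local[OF f\<omega> c W(1) span_f] Eul_local[OF \<omega> c W(1) span]
      scale_minus_one by (simp only: diff_conv_add_uminus)
  then show "local_span B (filt_lists (Suc r) (l - 1)) W
      (\<lambda>z vs. Eul (\<lambda>c z vs. f c z * \<omega> c z vs) c z vs + - 1 * (f c z * Eul \<omega> c z vs))"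
    using E_scale_defect[OF lin_subset[OF span source_lists_weight] sf] by (simp only:)
qed

lemma Eul_idempotent_defect:
  assumes \<omega>: "\<omega> \<in> filt B \<nu> (Suc r) l"
  shows "(\<lambda>c z vs. Eul (Eul \<omega>) c z vs + - 1 * Eul \<omega> c z vs) \<in> filt B \<nu> (Suc r) (l - 1)"
proof (rule filt_transfer[OF \<omega>])
  note E\<omega> = Eul_filt[OF \<omega>]
  show "(\<lambda>c z vs. Eul (Eul \<omega>) c z vs + - 1 * Eul \<omega> c z vs) \<in> jet_forms B (bdim B + Suc r)"
    by (rule jet_forms_add[OF Eul_forms[OF E\<omega>] filt_forms[OF filt_minus[OF E\<omega>]]])
  fix c W assume c: "c \<in> adapted_charts B" and W: "chart_open B c W"
    and span: "local_span B (filt_lists (Suc r) l) W (\<omega> c)"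
  interpret jet_open "bdim B" "fdim B" W by unfold_locales (use W in blast)
  have span_E: "local_span B (filt_lists (Suc r) l) W (Eul \<omega> c)"
    unfolding Eul_local[OF \<omega> c W(1) span]
    by (rule E_lin[OF lin_subset[OF span source_lists_weight] ring_smooth])
  have "cut (\<lambda>z vs. Eul (Eul \<omega>) c z vs + - 1 * Eul \<omega> c z vs) =
      E (Suc r) (E (Suc r) (cut (\<omega> c))) - E (Suc r) (cut (\<omega> c))"
    unfolding cut_add cut_scale Eul_local[OF E\<omega> c W(1) span_E] Eul_local[OF \<omega> c W(1) span]
      scale_minus_one by (simp only: diff_conv_add_uminus)
  then show "local_span B (filt_lists (Suc r) (l - 1)) W (\<lambda>z vs. Eul (Eul \<omega>) c z vs + - 1 * Eul \<omega> c z vs)"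
    using E_idempotent_defect[OF lin_subset[OF span source_lists_weight]] by (simp only:)
qed

lemma gr_map_properties:
  shows "\<forall>\<omega>\<in>filt B \<nu> (Suc r) l. gr_map B \<nu> (Suc r) l Eul (filt_coset B \<nu> (Suc r) l \<omega>) =
      filt_coset B \<nu> (Suc r) l (Eul \<omega>)"
    and "module_homomorphism (jet_ring B) (gr_module B \<nu> (Suc r) l) (gr_module B \<nu> (Suc r) l)
      (gr_map B \<nu> (Suc r) l Eul)"
    and "\<forall>Q\<in>carrier (gr_module B \<nu> (Suc r) l).
      gr_map B \<nu> (Suc r) l Eul (gr_map B \<nu> (Suc r) l Eul Q) = gr_map B \<nu> (Suc r) l Eul Q"
proof -
  let ?X = "filt_module B \<nu> (Suc r) l" and ?N = "filt B \<nu> (Suc r) (l - 1)"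
  interpret quotient_by_submodule "jet_ring B" ?X ?N by (rule quotient_by_filt)
  have carrier: "carrier ?X = filt B \<nu> (Suc r) l" by (simp add: filt_module_def)
  have add: "\<omega> \<oplus>\<^bsub>?X\<^esub> \<eta> = (\<lambda>c z vs. \<omega> c z vs + \<eta> c z vs)" for \<omega> \<eta>
    by (simp add: filt_module_def)
  have smult: "f \<odot>\<^bsub>?X\<^esub> \<omega> = (\<lambda>c z vs. f c z * \<omega> c z vs)" for f \<omega>
    by (simp add: filt_module_def)
  have gr: "gr_map B \<nu> (Suc r) l Eul = (\<lambda>Q. \<Union>\<omega>\<in>Q. ?N +>\<^bsub>?X\<^esub> Eul \<omega>)"
    by (simp add: gr_map_def filt_coset_def fun_eq_iff)
  have h_smult: "\<exists>k\<in>?N. Eul (f \<odot>\<^bsub>?X\<^esub> \<omega>) = k \<oplus>\<^bsub>?X\<^esub> f \<odot>\<^bsub>?X\<^esub> Eul \<omega>"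
    if "f \<in> carrier (jet_ring B)" "\<omega> \<in> carrier ?X" for f \<omega>
    unfolding add smult
    by (rule bexI[OF _ Eul_smult_defect]) (use that in \<open>simp_all add: carrier jet_ring_def\<close>)
  have h_idem: "\<exists>k\<in>?N. Eul (Eul \<omega>) = k \<oplus>\<^bsub>?X\<^esub> Eul \<omega>" if "\<omega> \<in> carrier ?X" for \<omega>
    unfolding add by (rule bexI[OF _ Eul_idempotent_defect]) (use that in \<open>simp_all add: carrier\<close>)
  have closed: "Eul \<omega> \<in> carrier ?X" if "\<omega> \<in> carrier ?X" for \<omega>
    using that Eul_filt unfolding carrier by blast
  have additive: "Eul (\<omega> \<oplus>\<^bsub>?X\<^esub> \<eta>) = Eul \<omega> \<oplus>\<^bsub>?X\<^esub> Eul \<eta>" if "\<omega> \<in> carrier ?X" "\<eta> \<in> carrier ?X" for \<omega> \<eta>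
    using that Eul_add unfolding add carrier by blast
  show "\<forall>\<omega>\<in>filt B \<nu> (Suc r) l. gr_map B \<nu> (Suc r) l Eul (filt_coset B \<nu> (Suc r) l \<omega>) =
      filt_coset B \<nu> (Suc r) l (Eul \<omega>)"
    unfolding carrier[symmetric] filt_coset_def gr
    by (rule quotient_map_properties(1)) (rule closed additive Eul_filt h_smult h_idem; assumption)+
  show "module_homomorphism (jet_ring B) (gr_module B \<nu> (Suc r) l) (gr_module B \<nu> (Suc r) l)
      (gr_map B \<nu> (Suc r) l Eul)"
    unfolding gr_module_def gr
    by (rule quotient_map_properties(2)) (rule closed additive Eul_filt h_smult h_idem; assumption)+
  show "\<forall>Q\<in>carrier (gr_module B \<nu> (Suc r) l).
      gr_map B \<nu> (Suc r) l Eul (gr_map B \<nu> (Suc r) l Eul Q) = gr_map B \<nu> (Suc r) l Eul Q"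
    unfolding gr_module_def gr
    by (rule quotient_map_properties(3)) (rule closed additive Eul_filt h_smult h_idem; assumption)+
qed

end

end

theorem proposition3p1:
  fixes B :: "('m, 'e, 'f) fbundle"
    and \<nu> :: "'m chart \<Rightarrow> form"
    and s :: nat
    and Eul :: "('m, 'e) jform \<Rightarrow> ('m, 'e) jform"
  assumes "smooth_fibre_bundle B"
    and "volume_form (bdim B) (base_space B) \<nu>"
    and "s \<ge> 1"
    and "interior_euler_operator B \<nu> s Eul"
  shows "(\<forall>l::nat. Eul ` filt B \<nu> s (int l) \<subseteq> filt B \<nu> s (int l)) \<and>
    (\<forall>l::nat.
       (\<forall>\<omega>\<in>filt B \<nu> s (int l).
          gr_map B \<nu> s (int l) Eul (filt_coset B \<nu> s (int l) \<omega>) =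
          filt_coset B \<nu> s (int l) (Eul \<omega>)) \<and>
       module_homomorphism (jet_ring B) (gr_module B \<nu> s (int l)) (gr_module B \<nu> s (int l))
         (gr_map B \<nu> s (int l) Eul) \<and>
       (\<forall>Q\<in>carrier (gr_module B \<nu> s (int l)).
          gr_map B \<nu> s (int l) Eul (gr_map B \<nu> s (int l) Eul Q) =
          gr_map B \<nu> s (int l) Eul Q))"
proof -
  obtain r where s: "s = Suc r" using assms(3) by (cases s) auto
  note euler = assms(4)[unfolded s]
  show ?thesis
    unfolding s
    using Eul_filt[OF assms(2) euler] gr_map_properties[OF assms(2) euler] by blast
qed

end
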